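(* Consider the random LSV maps $(T_\omega)_{\omega\in\Omega}$ of the context, with $\operatorname{ess\,sup}_{\omega}\beta(\omega)<1$ and $\gamma>0$ such that $\mathbb P(\beta(\omega)\le\gamma)>0$. Let $\gamma<1/2$ and $p,s\ge1$. Suppose that the $\alpha$-mixing coefficients of the process $(\beta\circ\sigma^i)_{i\in\mathbb Z}$ satisfy $$\alpha(n)=O\big(n^{-q+1}\log^{-\iota}(n)\big)\quad\text{with}\quad\iota>q\quad\text{and}\quad q>\frac ps\Big(\frac1\gamma-1\Big)+2.$$ Then there exists $B_s\in L^p(\Omega,\mathcal F,\mathbb P)$ such that for any integers $0\le r\le i<j$, for $\mathbb P$-a.e. $\omega\in\Omega$ and for all Lipschitz $g_1,g_2:M\to\mathbb R$, $$\Big\|\Big[L_{\sigma^i\omega}^{j-i}\big(g_2\,L_{\sigma^r\omega}^{i-r}(g_1)\big)\Big]_{\sigma^j\omega}\Big\|_{L^s(\mu_{\sigma^j\omega})}\le C(1+\|g_1\|_{\mathrm{Lip}})(1+\|g_2\|_{\mathrm{Lip}})\,B_s(\sigma^i\omega)\,(j-i)^{-\frac1s(\frac1\gamma-1)},$$ where $C$ is a constant depending only on $s,p,q$ and the random dynamical system.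
   Context: $(\Omega,\mathcal F,\mathbb P)$ is a probability space with an invertible ergodic $\mathbb P$-preserving transformation $\sigma$. $M=[0,1]$, $m$ is Lebesgue measure. For $\beta\in(0,1)$ the LSV map is $T_\beta(x)=x(1+2^\beta x^\beta)$ for $0\le x<1/2$ and $T_\beta(x)=2x-1$ for $1/2\le x\le1$. $\beta:\Omega\to(0,1)$ is measurable, $T_\omega:=T_{\beta(\omega)}$, $T_\omega^n:=T_{\sigma^{n-1}\omega}\circ\cdots\circ T_{\sigma\omega}\circ T_\omega$. $\mathcal L_\omega$ is the transfer operator of $T_\omega$ with respect to $m$: $\mathcal L_\omega\varphi(x)=\sum_{T_\omega(y)=x}\varphi(y)/T_\omega'(y)$; $\mathcal L_\omega^n:=\mathcal L_{\sigma^{n-1}\omega}\circ\cdots\circ\mathcal L_\omega$. The cocycle has a unique random absolutely continuous invariant measure $(\mu_\omega)_{\omega}$: $d\mu_\omega=h_\omega\,dm$, $(T_\omega)_*\mu_\omega=\mu_{\sigma\omega}$ for $\mathbb P$-a.e. $\omega$, with $h_\omega=\lim_{n\to\infty}\mathcal L_{\sigma^{-n}\omega}^n1$ in $L^1(m)$. $L_\omega:L^1(\mu_\omega)\to L^1(\mu_{\sigma\omega})$ is $L_\omega\varphi=\mathcal L_\omega(\varphi h_\omega)/h_{\sigma\omega}$, $L_\omega^n:=L_{\sigma^{n-1}\omega}\circ\cdots\circ L_\omega$, $L_\omega^0=\mathrm{Id}$. $[g]_\omega:=g-\mu_\omega(g)$; $\|\cdot\|_{\mathrm{Lip}}$ is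 the usual Lipschitz norm (supremum norm plus Lipschitz constant). The $\alpha$-mixing coefficients of $(\beta\circ\sigma^i)_{i\in\mathbb Z}$ are $\alpha(n)=\sup_{i\in\mathbb Z}\{|\mathbb P(A\cap B)-\mathbb P(A)\mathbb P(B)|:A\in\mathcal F_{-\infty,i},\,B\in\mathcal F_{i+n,\infty}\}$, where $\mathcal F_{-\infty,i}$ is generated by $(\beta\circ\sigma^j)_{j\le i}$ and $\mathcal F_{i,\infty}$ by $(\beta\circ\sigma^j)_{j\ge i}$. "Random dynamical system" refers to the data $(\Omega,\mathcal F,\mathbb P,\sigma)$, $\beta(\cdot)$ and $\gamma$. *)

theory Defs
  imports "HOL-Probability.Probability" "HOL-Library.Landau_Symbols"
begin

section \<open>The driving system\<close>

locale invertible_ergodic = prob_space P for P :: "'w measure" +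
  fixes \<sigma> :: "'w \<Rightarrow> 'w"
  assumes bij: "bij_betw \<sigma> (space P) (space P)"
    and measurable_map: "\<sigma> \<in> P \<rightarrow>\<^sub>M P"
    and measurable_inverse: "the_inv_into (space P) \<sigma> \<in> P \<rightarrow>\<^sub>M P"
    and measure_preserving: "distr P P \<sigma> = P"
    and ergodic: "\<And>A. A \<in> sets P \<Longrightarrow> \<sigma> -` A \<inter> space P = A \<Longrightarrow> prob A = 0 \<or> prob A = 1"

definition int_iterate :: "'w measure \<Rightarrow> ('w \<Rightarrow> 'w) \<Rightarrow> int \<Rightarrow> 'w \<Rightarrow> 'w" where
  "int_iterate P \<sigma> k =
     (if 0 \<le> k then \<sigma> ^^ nat k else the_inv_into (space P) \<sigma> ^^ nat (- k))"

definition events_from :: "'w measure \<Rightarrow> ('w \<Rightarrow> 'w) \<Rightarrow> ('w \<Rightarrow> real) \<Rightarrow> int set \<Rightarrow> 'w set set" where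
  "events_from P \<sigma> \<beta> J = sigma_sets (space P)
     {(\<lambda>\<omega>. \<beta> (int_iterate P \<sigma> j \<omega>)) -` A \<inter> space P | j A. j \<in> J \<and> A \<in> sets borel}"

definition alpha_mixing :: "'w measure \<Rightarrow> ('w \<Rightarrow> 'w) \<Rightarrow> ('w \<Rightarrow> real) \<Rightarrow> nat \<Rightarrow> real" where
  "alpha_mixing P \<sigma> \<beta> n =
     Sup {\<bar>measure P (A \<inter> B) - measure P A * measure P B\<bar> | i A B.
            A \<in> events_from P \<sigma> \<beta> {..i} \<and> B \<in> events_from P \<sigma> \<beta> {i + int n..}}"

section \<open>Maps and transfer operators\<close>

text \<open>Functions on the unit interval are represented by functions on the reals; all notions below
  only look at their values on \<open>{0..1}\<close>.\<close>

definition leb01 :: "real measure" where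
  "leb01 = restrict_space lborel {0..1}"

definition lsv :: "real \<Rightarrow> real \<Rightarrow> real" where
  "lsv b x = (if x < 1/2 then x * (1 + 2 powr b * x powr b) else 2 * x - 1)"

text \<open>The derivative of each branch, extended to the branch end points by the one-sided
  derivative; see the two lemmas after the definition.\<close>

definition lsv_deriv :: "real \<Rightarrow> real \<Rightarrow> real" where
  "lsv_deriv b x = (if x < 1/2 then 1 + (1 + b) * 2 powr b * x powr b else 2)"

lemma lsv_deriv_left:
  assumes b: "0 < b" and x: "0 \<le> x" "x < 1/2"
  shows "(lsv b has_real_derivative lsv_deriv b x) (at x within {0..1})"
proof -
  have "((\<lambda>x. x * (1 + 2 powr b * x powr b)) has_real_derivative lsv_deriv b x) (at x within {0..1})"
  proof (cases "x = 0")
    case True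
    have "((\<lambda>y. y powr b) \<longlongrightarrow> 0 powr b) (at (0::real) within {0..1})"
      by (rule tendsto_powr'[OF tendsto_ident_at tendsto_const])
        (use b in \<open>auto simp: eventually_at_filter\<close>)
    then have "((\<lambda>y. 1 + 2 powr b * y powr b) \<longlongrightarrow> 1 + 2 powr b * 0 powr b) (at (0::real) within {0..1})"
      by (intro tendsto_add tendsto_mult tendsto_const)
    moreover have "\<forall>\<^sub>F y in at (0::real) within {0..1}.
        1 + 2 powr b * y powr b = (y * (1 + 2 powr b * y powr b) - 0) / (y - 0)"
      by (auto simp: eventually_at_filter)
    ultimately have "((\<lambda>y. (y * (1 + 2 powr b * y powr b) - 0) / (y - 0)) \<longlongrightarrow> 1) (at (0::real) within {0..1})"
      by (auto intro: Lim_transform_eventually)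
    then show ?thesis
      using True by (simp add: has_field_derivative_iff lsv_deriv_def)
  next
    case False
    with x have "x > 0" by simp
    then show ?thesis
      using x by (auto intro!: derivative_eq_intros simp: lsv_deriv_def powr_diff field_simps)
  qed
  then show ?thesis
    by (rule has_field_derivative_transform_within[where d = "1/2 - x"])
      (use x in \<open>auto simp: lsv_def dist_real_def\<close>)
qed

lemma lsv_deriv_right:
  assumes "1/2 \<le> x" "x \<le> 1"
  shows "(lsv b has_real_derivative lsv_deriv b x) (at x within {1/2..1})"
proof -
  have "((\<lambda>x. 2 * x - 1) has_real_derivative lsv_deriv b x) (at x within {1/2..1})"
    using assms by (auto intro!: derivative_eq_intros simp: lsv_deriv_def)
  then show ?thesis
    by (rule has_field_derivative_transform_within[where d = 1])
      (use assms in \<open>auto simp: lsv_def\<close>)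
qed

definition transfer :: "real \<Rightarrow> (real \<Rightarrow> real) \<Rightarrow> real \<Rightarrow> real" where
  "transfer b \<phi> x = (\<Sum>y\<in>{y\<in>{0..1}. lsv b y = x}. \<phi> y / lsv_deriv b y)"

primrec cocycle_iterate :: "('w \<Rightarrow> 'w) \<Rightarrow> ('w \<Rightarrow> 'a \<Rightarrow> 'a) \<Rightarrow> nat \<Rightarrow> 'w \<Rightarrow> 'a \<Rightarrow> 'a" where
  "cocycle_iterate \<sigma> A 0 \<omega> = id"
| "cocycle_iterate \<sigma> A (Suc n) \<omega> = A ((\<sigma> ^^ n) \<omega>) \<circ> cocycle_iterate \<sigma> A n \<omega>"

section \<open>The random absolutely continuous invariant measure\<close>

definition racim :: "('w \<Rightarrow> real \<Rightarrow> real) \<Rightarrow> 'w \<Rightarrow> real measure" where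
  "racim h \<omega> = density leb01 (\<lambda>x. ennreal (h \<omega> x))"

text \<open>The last clause determines \<open>h \<omega>\<close> up to null sets of \<open>leb01\<close>, for almost every \<open>\<omega>\<close>.\<close>

definition is_racim_density ::
    "'w measure \<Rightarrow> ('w \<Rightarrow> 'w) \<Rightarrow> ('w \<Rightarrow> real) \<Rightarrow> ('w \<Rightarrow> real \<Rightarrow> real) \<Rightarrow> bool" where
  "is_racim_density P \<sigma> \<beta> h \<longleftrightarrow>
     (\<forall>\<omega>\<in>space P. h \<omega> \<in> borel_measurable leb01 \<and> (\<forall>x\<in>{0..1}. 0 \<le> h \<omega> x)) \<and>
     racim h \<in> P \<rightarrow>\<^sub>M prob_algebra leb01 \<and>
     (AE \<omega> in P. distr (racim h \<omega>) leb01 (lsv (\<beta> \<omega>)) = racim h (\<sigma> \<omega>)) \<and>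
     (AE \<omega> in P.
       (\<lambda>n. \<integral>x. \<bar>cocycle_iterate \<sigma> (\<lambda>\<omega>. transfer (\<beta> \<omega>)) n (int_iterate P \<sigma> (- int n) \<omega>) (\<lambda>_. 1) x
                 - h \<omega> x\<bar> \<partial>leb01) \<longlonglongrightarrow> 0)"

definition norm_transfer ::
    "('w \<Rightarrow> 'w) \<Rightarrow> ('w \<Rightarrow> real) \<Rightarrow> ('w \<Rightarrow> real \<Rightarrow> real) \<Rightarrow> 'w \<Rightarrow> (real \<Rightarrow> real) \<Rightarrow> real \<Rightarrow> real" where
  "norm_transfer \<sigma> \<beta> h \<omega> \<phi> x = transfer (\<beta> \<omega>) (\<lambda>y. \<phi> y * h \<omega> y) x / h (\<sigma> \<omega>) x"

definition norm_transfer_iterate ::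
    "('w \<Rightarrow> 'w) \<Rightarrow> ('w \<Rightarrow> real) \<Rightarrow> ('w \<Rightarrow> real \<Rightarrow> real) \<Rightarrow> nat \<Rightarrow> 'w \<Rightarrow> (real \<Rightarrow> real) \<Rightarrow> real \<Rightarrow> real" where
  "norm_transfer_iterate \<sigma> \<beta> h = cocycle_iterate \<sigma> (norm_transfer \<sigma> \<beta> h)"

definition centered :: "'a measure \<Rightarrow> ('a \<Rightarrow> real) \<Rightarrow> 'a \<Rightarrow> real" where
  "centered \<mu> g x = g x - (\<integral>y. g y \<partial>\<mu>)"

section \<open>Norms\<close>

definition in_Lp :: "'a measure \<Rightarrow> real \<Rightarrow> ('a \<Rightarrow> real) \<Rightarrow> bool" where
  "in_Lp \<mu> p f \<longleftrightarrow> f \<in> borel_measurable \<mu> \<and> integrable \<mu> (\<lambda>x. \<bar>f x\<bar> powr p)"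

definition Lp_norm :: "'a measure \<Rightarrow> real \<Rightarrow> ('a \<Rightarrow> real) \<Rightarrow> real" where
  "Lp_norm \<mu> p f = (\<integral>x. \<bar>f x\<bar> powr p \<partial>\<mu>) powr (1 / p)"

definition is_Lip :: "(real \<Rightarrow> real) \<Rightarrow> bool" where
  "is_Lip g \<longleftrightarrow> (\<exists>K. K-lipschitz_on {0..1} g)"

definition Lip_norm :: "(real \<Rightarrow> real) \<Rightarrow> real" where
  "Lip_norm g = (SUP x\<in>{0..1}. \<bar>g x\<bar>) + Inf {K. K-lipschitz_on {0..1} g}"

end

theory Submission
  imports Defs
begin

text \<open>The normalized operators do not increase the supremum norm, so the iterated
  observable in the theorem is bounded by the product of the two Lipschitz norms, and its
  \<open>L\<^sup>s\<close> norm is controlled by the power \<open>1/s\<close> of its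
  \<open>L\<^sup>1\<close> norm. Multiplying back by the density turns this
  \<open>L\<^sup>1\<close> norm into the one of \<open>T\<^sup>n (w - (\<integral>w) h)\<close>,
  where \<open>T\<^sup>n\<close> is the composition of the unnormalized transfer operators,
  \<open>h\<close> is the invariant density at time \<open>0\<close> and \<open>w\<close> is
  \<open>g\<^sub>2 T\<^sup>k (g\<^sub>1 h')\<close> for the density \<open>h'\<close> at time
  \<open>-k\<close>. Up to the Lipschitz norms, it has to be at most a constant times
  \<open>B\<^sup>s\<close> times \<open>n\<close> to the power \<open>1 - 1/\<gamma>\<close>.
  The densities are limits of images of the constant \<open>1\<close>, so that \<open>h\<close>
  and \<open>h'\<close> may be replaced by such images, provided that no bound depends on the
  number of steps. Three ideas give the estimate.

  Cones. Split a transfer operator into its left and its right branch. Nonnegative,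
  nonincreasing functions \<open>u\<close> for which \<open>x\<^sup>K u(x)\<close> is
  nondecreasing form a cone that both parts preserve if \<open>K \<ge> 2\<close>, and the right
  branch halves \<open>K\<close> (\<open>lsv_cone_left_transfer\<close>,
  \<open>lsv_cone_right_transfer\<close>). Subtracting a constant that is at most half of the
  minimum only doubles \<open>K\<close> (\<open>lsv_cone_diff_const\<close>), so a passage
  through the right branch repairs the damage. Multiplication by a Lipschitz function leads to a
  difference of two functions of the cone with \<open>K + 1\<close>
  (\<open>lip_bounded_split\<close>); hence \<open>w\<close> is a combination of four functions
  in the cone with \<open>K = 4\<close>, all dominated by a multiple of \<open>h\<close>.

  Coupling. Let two functions of this cone with the same mass evolve for a block of
  \<open>l\<close> steps. The mass that has used the right branch within the block has a density
  bounded below by a fixed multiple of this mass; so a common constant can be subtracted from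
  both functions without changing their difference (\<open>coupling_step\<close>). So the
  uncoupled mass decays geometrically in the number of blocks, up to the mass that stays near
  \<open>0\<close> during a whole block, which lies below a threshold. The threshold for
  \<open>l\<close> steps is of order \<open>l\<close> to the power \<open>-1/\<gamma>\<close> as
  soon as a fixed proportion of the parameters met is at most \<open>\<gamma>\<close>, and the
  invariant mass below it is of order \<open>l\<close> to the power \<open>1 -
  1/\<gamma>\<close>, because one sums over the starting times of the stay. With \<open>4
  K\<close> blocks of length \<open>l = K\<^sup>R\<close> this would only give the exponent for
  \<open>l\<close> instead of \<open>n = 4 K l\<close>. A second look at the last blocks
  recovers the exponent for \<open>n\<close>: a stay of length \<open>l\<close> in them either
  began before the middle of the time interval, and then lasts at least \<open>K l\<close>
  steps, or began in the uncoupled mass, which is already small (\<open>coupling_bound\<close>).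
  Blocks much shorter than \<open>n\<close>, yet a power of \<open>n\<close>, are what allows
  the proportion of good parameters to be controlled in all windows at once.

  Probability. Chebyshev's inequality on alternate subblocks together with mixing shows that a
  window of length \<open>n\<close> has too few good parameters with probability of order
  \<open>n\<close> to the power \<open>1 - q\<close> (\<open>few_good_maps_unlikely\<close>).
  Scale \<open>K\<close> needs windows of all lengths \<open>\<ge> l\<close> ending at one of
  the \<open>4 K\<close> block ends, so it fails with probability of order \<open>K\<close>
  times \<open>l\<close> to the power \<open>2 - q\<close>. On a failing scale the trivial bound
  is used, at the price of a factor \<open>n\<close> to the power \<open>1/\<gamma> - 1\<close>
  in \<open>B\<^sup>s\<close>; the condition on \<open>q\<close> is what makes
  \<open>B\<^sup>p\<close> integrable once \<open>R\<close> is large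
  (\<open>random_constant\<close>).\<close>

section \<open>The two full branches\<close>

definition left_branch :: "real \<Rightarrow> real \<Rightarrow> real" where
  "left_branch b x = x * (1 + 2 powr b * x powr b)"

definition left_deriv :: "real \<Rightarrow> real \<Rightarrow> real" where
  "left_deriv b x = 1 + (1 + b) * 2 powr b * x powr b"

definition left_inv :: "real \<Rightarrow> real \<Rightarrow> real" where
  "left_inv b = the_inv_into {0..1/2} (left_branch b)"

lemma left_branch_strict_mono:
  assumes "0 < b" "0 \<le> x" "x < y"
  shows "left_branch b x < left_branch b y"
proof -
  have "x powr b \<le> y powr b"
    using assms by (intro powr_mono2) auto
  then have "1 + 2 powr b * x powr b \<le> 1 + 2 powr b * y powr b"
    by (intro add_left_mono mult_left_mono) auto
  then have "x * (1 + 2 powr b * x powr b) \<le> x * (1 + 2 powr b * y powr b)"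
    using assms by (intro mult_left_mono) auto
  also have "\<dots> < y * (1 + 2 powr b * y powr b)"
    using assms by (intro mult_strict_right_mono add_pos_nonneg) auto
  finally show ?thesis
    by (simp add: left_branch_def)
qed

lemma left_branch_mono_iff:
  assumes "0 < b" "0 \<le> x" "0 \<le> y"
  shows "left_branch b x \<le> left_branch b y \<longleftrightarrow> x \<le> y"
  using left_branch_strict_mono[of b x y] left_branch_strict_mono[of b y x] assms
  by (cases x y rule: linorder_cases) auto

lemma left_branch_0 [simp]: "left_branch b 0 = 0"
  by (simp add: left_branch_def)

lemma left_branch_half [simp]: "left_branch b (1/2) = 1"
proof -
  have "2 powr b * (1/2) powr b = (1::real)"
    by (subst powr_mult[symmetric]) auto
  then show ?thesis
    by (simp add: left_branch_def)
qed

lemma left_branch_has_derivative: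
  assumes b: "0 < b" and x: "x \<in> {0..1/2}"
  shows "(left_branch b has_real_derivative left_deriv b x) (at x within {0..1/2})"
proof (cases "x = 0")
  case False
  with x have "x > 0" by simp
  then show ?thesis
    unfolding left_branch_def left_deriv_def
    by (auto intro!: derivative_eq_intros simp: powr_diff field_simps)
next
  case True
  have "(lsv b has_real_derivative lsv_deriv b 0) (at 0 within {0..1/2})"
    by (rule has_field_derivative_subset[OF lsv_deriv_left]) (use b in auto)
  then have "(left_branch b has_real_derivative lsv_deriv b 0) (at 0 within {0..1/2})"
    by (rule has_field_derivative_transform_within[where d = "1/2"])
      (auto simp: lsv_def left_branch_def dist_real_def)
  then show ?thesis
    using True by (simp add: lsv_deriv_def left_deriv_def)
qed

lemma left_branch_continuous_on:
  assumes "0 < b"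
  shows "continuous_on {0..1/2} (left_branch b)"
  using left_branch_has_derivative[OF assms] DERIV_continuous_on by blast

lemma left_branch_inj_on:
  assumes "0 < b"
  shows "inj_on (left_branch b) {0..1/2}"
  by (rule inj_onI) (use left_branch_mono_iff[OF assms] in \<open>metis atLeastAtMost_iff order.antisym order.refl\<close>)

lemma left_branch_image:
  assumes "0 < b"
  shows "left_branch b ` {0..1/2} = {0..1}"
proof
  show "left_branch b ` {0..1/2} \<subseteq> {0..1}"
    using left_branch_mono_iff[OF assms, of 0] left_branch_mono_iff[OF assms, of _ "1/2"] by auto
  show "{0..1} \<subseteq> left_branch b ` {0..1/2}"
  proof
    fix y :: real assume "y \<in> {0..1}"
    then obtain x where "0 \<le> x" "x \<le> 1/2" "left_branch b x = y"
      using IVT'[of "left_branch b" 0 y "1/2"] left_branch_continuous_on[OF assms] by auto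
    then show "y \<in> left_branch b ` {0..1/2}" by auto
  qed
qed

lemma left_inv:
  assumes "0 < b" "0 \<le> y" "y \<le> 1"
  shows left_inv_nonneg: "0 \<le> left_inv b y" and left_inv_le_half: "left_inv b y \<le> 1/2"
    and left_branch_left_inv: "left_branch b (left_inv b y) = y"
proof -
  have "y \<in> left_branch b ` {0..1/2}"
    using assms by (simp add: left_branch_image)
  then show "left_branch b (left_inv b y) = y"
    unfolding left_inv_def using left_branch_inj_on[OF assms(1)] by (rule f_the_inv_into_f[rotated])
  have "left_inv b y \<in> {0..1/2}"
    unfolding left_inv_def
    using left_branch_inj_on[OF assms(1)] \<open>y \<in> left_branch b ` {0..1/2}\<close> by (rule the_inv_into_into) auto
  then show "0 \<le> left_inv b y" "left_inv b y \<le> 1/2" by auto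
qed

lemma left_inv_left_branch:
  assumes "0 < b" "0 \<le> x" "x \<le> 1/2"
  shows "left_inv b (left_branch b x) = x"
  unfolding left_inv_def using assms by (intro the_inv_into_f_f left_branch_inj_on) auto

lemma left_inv_le_iff:
  assumes "0 < b" "0 \<le> y" "y \<le> 1" "0 \<le> x" "x \<le> 1/2"
  shows "left_inv b y \<le> x \<longleftrightarrow> y \<le> left_branch b x"
  using left_branch_mono_iff[of b "left_inv b y" x] assms left_inv[OF assms(1-3)] by simp

lemma left_inv_mono:
  assumes "0 < b" "0 \<le> x" "x \<le> y" "y \<le> 1"
  shows "left_inv b x \<le> left_inv b y"
  using assms left_inv[of b y] by (subst left_inv_le_iff) auto

lemma left_inv_le_self:
  assumes "0 < b" "0 \<le> y" "y \<le> 1"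
  shows "left_inv b y \<le> y"
proof -
  have "left_inv b y * 1 \<le> left_branch b (left_inv b y)"
    unfolding left_branch_def using left_inv[OF assms] by (intro mult_left_mono) auto
  then show ?thesis
    using left_inv[OF assms] by simp
qed

lemma sets_leb01: "sets leb01 = sets (restrict_space borel {0..1})"
  unfolding leb01_def by (rule sets_restrict_space_cong) simp

lemma left_inv_measurable:
  assumes "0 < b"
  shows "left_inv b \<in> leb01 \<rightarrow>\<^sub>M leb01"
proof -
  have "mono_on {0..1} (left_inv b)"
    by (rule mono_onI) (use left_inv_mono[OF assms] in auto)
  then have "left_inv b \<in> borel_measurable leb01"
    using borel_measurable_mono_on_fnc[of "{0..1}" "left_inv b"] measurable_cong_sets[OF sets_leb01 refl]
    by blast
  moreover have "left_inv b \<in> space leb01 \<rightarrow> {0..1}"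
    using left_inv[OF assms] by (force simp: leb01_def space_restrict_space)
  ultimately show ?thesis
    by (subst (2) leb01_def) (rule measurable_restrict_space2, auto)
qed

lemma space_leb01 [simp]: "space leb01 = {0..1}"
  by (simp add: leb01_def space_restrict_space)

interpretation leb01: prob_space leb01
  by (rule prob_spaceI) (simp add: leb01_def emeasure_restrict_space space_restrict_space)

lemma indicator_measurable_leb01 [measurable]: "(indicator {x..y} :: real \<Rightarrow> real) \<in> borel_measurable leb01"
  unfolding leb01_def by (rule measurable_restrict_space1) auto

text \<open>The two halves of a transfer operator are both of this form: \<open>\<psi>\<close>
  is the density of the image, under a branch \<open>g\<close> defined on \<open>{a..c}\<close>,
  of the measure with density \<open>\<phi>\<close> there.\<close>

lemma branch_change_of_variables:
  fixes \<phi> \<psi> :: "real \<Rightarrow> real"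
  assumes \<phi>: "integrable leb01 \<phi>" and \<psi>: "\<psi> \<in> borel_measurable leb01"
    and ac: "0 \<le> a" "a \<le> c" "c \<le> 1"
    and der: "\<And>x. x \<in> {a..c} \<Longrightarrow> (g has_real_derivative g' x) (at x within {a..c})"
    and inj: "inj_on g {a..c}" and img: "g ` {a..c} = {0..1}"
    and eq: "\<And>x. x \<in> {a..c} \<Longrightarrow> \<bar>g' x\<bar> * \<psi> (g x) = \<phi> x"
  shows "integrable leb01 \<psi>" and "(\<integral>x. \<psi> x \<partial>leb01) = (\<integral>x. indicator {a..c} x * \<phi> x \<partial>leb01)"
proof -
  have i1: "integrable leb01 (\<lambda>x. indicator {a..c} x * \<phi> x)"
  proof (rule Bochner_Integration.integrable_bound[OF \<phi>])
    show "(\<lambda>x. indicator {a..c} x * \<phi> x) \<in> borel_measurable leb01"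
      by (intro borel_measurable_times borel_measurable_integrable[OF \<phi>] indicator_measurable_leb01)
  qed (auto simp: indicator_def)
  have ind: "indicator {0..1} x *\<^sub>R (indicator {a..c} x * \<phi> x) = indicator {a..c} x * \<phi> x" for x
    using ac by (auto simp: indicator_def)
  have set_eq: "integrable lborel (\<lambda>x. indicator {a..c} x * \<phi> x)"
    using i1 unfolding leb01_def by (subst (asm) integrable_restrict_space) (simp_all only: ind, auto)
  have int_eq: "(\<integral>x. indicator {a..c} x * \<phi> x \<partial>leb01) = (\<integral>x. indicator {a..c} x * \<phi> x \<partial>lborel)"
    unfolding leb01_def by (subst integral_restrict_space) (simp_all only: ind, auto)
  have abs\<phi>: "set_integrable lebesgue {a..c} \<phi>"
    using set_eq unfolding set_integrable_def
    by (subst integrable_completion) (auto simp: borel_measurable_integrable)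
  then have abs1: "(\<lambda>x. \<bar>g' x\<bar> * \<psi> (g x)) absolutely_integrable_on {a..c}"
    by (subst set_integrable_cong[where M'=lebesgue and A'="{a..c}" and f'=\<phi>]) (auto simp: eq)
  have ieq: "integral {a..c} (\<lambda>x. \<bar>g' x\<bar> * \<psi> (g x)) = (\<integral>x. indicator {a..c} x * \<phi> x \<partial>lborel)"
  proof -
    have "integral {a..c} (\<lambda>x. \<bar>g' x\<bar> * \<psi> (g x)) = integral {a..c} \<phi>"
      by (rule Henstock_Kurzweil_Integration.integral_cong) (simp add: eq)
    also have "\<dots> = set_lebesgue_integral lebesgue {a..c} \<phi>"
      using abs\<phi> by (subst set_lebesgue_integral_eq_integral) auto
    also have "\<dots> = (\<integral>x. indicator {a..c} x * \<phi> x \<partial>lborel)"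
      unfolding set_lebesgue_integral_def using set_eq
      by (subst integral_completion) (auto simp: borel_measurable_integrable)
    finally show ?thesis .
  qed
  have *: "\<psi> absolutely_integrable_on {0..1} \<and>
      integral {0..1} \<psi> = (\<integral>x. indicator {a..c} x * \<phi> x \<partial>lborel)"
    using has_absolute_integral_change_of_variables_1'[of "{a..c}" g g' \<psi>] abs1 ieq der inj
    unfolding img by auto
  have meas: "(\<lambda>x. indicator {0..1} x *\<^sub>R \<psi> x) \<in> borel_measurable lborel"
    using \<psi> unfolding leb01_def by (subst (asm) borel_measurable_restrict_space_iff) (auto simp: mult.commute)
  have si: "integrable lborel (\<lambda>x. indicator {0..1} x *\<^sub>R \<psi> x)"
    using * meas unfolding set_integrable_def by (subst (asm) integrable_completion) auto
  then show "integrable leb01 \<psi>"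
    unfolding leb01_def by (subst integrable_restrict_space) auto
  have "(\<integral>x. \<psi> x \<partial>leb01) = (\<integral>x. indicator {0..1} x *\<^sub>R \<psi> x \<partial>lborel)"
    unfolding leb01_def by (subst integral_restrict_space) auto
  also have "\<dots> = integral {0..1} \<psi>"
    using * meas by (subst set_lebesgue_integral_eq_integral(2)[symmetric])
      (auto simp: set_lebesgue_integral_def integral_completion)
  also have "\<dots> = (\<integral>x. indicator {a..c} x * \<phi> x \<partial>leb01)"
    using * int_eq by simp
  finally show "(\<integral>x. \<psi> x \<partial>leb01) = (\<integral>x. indicator {a..c} x * \<phi> x \<partial>leb01)" .
qed

section \<open>Transfer operators\<close>

abbreviation mass :: "(real \<Rightarrow> real) \<Rightarrow> real" where
  "mass u \<equiv> \<integral>x. u x \<partial>leb01"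

abbreviation L1 :: "(real \<Rightarrow> real) \<Rightarrow> real" where
  "L1 u \<equiv> \<integral>x. \<bar>u x\<bar> \<partial>leb01"

definition left_transfer :: "real \<Rightarrow> (real \<Rightarrow> real) \<Rightarrow> real \<Rightarrow> real" where
  "left_transfer b \<phi> y = \<phi> (left_inv b y) / left_deriv b (left_inv b y)"

definition right_transfer :: "(real \<Rightarrow> real) \<Rightarrow> real \<Rightarrow> real" where
  "right_transfer \<phi> y = \<phi> ((1 + y) / 2) / 2"

text \<open>This is \<open>transfer\<close> except at the end point \<open>1\<close>, whose left
  preimage \<open>1/2\<close> belongs to the right branch of the map. Counting it twice makes
  both summands full branches on the closed interval, so that the cones below can be defined by
  conditions on all of \<open>{0..1}\<close>, including \<open>1\<close> where functions are
  smallest.\<close>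

definition full_transfer :: "real \<Rightarrow> (real \<Rightarrow> real) \<Rightarrow> real \<Rightarrow> real" where
  "full_transfer b \<phi> y = left_transfer b \<phi> y + right_transfer \<phi> y"

lemma left_deriv_ge_1: "0 < b \<Longrightarrow> 1 \<le> left_deriv b x"
  by (simp add: left_deriv_def)

lemma left_transfer_measurable:
  assumes b: "0 < b" and \<phi>: "\<phi> \<in> borel_measurable leb01"
  shows "left_transfer b \<phi> \<in> borel_measurable leb01"
proof -
  have "left_deriv b \<in> borel_measurable leb01"
    unfolding left_deriv_def leb01_def by (rule measurable_restrict_space1) measurable
  then show ?thesis
    unfolding left_transfer_def
    by (intro borel_measurable_divide measurable_compose[OF left_inv_measurable[OF b]] \<phi>)
qed

lemma right_transfer_measurable:
  assumes \<phi>: "\<phi> \<in> borel_measurable leb01"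
  shows "right_transfer \<phi> \<in> borel_measurable leb01"
proof -
  have "(\<lambda>y::real. (1 + y) / 2) \<in> leb01 \<rightarrow>\<^sub>M leb01"
    unfolding leb01_def by (rule measurable_restrict_space3) auto
  then show ?thesis
    unfolding right_transfer_def
    by (intro borel_measurable_divide measurable_compose[OF _ \<phi>] borel_measurable_const)
qed

lemma full_transfer_measurable:
  assumes b: "0 < b" and \<phi>: "\<phi> \<in> borel_measurable leb01"
  shows "full_transfer b \<phi> \<in> borel_measurable leb01"
  unfolding full_transfer_def
  by (intro borel_measurable_add left_transfer_measurable right_transfer_measurable assms)

lemma left_transfer_integral:
  assumes b: "0 < b" and \<phi>: "integrable leb01 \<phi>"
  shows integrable_left_transfer: "integrable leb01 (left_transfer b \<phi>)"
    and integral_left_transfer: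
      "mass (left_transfer b \<phi>) = (\<integral>x. indicator {0..1/2} x * \<phi> x \<partial>leb01)"
proof -
  have "\<bar>left_deriv b x\<bar> * left_transfer b \<phi> (left_branch b x) = \<phi> x" if "x \<in> {0..1/2}" for x
    using that left_deriv_ge_1[OF b, of x] by (simp add: left_transfer_def left_inv_left_branch[OF b])
  note * = branch_change_of_variables[OF \<phi> left_transfer_measurable[OF b] _ _ _
      left_branch_has_derivative[OF b] left_branch_inj_on[OF b] left_branch_image[OF b] this]
  show "integrable leb01 (left_transfer b \<phi>)"
    "mass (left_transfer b \<phi>) = (\<integral>x. indicator {0..1/2} x * \<phi> x \<partial>leb01)"
    using \<phi> by (auto intro!: *)
qed

lemma right_transfer_integral:
  assumes \<phi>: "integrable leb01 \<phi>"
  shows integrable_right_transfer: "integrable leb01 (right_transfer \<phi>)"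
    and integral_right_transfer:
      "mass (right_transfer \<phi>) = (\<integral>x. indicator {1/2..1} x * \<phi> x \<partial>leb01)"
proof -
  have der: "((\<lambda>x. 2 * x - 1) has_real_derivative 2) (at x within {1/2..1})" for x :: real
    by (auto intro!: derivative_eq_intros)
  have inj: "inj_on (\<lambda>x::real. 2 * x - 1) {1/2..1}"
    by (auto simp: inj_on_def)
  have img: "(\<lambda>x::real. 2 * x - 1) ` {1/2..1} = {0..1}"
  proof (intro equalityI subsetI)
    fix y :: real assume "y \<in> {0..1}"
    then show "y \<in> (\<lambda>x::real. 2 * x - 1) ` {1/2..1}"
      by (intro image_eqI[where x = "(1 + y) / 2"]) (auto simp: field_simps)
  qed auto
  have "\<bar>2\<bar> * right_transfer \<phi> (2 * x - 1) = \<phi> x" for x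
    by (simp add: right_transfer_def)
  note * = branch_change_of_variables[OF \<phi> right_transfer_measurable _ _ _ der inj img this]
  show "integrable leb01 (right_transfer \<phi>)"
    "mass (right_transfer \<phi>) = (\<integral>x. indicator {1/2..1} x * \<phi> x \<partial>leb01)"
    using \<phi> by (auto intro!: *)
qed

lemma integrable_indicator_mult:
  assumes "integrable leb01 \<phi>"
  shows "integrable leb01 (\<lambda>x. indicator {a..c} x * \<phi> x :: real)"
proof (rule Bochner_Integration.integrable_bound[OF assms])
  show "(\<lambda>x. indicator {a..c} x * \<phi> x) \<in> borel_measurable leb01"
    by (intro borel_measurable_times borel_measurable_integrable[OF assms] indicator_measurable_leb01)
qed (auto simp: indicator_def)

lemma AE_leb01_neq: "AE x in leb01. x \<noteq> a"
  unfolding leb01_def by (subst AE_restrict_space_iff) (auto intro: AE_mp[OF AE_lborel_singleton[of a]])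

lemma integral_split_half:
  assumes \<phi>: "integrable leb01 \<phi>"
  shows "mass \<phi> =
    (\<integral>x. indicator {0..1/2} x * \<phi> x \<partial>leb01) + (\<integral>x. indicator {1/2..1} x * \<phi> x \<partial>leb01 :: real)"
proof -
  have "AE x in leb01. \<phi> x = indicator {0..1/2} x * \<phi> x + indicator {1/2..1} x * \<phi> x"
    using AE_leb01_neq[of "1/2"] by (rule AE_mp) (auto simp: indicator_def)
  then have "mass \<phi> = (\<integral>x. indicator {0..1/2} x * \<phi> x + indicator {1/2..1} x * \<phi> x \<partial>leb01)"
    by (intro integral_cong_AE borel_measurable_add borel_measurable_integrable
        integrable_indicator_mult assms)
  also have "\<dots> = (\<integral>x. indicator {0..1/2} x * \<phi> x \<partial>leb01) + (\<integral>x. indicator {1/2..1} x * \<phi> x \<partial>leb01)"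
    by (intro Bochner_Integration.integral_add integrable_indicator_mult assms)
  finally show ?thesis .
qed

lemma full_transfer_integral:
  assumes b: "0 < b" and \<phi>: "integrable leb01 \<phi>"
  shows integrable_full_transfer: "integrable leb01 (full_transfer b \<phi>)"
    and integral_full_transfer: "mass (full_transfer b \<phi>) = mass \<phi>"
  unfolding full_transfer_def
  using left_transfer_integral[OF b \<phi>] right_transfer_integral[OF \<phi>] integral_split_half[OF \<phi>]
  by simp_all

lemma left_transfer_mono:
  assumes "0 < b" "\<And>x. x \<in> {0..1} \<Longrightarrow> u x \<le> v x" "y \<in> {0..1}"
  shows "left_transfer b u y \<le> left_transfer b v y"
  unfolding left_transfer_def
  using left_inv_nonneg[of b y] left_inv_le_half[of b y] left_deriv_ge_1[of b "left_inv b y"] assms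
  by (intro divide_right_mono assms) auto

lemma right_transfer_mono:
  assumes "\<And>x. x \<in> {0..1} \<Longrightarrow> u x \<le> v x" "y \<in> {0..1}"
  shows "right_transfer u y \<le> right_transfer v y"
  unfolding right_transfer_def using assms by (intro divide_right_mono assms) auto

lemma full_transfer_mono:
  assumes "0 < b" "\<And>x. x \<in> {0..1} \<Longrightarrow> u x \<le> v x" "y \<in> {0..1}"
  shows "full_transfer b u y \<le> full_transfer b v y"
  unfolding full_transfer_def using assms by (intro add_mono left_transfer_mono right_transfer_mono)

lemma full_transfer_add: "full_transfer b (\<lambda>x. u x + v x) = (\<lambda>y. full_transfer b u y + full_transfer b v y)"
  by (auto simp: full_transfer_def left_transfer_def right_transfer_def add_divide_distrib)

lemma full_transfer_diff: "full_transfer b (\<lambda>x. u x - v x) = (\<lambda>y. full_transfer b u y - full_transfer b v y)"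
  by (auto simp: full_transfer_def left_transfer_def right_transfer_def diff_divide_distrib)

lemma full_transfer_scale: "full_transfer b (\<lambda>x. c * u x) = (\<lambda>y. c * full_transfer b u y)"
  by (auto simp: full_transfer_def left_transfer_def right_transfer_def algebra_simps)

lemma full_transfer_abs_le:
  assumes "0 < b" "y \<in> {0..1}"
  shows "\<bar>full_transfer b u y\<bar> \<le> full_transfer b (\<lambda>x. \<bar>u x\<bar>) y"
proof -
  have "full_transfer b u y \<le> full_transfer b (\<lambda>x. \<bar>u x\<bar>) y"
    using assms by (intro full_transfer_mono) auto
  moreover have "full_transfer b (\<lambda>x. (-1) * u x) y \<le> full_transfer b (\<lambda>x. \<bar>u x\<bar>) y"
    using assms by (intro full_transfer_mono) auto
  ultimately show ?thesis
    unfolding full_transfer_scale by simp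
qed

definition mass_below :: "(real \<Rightarrow> real) \<Rightarrow> real \<Rightarrow> real" where
  "mass_below u x = (\<integral>z. indicator {0..x} z * u z \<partial>leb01)"

text \<open>The left branch maps \<open>{0..left_inv b x}\<close> onto
  \<open>{0..x}\<close>.\<close>

lemma mass_below_left_transfer:
  assumes b: "0 < b" and u: "integrable leb01 u" and x: "0 \<le> x" "x \<le> 1"
  shows "mass_below (left_transfer b u) x = mass_below u (left_inv b x)"
proof -
  have "mass_below (left_transfer b u) x =
      mass (left_transfer b (\<lambda>z. indicator {0..left_inv b x} z * u z))"
    unfolding mass_below_def
  proof (rule Bochner_Integration.integral_cong[OF refl])
    fix y assume "y \<in> space leb01"
    then have y: "0 \<le> y" "y \<le> 1" by auto
    have "left_inv b y \<le> left_inv b x \<longleftrightarrow> y \<le> x"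
      using left_inv_le_iff[OF b y, of "left_inv b x"] left_inv[OF b x] by simp
    then show "indicator {0..x} y * left_transfer b u y =
        left_transfer b (\<lambda>z. indicator {0..left_inv b x} z * u z) y"
      using y left_inv_nonneg[OF b y] by (auto simp: left_transfer_def indicator_def)
  qed
  also have "\<dots> = (\<integral>z. indicator {0..1/2} z * (indicator {0..left_inv b x} z * u z) \<partial>leb01)"
    by (rule integral_left_transfer[OF b integrable_indicator_mult[OF u]])
  also have "\<dots> = mass_below u (left_inv b x)"
    unfolding mass_below_def using left_inv_le_half[OF b x]
    by (intro Bochner_Integration.integral_cong) (auto simp: indicator_def)
  finally show ?thesis .
qed

lemma mass_below_1: "mass_below u 1 = mass u"
  unfolding mass_below_def by (intro Bochner_Integration.integral_cong) (auto simp: indicator_def)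

lemma mass_below_mono:
  assumes "integrable leb01 u" "integrable leb01 v" "\<And>z. z \<in> {0..1} \<Longrightarrow> u z \<le> v z"
  shows "mass_below u x \<le> mass_below v x"
  unfolding mass_below_def
  using assms by (intro integral_mono integrable_indicator_mult) (auto simp: indicator_def)

lemma mass_below_scale: "mass_below (\<lambda>x. c * u x) y = c * mass_below u y"
  unfolding mass_below_def by (simp add: mult.left_commute)

lemma mass_below_le_mass:
  assumes "integrable leb01 u" "\<And>z. z \<in> {0..1} \<Longrightarrow> 0 \<le> u z"
  shows "mass_below u x \<le> mass u"
  unfolding mass_below_def
  using assms by (intro integral_mono integrable_indicator_mult) (auto simp: indicator_def)

lemma mass_below_nonneg:
  assumes "\<And>z. z \<in> {0..1} \<Longrightarrow> 0 \<le> u z"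
  shows "0 \<le> mass_below u x"
  unfolding mass_below_def using assms by (intro integral_nonneg_AE) (auto simp: indicator_def)

lemma measure_leb01_Icc:
  assumes "0 \<le> x" "x \<le> y" "y \<le> 1"
  shows "measure leb01 {x..y} = y - x"
  unfolding leb01_def using assms by (subst measure_restrict_space) auto

lemma measure_leb01_UNIV [simp]: "measure leb01 {0..1} = 1"
  using measure_leb01_Icc[of 0 1] by simp

lemma integral_indicator_const_leb01:
  assumes "0 \<le> x" "x \<le> y" "y \<le> 1"
  shows "(\<integral>z. indicator {x..y} z * c \<partial>leb01) = (y - x) * (c::real)"
proof -
  have "(\<integral>z. indicator {x..y} z * c \<partial>leb01) = c * measure leb01 ({x..y} \<inter> space leb01)"
    by (subst integral_mult_left_zero) simp
  also have "{x..y} \<inter> space leb01 = {x..y}"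
    using assms by auto
  finally show ?thesis
    using measure_leb01_Icc[OF assms] by simp
qed

section \<open>The invariant cones\<close>

text \<open>For differentiable \<open>u\<close> the conditions say \<open>- K u(x) / x \<le>
  u'(x) \<le> 0\<close>: a bound on the logarithmic derivative in the scale of \<open>log
  x\<close>, in which the left branch is nearly an isometry near \<open>0\<close>.\<close>

definition lsv_cone :: "nat \<Rightarrow> (real \<Rightarrow> real) \<Rightarrow> bool" where
  "lsv_cone K u \<longleftrightarrow> (\<forall>x\<in>{0..1}. 0 \<le> u x) \<and>
     (\<forall>x y. 0 \<le> x \<and> x \<le> y \<and> y \<le> 1 \<longrightarrow> u y \<le> u x \<and> x ^ K * u x \<le> y ^ K * u y)"

lemma lsv_coneI:
  assumes "\<And>x. 0 \<le> x \<Longrightarrow> x \<le> 1 \<Longrightarrow> 0 \<le> u x"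
    and "\<And>x y. 0 \<le> x \<Longrightarrow> x \<le> y \<Longrightarrow> y \<le> 1 \<Longrightarrow> u y \<le> u x"
    and "\<And>x y. 0 \<le> x \<Longrightarrow> x \<le> y \<Longrightarrow> y \<le> 1 \<Longrightarrow> x ^ K * u x \<le> y ^ K * u y"
  shows "lsv_cone K u"
  using assms by (auto simp: lsv_cone_def)

lemma lsv_cone_nonneg: "lsv_cone K u \<Longrightarrow> 0 \<le> x \<Longrightarrow> x \<le> 1 \<Longrightarrow> 0 \<le> u x"
  by (auto simp: lsv_cone_def)

lemma lsv_cone_antimono: "lsv_cone K u \<Longrightarrow> 0 \<le> x \<Longrightarrow> x \<le> y \<Longrightarrow> y \<le> 1 \<Longrightarrow> u y \<le> u x"
  by (auto simp: lsv_cone_def)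

lemma lsv_cone_power_mono:
  "lsv_cone K u \<Longrightarrow> 0 \<le> x \<Longrightarrow> x \<le> y \<Longrightarrow> y \<le> 1 \<Longrightarrow> x ^ K * u x \<le> y ^ K * u y"
  by (auto simp: lsv_cone_def)

lemma lsv_cone_integrable:
  assumes "lsv_cone K u"
  shows "integrable leb01 u"
proof -
  have "mono_on {0..1} (\<lambda>x. - u x)"
    by (rule mono_onI) (use lsv_cone_antimono[OF assms] in auto)
  then have "(\<lambda>x. - u x) \<in> borel_measurable leb01"
    using borel_measurable_mono_on_fnc measurable_cong_sets[OF sets_leb01 refl] by blast
  then have "u \<in> borel_measurable leb01"
    by (simp add: borel_measurable_uminus_eq)
  then show ?thesis
    by (rule leb01.integrable_const_bound[where B = "u 0", rotated])
      (use lsv_cone_antimono[OF assms, of 0] lsv_cone_nonneg[OF assms] in auto)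
qed

lemma lsv_cone_mono:
  assumes u: "lsv_cone K u" and KL: "K \<le> L"
  shows "lsv_cone L u"
proof (rule lsv_coneI)
  fix x y :: real assume xy: "0 \<le> x" "x \<le> y" "y \<le> 1"
  have "x ^ L * u x = x ^ (L - K) * (x ^ K * u x)"
    using KL by (simp add: power_add[symmetric])
  also have "\<dots> \<le> y ^ (L - K) * (y ^ K * u y)"
    using xy lsv_cone_nonneg[OF u] by (intro mult_mono power_mono lsv_cone_power_mono[OF u]) auto
  also have "\<dots> = y ^ L * u y"
    using KL by (simp add: power_add[symmetric])
  finally show "x ^ L * u x \<le> y ^ L * u y" .
qed (use lsv_cone_nonneg[OF u] lsv_cone_antimono[OF u] in auto)

lemma lsv_cone_add:
  assumes "lsv_cone K u" "lsv_cone K v"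
  shows "lsv_cone K (\<lambda>x. u x + v x)"
  using assms by (auto simp: lsv_cone_def distrib_left intro: add_mono)

lemma lsv_cone_scale:
  assumes "lsv_cone K u" "0 \<le> c"
  shows "lsv_cone K (\<lambda>x. c * u x)"
  using assms by (auto simp: lsv_cone_def mult.left_commute[of _ c] intro: mult_left_mono)

lemma lsv_cone_const:
  assumes "0 \<le> c"
  shows "lsv_cone K (\<lambda>_. c)"
  using assms by (auto simp: lsv_cone_def intro: mult_right_mono power_mono)

lemma lsv_cone_le_ratio:
  assumes "lsv_cone K u" "0 < x" "x \<le> y" "y \<le> 1"
  shows "u x \<le> (y / x) ^ K * u y"
  using lsv_cone_power_mono[OF assms(1), of x y] assms by (simp add: field_simps power_divide)

text \<open>Subtracting \<open>c\<close> keeps \<open>u'\<close> and at most halves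
  \<open>u\<close>, so \<open>- u'/u\<close> at most doubles.\<close>

lemma lsv_cone_diff_const:
  assumes u: "lsv_cone K u" and c: "0 \<le> c" "2 * c \<le> u 1"
  shows "lsv_cone (2 * K) (\<lambda>x. u x - c)"
proof (rule lsv_coneI)
  fix x :: real assume "0 \<le> x" "x \<le> 1"
  then show "0 \<le> u x - c"
    using lsv_cone_antimono[OF u, of x 1] c by auto
next
  fix x y :: real assume "0 \<le> x" "x \<le> y" "y \<le> 1"
  then show "u y - c \<le> u x - c"
    using lsv_cone_antimono[OF u] by auto
next
  fix x y :: real assume xy: "0 \<le> x" "x \<le> y" "y \<le> 1"
  define X Y where "X = x ^ K" and "Y = y ^ K"
  have XY: "0 \<le> X" "X \<le> Y"
    using xy by (auto simp: X_def Y_def intro: power_mono)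
  have uy: "2 * c \<le> u y"
    using lsv_cone_antimono[OF u, of y 1] xy c by auto
  have "X * u x \<le> Y * u y"
    unfolding X_def Y_def by (rule lsv_cone_power_mono[OF u xy])
  then have "X * (X * u x) \<le> X * (Y * u y)"
    using XY by (intro mult_left_mono)
  moreover have "0 \<le> Y * (Y - X) * (u y - 2 * c)" "0 \<le> c * (Y - X) * (Y - X)"
    using XY uy c by auto
  ultimately have "X * X * (u x - c) \<le> Y * Y * (u y - c)"
    by (simp add: algebra_simps)
  then show "x ^ (2 * K) * (u x - c) \<le> y ^ (2 * K) * (u y - c)"
    by (simp add: X_def Y_def power_mult power2_eq_square power_mult_distrib mult_2 power_add)
qed

text \<open>For \<open>w = (2 x)\<^sup>b\<close> and \<open>c = 1 + b\<close> the left branch is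
  \<open>x (1 + w)\<close> and its derivative \<open>1 + c w\<close>, so this is the growth of
  \<open>(left_branch b x / x)\<^sup>K / left_deriv b x\<close> in \<open>x\<close>, which is
  what the power condition of the cone requires from the left branch.\<close>

lemma branch_power_quotient_mono:
  fixes w1 w2 c :: real
  assumes w: "0 \<le> w1" "w1 \<le> w2" and c: "0 \<le> c" "c \<le> 2" and K: "2 \<le> K"
  shows "(1 + w1) ^ K / (1 + c * w1) \<le> (1 + w2) ^ K / (1 + c * w2)"
proof -
  have "0 \<le> (w2 - w1) * ((2 - c) + w1 + w2 + c * w1 * w2)"
    using w c by (intro mult_nonneg_nonneg add_nonneg_nonneg) auto
  then have "(1 + w1)\<^sup>2 * (1 + c * w2) \<le> (1 + w2)\<^sup>2 * (1 + c * w1)"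
    by (simp add: algebra_simps power2_eq_square)
  moreover have pos: "0 < 1 + c * w1" "0 < 1 + c * w2"
    using w c by (auto intro!: add_pos_nonneg)
  ultimately have 2: "(1 + w1)\<^sup>2 / (1 + c * w1) \<le> (1 + w2)\<^sup>2 / (1 + c * w2)"
    by (simp add: field_simps)
  have split: "(1 + w) ^ K = (1 + w) ^ (K - 2) * (1 + w)\<^sup>2" for w :: real
    using K power_add[of "1 + w" "K - 2" 2] by (metis le_add_diff_inverse2)
  have "(1 + w1) ^ (K - 2) * ((1 + w1)\<^sup>2 / (1 + c * w1)) \<le> (1 + w2) ^ (K - 2) * ((1 + w2)\<^sup>2 / (1 + c * w2))"
    using w c pos by (intro mult_mono 2 power_mono) auto
  then show ?thesis
    by (simp add: split)
qed

lemma lsv_cone_left_transfer: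
  assumes b: "0 < b" "b \<le> 1" and u: "lsv_cone K u" and K: "2 \<le> K"
  shows "lsv_cone K (left_transfer b u)"
proof (rule lsv_coneI)
  fix y :: real assume y: "0 \<le> y" "y \<le> 1"
  show "0 \<le> left_transfer b u y"
    unfolding left_transfer_def
    using left_deriv_ge_1[OF b(1), of "left_inv b y"] left_inv[OF b(1) y] lsv_cone_nonneg[OF u, of "left_inv b y"]
    by auto
next
  fix y1 y2 :: real assume y: "0 \<le> y1" "y1 \<le> y2" "y2 \<le> 1"
  define x1 x2 where "x1 = left_inv b y1" and "x2 = left_inv b y2"
  have x: "0 \<le> x1" "x1 \<le> x2" "x2 \<le> 1/2" and yx: "y1 = left_branch b x1" "y2 = left_branch b x2"
    unfolding x1_def x2_def using y left_inv[of b y1] left_inv[of b y2] left_inv_mono[of b y1 y2] b by auto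
  define w where "w x = 2 powr b * x powr b" for x :: real
  have w: "0 \<le> w x1" "w x1 \<le> w x2"
    unfolding w_def using x b by (auto intro!: mult_left_mono powr_mono2)
  have d: "left_deriv b x = 1 + (1 + b) * w x" for x
    by (simp add: left_deriv_def w_def)
  have br: "left_branch b x = x * (1 + w x)" for x
    by (simp add: left_branch_def w_def)
  have u2: "0 \<le> u x2" "u x2 \<le> u x1" "0 \<le> u x1"
    using x lsv_cone_nonneg[OF u] lsv_cone_antimono[OF u] by auto
  have dpos: "1 \<le> left_deriv b x" for x
    by (rule left_deriv_ge_1[OF b(1)])
  have dle: "left_deriv b x1 \<le> left_deriv b x2"
    unfolding d using w b by (auto intro!: mult_left_mono)
  show "left_transfer b u y2 \<le> left_transfer b u y1"
    unfolding left_transfer_def x1_def[symmetric] x2_def[symmetric]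
    using u2 dle dpos[of x1] by (intro frac_le) auto
  have lt: "left_transfer b u y1 = u x1 / left_deriv b x1" "left_transfer b u y2 = u x2 / left_deriv b x2"
    by (simp_all add: left_transfer_def x1_def x2_def)
  have "y1 ^ K * left_transfer b u y1 = (x1 ^ K * u x1) * ((1 + w x1) ^ K / left_deriv b x1)"
    unfolding lt by (simp add: yx br power_mult_distrib)
  also have "\<dots> \<le> (x2 ^ K * u x2) * ((1 + w x2) ^ K / left_deriv b x2)"
    unfolding d using x u2 w b K
    by (intro mult_mono lsv_cone_power_mono[OF u] branch_power_quotient_mono) auto
  also have "\<dots> = y2 ^ K * left_transfer b u y2"
    unfolding lt by (simp add: yx br power_mult_distrib)
  finally show "y1 ^ K * left_transfer b u y1 \<le> y2 ^ K * left_transfer b u y2" .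
qed

text \<open>In the variable \<open>x = (1 + y) / 2\<close> the ratio of two points is at most
  the square root of the ratio in \<open>y\<close>. This is the only place where regularity is
  gained: the left branch has no uniform contraction, neither near \<open>0\<close> nor, for
  small \<open>b\<close>, away from it.\<close>

lemma lsv_cone_right_transfer:
  assumes u: "lsv_cone (2 * K) u"
  shows "lsv_cone K (right_transfer u)"
proof (rule lsv_coneI)
  fix y1 y2 :: real assume y: "0 \<le> y1" "y1 \<le> y2" "y2 \<le> 1"
  define x1 x2 where "x1 = (1 + y1) / 2" and "x2 = (1 + y2) / 2"
  have x: "0 < x1" "x1 \<le> x2" "x2 \<le> 1"
    using y by (auto simp: x1_def x2_def)
  have ux2: "0 \<le> u x2"
    using lsv_cone_nonneg[OF u] x by auto
  have "y1 * y2 \<le> 1 * 1"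
    using y by (intro mult_mono) auto
  then have "0 \<le> (y2 - y1) * (1 - y1 * y2)"
    using y by (intro mult_nonneg_nonneg) auto
  then have "y1 * (1 + y2)\<^sup>2 \<le> y2 * (1 + y1)\<^sup>2"
    by (simp add: algebra_simps power2_eq_square)
  then have "y1 * (x2\<^sup>2 / x1\<^sup>2) \<le> y2"
    using y by (simp add: x1_def x2_def power_divide field_simps)
  then have *: "(y1 * (x2 / x1)\<^sup>2) ^ K \<le> y2 ^ K"
    using y by (intro power_mono) (auto simp: power_divide)
  have "y1 ^ K * u x1 \<le> y1 ^ K * ((x2 / x1) ^ (2 * K) * u x2)"
    using y by (intro mult_left_mono lsv_cone_le_ratio[OF u] x) auto
  also have "\<dots> = (y1 * (x2 / x1)\<^sup>2) ^ K * u x2"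
    by (simp add: power_mult_distrib power_mult)
  also have "\<dots> \<le> y2 ^ K * u x2"
    using * ux2 by (intro mult_right_mono)
  finally show "y1 ^ K * right_transfer u y1 \<le> y2 ^ K * right_transfer u y2"
    by (simp add: right_transfer_def x1_def x2_def)
  show "right_transfer u y2 \<le> right_transfer u y1"
    using lsv_cone_antimono[OF u, of x1 x2] x by (simp add: right_transfer_def x1_def x2_def)
qed (auto simp: right_transfer_def intro!: lsv_cone_nonneg[OF u])

lemma lsv_cone_full_transfer:
  assumes b: "0 < b" "b \<le> 1" and u: "lsv_cone K u" and K: "2 \<le> K"
  shows "lsv_cone K (full_transfer b u)"
  unfolding full_transfer_def
  by (intro lsv_cone_add lsv_cone_left_transfer assms lsv_cone_right_transfer lsv_cone_mono[OF u]) auto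

text \<open>The value at \<open>1/2\<close> is the minimum over \<open>{0..1/2}\<close>, hence
  at most the mean over this interval.\<close>

lemma lsv_cone_at_half_le:
  assumes u: "lsv_cone K u"
  shows "u (1/2) \<le> 2 * mass u"
proof -
  have int: "integrable leb01 u"
    by (rule lsv_cone_integrable[OF u])
  have "(1/2 - 0) * u (1/2) = (\<integral>x. indicator {0..1/2} x * u (1/2) \<partial>leb01)"
    by (rule integral_indicator_const_leb01[symmetric]) auto
  also have "\<dots> \<le> mass u"
  proof (rule integral_mono[OF _ int])
    show "integrable leb01 (\<lambda>x. indicator {0..1/2} x * u (1/2))"
      by (intro integrable_indicator_mult) simp
    fix x assume "x \<in> space leb01"
    then show "indicator {0..1/2} x * u (1/2) \<le> u x"
      using lsv_cone_antimono[OF u, of x "1/2"] lsv_cone_nonneg[OF u, of x] by (auto simp: indicator_def)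
  qed
  finally show ?thesis by simp
qed

text \<open>Mass arrives in \<open>{0..x}\<close> through the left branch, or through the right
  branch from the interval of length \<open>x/2\<close> next to \<open>1/2\<close>, on which the
  density is at most \<open>u (1/2)\<close>.\<close>

lemma mass_below_full_transfer:
  assumes b: "0 < b" and u: "lsv_cone K u" and x: "0 \<le> x" "x \<le> 1"
  shows "mass_below (full_transfer b u) x \<le> mass_below u (left_inv b x) + x * mass u"
proof -
  have int: "integrable leb01 u"
    by (rule lsv_cone_integrable[OF u])
  have "mass_below (full_transfer b u) x = mass_below (left_transfer b u) x + mass_below (right_transfer u) x"
    unfolding mass_below_def full_transfer_def distrib_left
    by (intro Bochner_Integration.integral_add integrable_indicator_mult integrable_left_transfer[OF b]
        integrable_right_transfer int)
  also have "mass_below (right_transfer u) x \<le> (\<integral>z. indicator {0..x} z * (u (1/2) / 2) \<partial>leb01)"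
    unfolding mass_below_def
    by (intro integral_mono integrable_indicator_mult integrable_right_transfer[OF int])
      (auto simp: right_transfer_def indicator_def intro!: lsv_cone_antimono[OF u])
  also have "\<dots> = (x - 0) * (u (1/2) / 2)"
    by (rule integral_indicator_const_leb01) (use x in auto)
  also have "\<dots> \<le> x * mass u"
    using mult_left_mono[OF lsv_cone_at_half_le[OF u] x(1)] by (simp add: mult_ac)
  finally show ?thesis
    using mass_below_left_transfer[OF b int x] by simp
qed

text \<open>One use of the right branch spreads mass over the whole interval: on
  \<open>{1/2..1}\<close> a function of the cone varies at most by the factor \<open>2 ^
  4\<close>.\<close>

lemma right_transfer_ge:
  assumes u: "lsv_cone 4 u" and x: "0 \<le> x" "x \<le> 1"
  shows "mass (right_transfer u) / 16 \<le> right_transfer u x"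
proof -
  have int: "integrable leb01 u"
    by (rule lsv_cone_integrable[OF u])
  have "mass (right_transfer u) \<le> (\<integral>z. u (1/2) / 2 \<partial>leb01)"
    by (intro integral_mono integrable_right_transfer[OF int])
      (auto simp: right_transfer_def intro!: lsv_cone_antimono[OF u])
  also have "\<dots> = u (1/2) / 2"
    using leb01.prob_space by simp
  also have "\<dots> \<le> 8 * u 1"
    using lsv_cone_power_mono[OF u, of "1/2" 1] by (simp add: power_divide)
  also have "\<dots> \<le> 16 * right_transfer u x"
    using lsv_cone_antimono[OF u, of "(1 + x) / 2" 1] x by (simp add: right_transfer_def)
  finally show ?thesis by simp
qed

text \<open>The slope \<open>- G\<close> makes the first factor nonincreasing, and the constant
  \<open>4 G\<close> makes it so large compared with its slope, which is at most \<open>2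
  G\<close>, that \<open>x\<close> times it is nondecreasing. So only one power of
  \<open>x\<close> is lost.\<close>

lemma lsv_cone_mult_affine:
  assumes f: "lsv_cone K f"
    and lip: "\<And>x y. x \<in> {0..1} \<Longrightarrow> y \<in> {0..1} \<Longrightarrow> \<bar>g x - g y\<bar> \<le> G * \<bar>x - y\<bar>"
    and bd: "\<And>x. x \<in> {0..1} \<Longrightarrow> \<bar>g x\<bar> \<le> G" and G: "0 \<le> G"
  shows "lsv_cone (Suc K) (\<lambda>x. (g x + (4 * G - G * x)) * f x)"
proof -
  define p where "p x = g x + (4 * G - G * x)" for x
  have p0: "2 * G \<le> p x" if "0 \<le> x" "x \<le> 1" for x
    using bd[of x] that mult_left_mono[of x 1 G] G by (auto simp: p_def)
  have panti: "p y \<le> p x" if "0 \<le> x" "x \<le> y" "y \<le> 1" for x y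
    using lip[of x y] that by (auto simp: p_def algebra_simps abs_if split: if_splits)
  have pmono: "x * p x \<le> y * p y" if "0 \<le> x" "x \<le> y" "y \<le> 1" for x y
  proof -
    have "p x - p y \<le> 2 * G * (y - x)"
      using lip[of x y] that by (auto simp: p_def algebra_simps abs_if split: if_splits)
    then have "x * (p x - p y) \<le> 1 * (2 * G * (y - x))"
      using that G panti[OF that] by (intro mult_mono) auto
    also have "\<dots> \<le> p y * (y - x)"
      using p0[of y] that by (simp add: mult_right_mono)
    finally show ?thesis by (simp add: algebra_simps)
  qed
  have "lsv_cone (Suc K) (\<lambda>x. p x * f x)"
  proof (rule lsv_coneI)
    fix x :: real assume "0 \<le> x" "x \<le> 1"
    then show "0 \<le> p x * f x"
      using p0[of x] G lsv_cone_nonneg[OF f] by auto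
  next
    fix x y :: real assume xy: "0 \<le> x" "x \<le> y" "y \<le> 1"
    then show "p y * f y \<le> p x * f x"
      using p0[of x] p0[of y] G lsv_cone_nonneg[OF f] lsv_cone_antimono[OF f] panti by (intro mult_mono) auto
    have "(x * p x) * (x ^ K * f x) \<le> (y * p y) * (y ^ K * f y)"
      using xy p0[of x] p0[of y] G lsv_cone_nonneg[OF f]
      by (intro mult_mono[OF pmono lsv_cone_power_mono[OF f]]) auto
    then show "x ^ Suc K * (p x * f x) \<le> y ^ Suc K * (p y * f y)"
      by (simp add: mult_ac)
  qed
  then show ?thesis by (simp add: p_def)
qed

section \<open>Evolution in a fixed environment\<close>

primrec evolve :: "(int \<Rightarrow> real) \<Rightarrow> int \<Rightarrow> nat \<Rightarrow> (real \<Rightarrow> real) \<Rightarrow> real \<Rightarrow> real" where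
  "evolve b t 0 u = u"
| "evolve b t (Suc n) u = full_transfer (b (t + int n)) (evolve b t n u)"

text \<open>The points whose orbit, started at time \<open>t\<close>, uses the left branch
  \<open>n\<close> times in a row are those below the threshold.\<close>

primrec threshold :: "(int \<Rightarrow> real) \<Rightarrow> nat \<Rightarrow> int \<Rightarrow> real" where
  "threshold b 0 t = 1"
| "threshold b (Suc n) t = left_inv (b t) (threshold b n (t + 1))"

lemma evolve_add: "evolve b t (m + n) u = evolve b (t + int m) n (evolve b t m u)"
  by (induction n) (simp_all add: add.assoc)

lemma evolve_Suc_left: "evolve b t (Suc n) u = evolve b (t + 1) n (full_transfer (b t) u)"
  using evolve_add[of b t 1 n u] by simp

lemma evolve_plus: "evolve b t n (\<lambda>x. u x + v x) = (\<lambda>y. evolve b t n u y + evolve b t n v y)"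
  by (induction n) (simp_all add: full_transfer_add)

lemma evolve_diff: "evolve b t n (\<lambda>x. u x - v x) = (\<lambda>y. evolve b t n u y - evolve b t n v y)"
  by (induction n) (simp_all add: full_transfer_diff)

lemma evolve_scale: "evolve b t n (\<lambda>x. c * u x) = (\<lambda>y. c * evolve b t n u y)"
  by (induction n) (simp_all add: full_transfer_scale)

locale lsv_environment =
  fixes b :: "int \<Rightarrow> real" and \<beta>0 :: real
  assumes b_pos: "\<And>t. 0 < b t" and b_le: "\<And>t. b t \<le> \<beta>0" and \<beta>0_less: "\<beta>0 < 1"
begin

lemma b_le_1: "b t \<le> 1"
  using b_le[of t] \<beta>0_less by simp

lemma \<beta>0_pos: "0 < \<beta>0"
  using b_pos[of 0] b_le[of 0] by simp

lemma threshold_bounds: "0 \<le> threshold b n t \<and> threshold b n t \<le> 1"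
proof (induction n arbitrary: t)
  case (Suc n)
  have "left_inv (b t) (threshold b n (t + 1)) \<le> 1/2" "0 \<le> left_inv (b t) (threshold b n (t + 1))"
    using Suc[of "t + 1"] left_inv_le_half[OF b_pos] left_inv_nonneg[OF b_pos] by auto
  then show ?case by simp
qed simp

lemma integrable_evolve: "integrable leb01 u \<Longrightarrow> integrable leb01 (evolve b t n u)"
  by (induction n) (auto intro: integrable_full_transfer[OF b_pos])

lemma integral_evolve: "integrable leb01 u \<Longrightarrow> mass (evolve b t n u) = mass u"
  by (induction n) (simp_all add: integral_full_transfer[OF b_pos] integrable_evolve)

lemma evolve_measurable: "u \<in> borel_measurable leb01 \<Longrightarrow> evolve b t n u \<in> borel_measurable leb01"
  by (induction n) (auto intro: full_transfer_measurable[OF b_pos])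

lemma lsv_cone_evolve: "lsv_cone K u \<Longrightarrow> 2 \<le> K \<Longrightarrow> lsv_cone K (evolve b t n u)"
  by (induction n) (auto intro: lsv_cone_full_transfer[OF b_pos b_le_1])

lemma evolve_mono:
  assumes "\<And>x. x \<in> {0..1} \<Longrightarrow> u x \<le> v x" "y \<in> {0..1}"
  shows "evolve b t n u y \<le> evolve b t n v y"
  using assms(2) by (induction n arbitrary: y) (auto intro!: full_transfer_mono[OF b_pos] assms(1))

lemma evolve_cong:
  assumes "\<And>x. x \<in> {0..1} \<Longrightarrow> u x = v x" "y \<in> {0..1}"
  shows "evolve b t n u y = evolve b t n v y"
  by (intro order.antisym evolve_mono) (use assms in auto)

lemma evolve_abs_le: "y \<in> {0..1} \<Longrightarrow> \<bar>evolve b t n u y\<bar> \<le> evolve b t n (\<lambda>x. \<bar>u x\<bar>) y"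
proof (induction n arbitrary: y)
  case (Suc n)
  have "\<bar>full_transfer (b (t + int n)) (evolve b t n u) y\<bar>
      \<le> full_transfer (b (t + int n)) (\<lambda>x. \<bar>evolve b t n u x\<bar>) y"
    by (rule full_transfer_abs_le[OF b_pos Suc.prems])
  also have "\<dots> \<le> full_transfer (b (t + int n)) (evolve b t n (\<lambda>x. \<bar>u x\<bar>)) y"
    by (rule full_transfer_mono[OF b_pos Suc.IH Suc.prems])
  finally show ?case by simp
qed simp

lemma evolve_L1_contraction:
  assumes u: "integrable leb01 u"
  shows "L1 (evolve b t n u) \<le> L1 u"
proof -
  have "L1 (evolve b t n u) \<le> (\<integral>x. evolve b t n (\<lambda>x. \<bar>u x\<bar>) x \<partial>leb01)"
    using u by (intro integral_mono integrable_abs integrable_evolve evolve_abs_le) auto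
  also have "\<dots> = L1 u"
    using u by (intro integral_evolve) auto
  finally show ?thesis .
qed

text \<open>Mass below \<open>threshold b l\<close> at the end either used only the left branch
  since time \<open>t\<close>, and then started below \<open>threshold b (l + n) t\<close>, or
  it has used the left branch exactly \<open>j\<close> times since its last use of the right
  branch. The summand with index \<open>j\<close> bounds the second kind.\<close>

lemma mass_below_evolve:
  assumes u: "lsv_cone K u" and K: "2 \<le> K"
  shows "mass_below (evolve b t n u) (threshold b l (t + int n)) \<le>
    mass_below u (threshold b (l + n) t) +
    mass u * (\<Sum>j<n. threshold b (l + j) (t + int n - int j))"
proof (induction n arbitrary: l)
  case (Suc n)
  let ?M = "\<integral>x. u x \<partial>leb01" and ?y = "threshold b l (t + int (Suc n))"
  have y: "0 \<le> ?y" "?y \<le> 1"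
    using threshold_bounds by blast+
  have "mass_below (evolve b t (Suc n) u) ?y \<le>
      mass_below (evolve b t n u) (left_inv (b (t + int n)) ?y) + ?y * mass (evolve b t n u)"
    using mass_below_full_transfer[OF b_pos lsv_cone_evolve[OF u K] y] by simp
  also have "mass (evolve b t n u) = ?M"
    by (rule integral_evolve[OF lsv_cone_integrable[OF u]])
  also have "left_inv (b (t + int n)) ?y = threshold b (Suc l) (t + int n)"
    by (simp add: add_ac)
  also have "mass_below (evolve b t n u) (threshold b (Suc l) (t + int n)) \<le>
      mass_below u (threshold b (Suc l + n) t) + ?M * (\<Sum>j<n. threshold b (Suc l + j) (t + int n - int j))"
    by (rule Suc.IH)
  finally show ?case
    by (subst sum.lessThan_Suc_shift) (simp add: algebra_simps)
qed simp

lemma mass_below_const_1: "0 \<le> x \<Longrightarrow> x \<le> 1 \<Longrightarrow> mass_below (\<lambda>_. 1) x = x"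
  using integral_indicator_const_leb01[of 0 x 1] by (simp add: mass_below_def)

lemma integral_evolve_1: "mass (evolve b t n (\<lambda>_. 1)) = 1"
  by (subst integral_evolve) (simp_all add: leb01.prob_space)

lemma lsv_cone_evolve_1: "lsv_cone 2 (evolve b t n (\<lambda>_. 1))"
  by (intro lsv_cone_evolve lsv_cone_const) auto

lemma mass_below_evolve_1:
  "mass_below (evolve b t n (\<lambda>_. 1)) (threshold b l (t + int n)) \<le>
     (\<Sum>j<Suc n. threshold b (l + j) (t + int n - int j))"
  using mass_below_evolve[OF lsv_cone_const[of 1 2], of t n l] threshold_bounds[of "l + n" t]
    mass_below_const_1[of "threshold b (l + n) t"] leb01.prob_space by simp

end

lemma ln_one_plus_ge_half:
  assumes "0 \<le> w" "w \<le> (1::real)"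
  shows "w / 2 \<le> ln (1 + w)"
proof -
  have "ln (1 / (1 + w)) \<le> 1 / (1 + w) - 1"
    using assms by (intro ln_le_minus_one) auto
  then have "1 - 1 / (1 + w) \<le> ln (1 + w)"
    using assms by (simp add: ln_div)
  moreover have "w / 2 \<le> w / (1 + w)"
    using assms by (intro divide_left_mono) auto
  moreover have "w / (1 + w) = 1 - 1 / (1 + w)"
    using assms by (simp add: field_simps)
  ultimately show ?thesis by simp
qed

lemma one_plus_powr_ge:
  assumes "0 \<le> w" "w \<le> (1::real)" "0 \<le> a"
  shows "1 + a * w / 2 \<le> (1 + w) powr a"
proof -
  have "1 + a * (w / 2) \<le> 1 + a * ln (1 + w)"
    using ln_one_plus_ge_half[OF assms(1,2)] assms(3) by (simp add: mult_left_mono del: times_divide_eq_right)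
  also have "\<dots> \<le> exp (a * ln (1 + w))"
    by (rule exp_ge_add_one_self)
  also have "\<dots> = (1 + w) powr a"
    using assms by (simp add: powr_def)
  finally show ?thesis by simp
qed

context lsv_environment
begin

text \<open>By \<open>mass_below_full_transfer\<close> the mass \<open>F\<close> below
  \<open>x\<close> of the images of \<open>1\<close> increases at most from \<open>F (left_inv b
  x)\<close> to \<open>F (left_inv b x) + x\<close>. The lemma provides a supersolution of this
  recursion. With \<open>l = left_inv b x\<close> it holds since \<open>l\<close> to the power
  \<open>1 - \<beta>0\<close> times \<open>(2 l)\<^sup>b\<close> is at least \<open>l\<close>,
  that is, of the order of \<open>x\<close>.\<close>

lemma left_inv_powr_step:
  assumes x: "0 \<le> x" "x \<le> 1"
  defines "\<theta> \<equiv> 1 - \<beta>0"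
  shows "4 / \<theta> * left_inv (b t) x powr \<theta> + x \<le> 4 / \<theta> * x powr \<theta>"
proof -
  define l where "l = left_inv (b t) x"
  have l: "0 \<le> l" "l \<le> 1/2" "left_branch (b t) l = x"
    unfolding l_def using left_inv[OF b_pos x] by auto
  have \<theta>: "0 < \<theta>" "\<theta> < 1"
    using \<beta>0_less \<beta>0_pos by (auto simp: \<theta>_def)
  define w where "w = (2 * l) powr b t"
  have w: "0 \<le> w" "w \<le> 1"
    unfolding w_def using l b_pos[of t] by (auto intro!: powr_le1)
  have xw: "x = l * (1 + w)"
    using l by (simp add: left_branch_def w_def powr_mult)
  show ?thesis
  proof (cases "l = 0")
    case True
    then show ?thesis using xw unfolding l_def[symmetric] by simp
  next
    case False
    with l have lpos: "0 < l" by simp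
    have "l powr \<beta>0 \<le> (2 * l) powr \<beta>0"
      using lpos \<beta>0_pos by (intro powr_mono2) auto
    also have "\<dots> \<le> w"
      unfolding w_def using lpos l b_le[of t] by (intro powr_mono') auto
    finally have wl: "l powr \<beta>0 \<le> w" .
    have "l = l powr \<theta> * l powr \<beta>0"
      using lpos by (simp add: powr_add[symmetric] \<theta>_def)
    also have "\<dots> \<le> l powr \<theta> * w"
      using wl by (intro mult_left_mono) auto
    finally have "2 * l \<le> 2 * (l powr \<theta> * w)" by simp
    moreover have "x \<le> 2 * l"
      using xw w l mult_left_mono[of w 1 l] by (simp add: algebra_simps)
    ultimately have "4 / \<theta> * l powr \<theta> + x \<le> 4 / \<theta> * (l powr \<theta> * (1 + \<theta> * w / 2))"
      using \<theta> by (simp add: field_simps)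
    also have "\<dots> \<le> 4 / \<theta> * (l powr \<theta> * (1 + w) powr \<theta>)"
      using \<theta> w by (intro mult_left_mono one_plus_powr_ge) auto
    also have "l powr \<theta> * (1 + w) powr \<theta> = x powr \<theta>"
      using w l by (simp add: xw powr_mult)
    finally show ?thesis by (simp add: l_def)
  qed
qed

lemma mass_below_evolve_1_powr:
  assumes x: "0 \<le> x" "x \<le> 1"
  shows "mass_below (evolve b t n (\<lambda>_. 1)) x \<le> 4 / (1 - \<beta>0) * x powr (1 - \<beta>0)"
  using x
proof (induction n arbitrary: x)
  case 0
  have "x = 1 * x powr 1"
    using 0 by simp
  also have "\<dots> \<le> 4 / (1 - \<beta>0) * x powr (1 - \<beta>0)"
    using 0 \<beta>0_less \<beta>0_pos by (intro mult_mono powr_mono') (auto simp: field_simps)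
  finally show ?case
    using mass_below_const_1[of x] 0 by simp
next
  case (Suc n)
  have "mass_below (evolve b t (Suc n) (\<lambda>_. 1)) x
      \<le> mass_below (evolve b t n (\<lambda>_. 1)) (left_inv (b (t + int n)) x) + x"
    using mass_below_full_transfer[OF b_pos lsv_cone_evolve_1 Suc.prems] integral_evolve_1 by simp
  also have "\<dots> \<le> 4 / (1 - \<beta>0) * left_inv (b (t + int n)) x powr (1 - \<beta>0) + x"
    using left_inv[OF b_pos[of "t + int n"] Suc.prems] by (intro add_right_mono Suc.IH) auto
  also have "\<dots> \<le> 4 / (1 - \<beta>0) * x powr (1 - \<beta>0)"
    by (rule left_inv_powr_step[OF Suc.prems])
  finally show ?case .
qed

text \<open>The number is \<open>y\<^sup>2 / 2\<close> for the point \<open>y\<close> at which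
  the bound of \<open>mass_below_evolve_1_powr\<close> equals \<open>1/2\<close>. It depends on
  \<open>\<beta>0\<close> only.\<close>

definition "floor_const = (((1 - \<beta>0) / 8) powr (1 / (1 - \<beta>0)))\<^sup>2 / 2"

lemma floor_const_pos: "0 < floor_const"
  using \<beta>0_less by (simp add: floor_const_def)

lemma floor_const_le: "floor_const \<le> 1"
proof -
  have "((1 - \<beta>0) / 8) powr (1 / (1 - \<beta>0)) \<le> 1"
    using \<beta>0_less \<beta>0_pos by (intro powr_le1) auto
  then have "(((1 - \<beta>0) / 8) powr (1 / (1 - \<beta>0)))\<^sup>2 \<le> 1"
    by (intro power_le_one) auto
  then show ?thesis
    by (simp add: floor_const_def)
qed

text \<open>At least half of the mass lies to the right of the point \<open>y\<close> in
  \<open>floor_const\<close>. The function is nonincreasing, so its value at \<open>y\<close> is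
  at least \<open>1/2\<close>, and the cone condition passes this on to its minimum at
  \<open>1\<close>.\<close>

lemma evolve_1_ge:
  assumes x: "x \<in> {0..1}"
  shows "floor_const \<le> evolve b t n (\<lambda>_. 1) x"
proof -
  define f where "f = evolve b t n (\<lambda>_. 1)"
  define y where "y = ((1 - \<beta>0) / 8) powr (1 / (1 - \<beta>0))"
  have f: "lsv_cone 2 f"
    unfolding f_def by (rule lsv_cone_evolve_1)
  have int: "integrable leb01 f"
    by (rule lsv_cone_integrable[OF f])
  have y: "0 < y" "y \<le> 1"
    unfolding y_def using \<beta>0_less \<beta>0_pos by (auto intro!: powr_le1)
  have "mass_below f y \<le> 4 / (1 - \<beta>0) * y powr (1 - \<beta>0)"
    unfolding f_def using y by (intro mass_below_evolve_1_powr) auto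
  also have "y powr (1 - \<beta>0) = (1 - \<beta>0) / 8"
    unfolding y_def using \<beta>0_less by (simp add: powr_powr)
  also have "4 / (1 - \<beta>0) * ((1 - \<beta>0) / 8) = 1 / 2"
    using \<beta>0_less by (simp add: field_simps)
  finally have half: "mass_below f y \<le> 1 / 2" .
  have fy: "0 \<le> f y"
    using y by (intro lsv_cone_nonneg[OF f]) auto
  have "1 = mass f"
    unfolding f_def by (rule integral_evolve_1[symmetric])
  also have "\<dots> \<le> (\<integral>x. indicator {0..y} x * f x + f y \<partial>leb01)"
    using y fy by (intro integral_mono int Bochner_Integration.integrable_add integrable_indicator_mult)
      (auto simp: indicator_def intro!: lsv_cone_antimono[OF f])
  also have "\<dots> = mass_below f y + f y"
    unfolding mass_below_def
    by (subst Bochner_Integration.integral_add) (auto simp: leb01.prob_space intro!: integrable_indicator_mult int)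
  finally have "1 / 2 \<le> f y"
    using half by simp
  then have "y\<^sup>2 / 2 \<le> y\<^sup>2 * f y"
    using mult_left_mono[of "1/2" "f y" "y\<^sup>2"] by simp
  also have "\<dots> \<le> f 1"
    using lsv_cone_power_mono[OF f, of y 1] y by simp
  also have "\<dots> \<le> f x"
    using x by (intro lsv_cone_antimono[OF f]) auto
  finally show ?thesis
    by (simp add: floor_const_def y_def f_def)
qed

section \<open>Coupling\<close>

text \<open>Split according to whether the right branch is used within \<open>l\<close> steps.
  The part \<open>z\<close> that never uses it has mass \<open>mass_below u (threshold b l
  t)\<close> and keeps the regularity of \<open>u\<close>; the rest \<open>a\<close> regains
  regularity at the first use of the right branch and is bounded below by its mass from then
  on.\<close>

lemma block_decomposition:
  assumes "lsv_cone 4 u"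
  shows "\<exists>z a. (\<forall>x\<in>{0..1}. evolve b t l u x = z x + a x) \<and> lsv_cone 4 z \<and> lsv_cone 2 a \<and>
    (\<forall>x\<in>{0..1}. floor_const / 16 * (mass u - mass_below u (threshold b l t)) \<le> a x)"
  using assms
proof (induction l arbitrary: t u)
  case 0
  then show ?case
    by (intro exI[of _ u] exI[of _ "\<lambda>_. 0"]) (auto simp: mass_below_1 lsv_cone_const)
next
  case (Suc l)
  let ?L = "left_transfer (b t) u" and ?R = "right_transfer u"
  note u = Suc.prems
  have int: "integrable leb01 u"
    by (rule lsv_cone_integrable[OF u])
  have L: "lsv_cone 4 ?L"
    by (rule lsv_cone_left_transfer[OF b_pos b_le_1 u]) simp
  have R: "lsv_cone 2 ?R"
    by (rule lsv_cone_right_transfer) (use u in simp)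
  \<comment> \<open>Follow the left branch first; what takes the right branch at this step is
    already regular and spread out.\<close>
  obtain z a where za: "\<And>x. x \<in> {0..1} \<Longrightarrow> evolve b (t + 1) l ?L x = z x + a x" "lsv_cone 4 z" "lsv_cone 2 a"
    and a: "\<And>x. x \<in> {0..1} \<Longrightarrow> floor_const / 16 *
        (mass ?L - mass_below ?L (threshold b l (t + 1))) \<le> a x"
    using Suc.IH[OF L, of "t + 1"] by blast
  define a' where "a' x = a x + evolve b (t + 1) l ?R x" for x
  define m where "m = mass ?R"
  have m: "0 \<le> m"
    unfolding m_def by (intro integral_nonneg_AE) (use lsv_cone_nonneg[OF R] in auto)
  have split: "evolve b t (Suc l) u x = z x + a' x" if "x \<in> {0..1}" for x
  proof -
    have "evolve b t (Suc l) u = evolve b (t + 1) l (\<lambda>y. ?L y + ?R y)"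
      unfolding evolve_Suc_left by (rule arg_cong[where f = "evolve b (t + 1) l"]) (auto simp: full_transfer_def)
    then show ?thesis
      using za(1)[OF that] by (simp add: evolve_plus a'_def)
  qed
  have thr: "mass_below ?L (threshold b l (t + 1)) = mass_below u (threshold b (Suc l) t)"
    using mass_below_left_transfer[OF b_pos int] threshold_bounds[of l "t + 1"] by simp
  have mass: "mass u = mass ?L + m"
    unfolding m_def integral_left_transfer[OF b_pos int] integral_right_transfer[OF int]
    by (rule integral_split_half[OF int])
  have "floor_const / 16 * (mass u - mass_below u (threshold b (Suc l) t)) \<le> a' x"
    if x: "x \<in> {0..1}" for x
  proof -
    have "floor_const / 16 * m = m / 16 * floor_const" by simp
    also have "\<dots> \<le> m / 16 * evolve b (t + 1) l (\<lambda>_. 1) x"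
      using m by (intro mult_left_mono evolve_1_ge x) auto
    also have "\<dots> = evolve b (t + 1) l (\<lambda>_. m / 16 * 1) x"
      by (simp only: evolve_scale)
    also have "\<dots> \<le> evolve b (t + 1) l ?R x"
      using right_transfer_ge[OF u] by (intro evolve_mono x) (auto simp: m_def)
    finally show ?thesis
      using a[OF x] unfolding a'_def mass thr by (simp add: algebra_simps)
  qed
  moreover have "lsv_cone 2 a'"
    unfolding a'_def by (intro lsv_cone_add za lsv_cone_evolve R) auto
  ultimately show ?case
    using split za by (intro exI[of _ z] exI[of _ a']) auto
qed

definition "couple_rate = floor_const / 32"

lemma couple_rate: "0 < couple_rate" "couple_rate < 1"
  using floor_const_pos floor_const_le by (auto simp: couple_rate_def)

text \<open>Subtract one constant from both functions. It comes out of the parts that have used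
  the right branch, which lie in the better cone \<open>lsv_cone 2\<close>, and is at most half
  of their minima; so the remainders stay in \<open>lsv_cone 4\<close>.\<close>

lemma coupling_step:
  assumes u: "lsv_cone 4 u" and v: "lsv_cone 4 v" and uv: "mass u = mass v"
  shows "\<exists>u' v'. lsv_cone 4 u' \<and> lsv_cone 4 v' \<and> mass u' = mass v' \<and>
    (\<forall>x\<in>{0..1}. u' x \<le> evolve b t l u x \<and> v' x \<le> evolve b t l v x \<and>
       evolve b t l u x - evolve b t l v x = u' x - v' x) \<and>
    mass u' \<le> (1 - couple_rate) * mass u +
       couple_rate * (mass_below u (threshold b l t) + mass_below v (threshold b l t))"
proof -
  define M where "M = mass u"
  define Au where "Au = mass_below u (threshold b l t)"
  define Av where "Av = mass_below v (threshold b l t)"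
  have intu: "integrable leb01 u" and intv: "integrable leb01 v"
    using lsv_cone_integrable u v by auto
  have A: "0 \<le> Au" "Au \<le> M" "0 \<le> Av" "Av \<le> M"
    unfolding Au_def Av_def M_def
    using mass_below_le_mass[OF intu] mass_below_le_mass[OF intv] mass_below_nonneg[of u] mass_below_nonneg[of v]
      lsv_cone_nonneg[OF u] lsv_cone_nonneg[OF v] uv by auto
  obtain z a where za: "\<And>x. x \<in> {0..1} \<Longrightarrow> evolve b t l u x = z x + a x" "lsv_cone 4 z" "lsv_cone 2 a"
    "\<And>x. x \<in> {0..1} \<Longrightarrow> floor_const / 16 * (M - Au) \<le> a x"
    unfolding M_def Au_def using block_decomposition[OF u, of t l] by blast
  obtain z' a' where za': "\<And>x. x \<in> {0..1} \<Longrightarrow> evolve b t l v x = z' x + a' x" "lsv_cone 4 z'" "lsv_cone 2 a'"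
    "\<And>x. x \<in> {0..1} \<Longrightarrow> floor_const / 16 * (M - Av) \<le> a' x"
    unfolding M_def Av_def uv using block_decomposition[OF v, of t l] by blast
  \<comment> \<open>The common constant must respect both functions, hence the sum of both
    masses near \<open>0\<close>; the maximum with \<open>0\<close> covers the case that most
    mass is near \<open>0\<close>.\<close>
  define \<kappa> where "\<kappa> = couple_rate * max 0 (M - Au - Av)"
  have \<kappa>: "0 \<le> \<kappa>"
    unfolding \<kappa>_def using couple_rate by simp
  have "2 * \<kappa> = floor_const / 16 * max 0 (M - Au - Av)"
    by (simp add: \<kappa>_def couple_rate_def)
  then have le: "2 * \<kappa> \<le> floor_const / 16 * (M - Au)" "2 * \<kappa> \<le> floor_const / 16 * (M - Av)"
    using A floor_const_pos by (auto intro!: mult_left_mono)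
  define u' where "u' x = z x + (a x - \<kappa>)" for x
  define v' where "v' x = z' x + (a' x - \<kappa>)" for x
  have cone: "lsv_cone 4 u'" "lsv_cone 4 v'"
    unfolding u'_def v'_def
    using lsv_cone_diff_const[OF za(3) \<kappa> order_trans[OF le(1) za(4)]]
      lsv_cone_diff_const[OF za'(3) \<kappa> order_trans[OF le(2) za'(4)]]
    by (auto intro!: lsv_cone_add za za')
  have eq: "u' x = evolve b t l u x - \<kappa>" "v' x = evolve b t l v x - \<kappa>" if "x \<in> {0..1}" for x
    using that by (auto simp: u'_def v'_def za za')
  have "mass u' = (\<integral>x. evolve b t l u x - \<kappa> \<partial>leb01)"
    "mass v' = (\<integral>x. evolve b t l v x - \<kappa> \<partial>leb01)"
    by (rule Bochner_Integration.integral_cong; simp add: eq)+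
  then have mass: "mass u' = M - \<kappa>" "mass v' = M - \<kappa>"
    by (simp_all add: integrable_evolve integral_evolve intu intv leb01.prob_space M_def uv)
  have "couple_rate * (M - Au - Av) \<le> \<kappa>"
    unfolding \<kappa>_def using couple_rate by (intro mult_left_mono) auto
  then have "mass u' \<le> (1 - couple_rate) * M + couple_rate * (Au + Av)"
    unfolding mass by (simp add: algebra_simps)
  then show ?thesis
    using cone mass eq \<kappa> unfolding M_def Au_def Av_def
    by (intro exI[of _ u'] exI[of _ v']) auto
qed

end

lemma affine_recursion_bound:
  fixes M :: "nat \<Rightarrow> real"
  assumes \<rho>: "0 \<le> \<rho>" "\<rho> \<le> 1" and A: "0 \<le> A"
    and step: "\<And>i. i < m \<Longrightarrow> M (k + Suc i) \<le> (1 - \<rho>) * M (k + i) + \<rho> * A"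
  shows "M (k + m) \<le> (1 - \<rho>) ^ m * M k + A"
  using step
proof (induction m)
  case (Suc m)
  have "M (k + Suc m) \<le> (1 - \<rho>) * M (k + m) + \<rho> * A"
    by (rule Suc.prems) simp
  also have "\<dots> \<le> (1 - \<rho>) * ((1 - \<rho>) ^ m * M k + A) + \<rho> * A"
    using Suc \<rho> by (intro add_right_mono mult_left_mono) auto
  finally show ?case
    by (simp add: algebra_simps)
qed (use A in simp)

context lsv_environment
begin

lemma coupling_sequence:
  assumes "lsv_cone 4 u" "lsv_cone 4 v" "mass u = mass v"
  obtains U V :: "nat \<Rightarrow> real \<Rightarrow> real"
  where "U 0 = u" "V 0 = v"
    and "\<And>k. lsv_cone 4 (U k)" "\<And>k. lsv_cone 4 (V k)" "\<And>k. mass (U k) = mass (V k)"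
    and "\<And>k x. x \<in> {0..1} \<Longrightarrow> U (Suc k) x \<le> evolve b (int (k * l)) l (U k) x"
    and "\<And>k x. x \<in> {0..1} \<Longrightarrow> V (Suc k) x \<le> evolve b (int (k * l)) l (V k) x"
    and "\<And>k x. x \<in> {0..1} \<Longrightarrow>
      evolve b (int (k * l)) l (U k) x - evolve b (int (k * l)) l (V k) x = U (Suc k) x - V (Suc k) x"
    and "\<And>k. mass (U (Suc k)) \<le> (1 - couple_rate) * mass (U k) + couple_rate *
       (mass_below (U k) (threshold b l (int (k * l))) + mass_below (V k) (threshold b l (int (k * l))))"
proof -
  define P where "P w \<longleftrightarrow> lsv_cone 4 (fst w) \<and> lsv_cone 4 (snd w) \<and>
    mass (fst w) = mass (snd w)" for w :: "(real \<Rightarrow> real) \<times> (real \<Rightarrow> real)"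
  define Q where "Q k w w' \<longleftrightarrow>
    (\<forall>x\<in>{0..1}. fst w' x \<le> evolve b (int (k * l)) l (fst w) x \<and> snd w' x \<le> evolve b (int (k * l)) l (snd w) x \<and>
       evolve b (int (k * l)) l (fst w) x - evolve b (int (k * l)) l (snd w) x = fst w' x - snd w' x) \<and>
    mass (fst w') \<le> (1 - couple_rate) * mass (fst w) + couple_rate *
       (mass_below (fst w) (threshold b l (int (k * l))) + mass_below (snd w) (threshold b l (int (k * l))))"
    for k and w w' :: "(real \<Rightarrow> real) \<times> (real \<Rightarrow> real)"
  have step: "\<exists>w'. P w' \<and> Q k w w'" if "P w" for k w
  proof -
    have "lsv_cone 4 (fst w)" "lsv_cone 4 (snd w)" "mass (fst w) = mass (snd w)"
      using that by (auto simp: P_def)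
    from coupling_step[OF this, of "int (k * l)" l] show ?thesis
      unfolding P_def Q_def split_paired_Ex fst_conv snd_conv by blast
  qed
  define W where "W = rec_nat (u, v) (\<lambda>k w. SOME w'. P w' \<and> Q k w w')"
  have PW: "P (W k)" for k
  proof (induction k)
    case (Suc k)
    then show ?case
      using someI_ex[OF step[OF Suc]] by (simp add: W_def)
  qed (use assms in \<open>simp add: W_def P_def\<close>)
  have QW: "Q k (W k) (W (Suc k))" for k
    using someI_ex[OF step[OF PW[of k]]] by (simp add: W_def)
  have W0: "fst (W 0) = u" "snd (W 0) = v"
    by (simp_all add: W_def)
  show thesis
    by (rule that[of "\<lambda>k. fst (W k)" "\<lambda>k. snd (W k)", OF W0])
      (use PW QW in \<open>auto simp only: P_def Q_def\<close>)
qed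

lemma dominated_evolve:
  assumes "\<And>k x. x \<in> {0..1} \<Longrightarrow> U (Suc k) x \<le> evolve b (int (k * l)) l (U k) x" and "x \<in> {0..1}"
  shows "U (k + m) x \<le> evolve b (int (k * l)) (m * l) (U k) x"
  using assms(2)
proof (induction m arbitrary: x)
  case (Suc m)
  have "U (k + Suc m) x \<le> evolve b (int ((k + m) * l)) l (U (k + m)) x"
    using assms(1)[of x "k + m"] Suc.prems by simp
  also have "\<dots> \<le> evolve b (int ((k + m) * l)) l (evolve b (int (k * l)) (m * l) (U k)) x"
    by (rule evolve_mono[OF Suc.IH Suc.prems])
  also have "\<dots> = evolve b (int (k * l)) (m * l + l) (U k) x"
    unfolding evolve_add by (simp add: algebra_simps)
  finally show ?case by (simp add: add.commute)
qed simp

text \<open>The uncoupled parts are bounded by the evolution of the initial functions, hence by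
  \<open>E\<close> times an image of \<open>1\<close>, for which the mass below a threshold is a
  sum of thresholds reaching back in time.\<close>

lemma mass_below_dominated:
  fixes U :: "nat \<Rightarrow> real \<Rightarrow> real"
  assumes U: "lsv_cone 4 (U k)" and dom: "\<And>x. x \<in> {0..1} \<Longrightarrow> U k x \<le> evolve b 0 (k * l) (U 0) x"
    and E: "0 \<le> E" and U0: "\<And>x. x \<in> {0..1} \<Longrightarrow> U 0 x \<le> E * evolve b (- int N) N (\<lambda>_. 1) x"
    and S: "\<And>n. (\<Sum>j<n. threshold b (L + j) (int (k * l) - int j)) \<le> S"
  shows "mass_below (U k) (threshold b L (int (k * l))) \<le> E * S"
proof -
  let ?h = "evolve b (- int N) (N + k * l) (\<lambda>_. 1)"
  have "U k x \<le> E * ?h x" if x: "x \<in> {0..1}" for x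
  proof -
    have "U k x \<le> evolve b 0 (k * l) (\<lambda>x. E * evolve b (- int N) N (\<lambda>_. 1) x) x"
      by (rule order_trans[OF dom[OF x]], rule evolve_mono[OF U0 x])
    also have "\<dots> = E * ?h x"
      using evolve_add[of b "- int N" N "k * l" "\<lambda>_. 1"] by (simp add: evolve_scale)
    finally show ?thesis .
  qed
  then have "mass_below (U k) (threshold b L (int (k * l))) \<le>
      mass_below (\<lambda>x. E * ?h x) (threshold b L (int (k * l)))"
    by (intro mass_below_mono lsv_cone_integrable[OF U] integrable_mult_right integrable_evolve) auto
  also have "\<dots> = E * mass_below ?h (threshold b L (int (k * l)))"
    by (rule mass_below_scale)
  also have "\<dots> \<le> E * S"
    using mass_below_evolve_1[of "- int N" "N + k * l" L] S[of "Suc (N + k * l)"] E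
    by (intro mult_left_mono) (simp_all add: algebra_simps)
  finally show ?thesis .
qed

text \<open>There are \<open>4 K\<close> blocks of length \<open>l\<close>;
  \<open>\<eta>\<close> bounds the invariant mass that is about to stay near \<open>0\<close>
  for one block, and \<open>\<eta>'\<close> the mass at the middle, time \<open>2 K l\<close>,
  about to stay there for at least \<open>K\<close> blocks. The first half of the blocks reduces
  the uncoupled mass to order \<open>\<eta>\<close>. During the last quarter, a stay of one
  block begins either before the middle, with cost \<open>\<eta>'\<close>, or in the uncoupled
  mass after it, with cost \<open>\<eta>\<close> times that mass. The result is of order
  \<open>\<eta>' + \<eta>\<^sup>2\<close> up to geometric terms.\<close>

lemma coupling_bound:
  assumes u: "lsv_cone 4 u" and v: "lsv_cone 4 v" and uv: "mass u = mass v"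
    and E: "0 \<le> E"
    and uE: "\<And>x. x \<in> {0..1} \<Longrightarrow> u x \<le> E * evolve b (- int N) N (\<lambda>_. 1) x"
    and vE: "\<And>x. x \<in> {0..1} \<Longrightarrow> v x \<le> E * evolve b (- int N) N (\<lambda>_. 1) x"
    and short: "\<And>k n. k < 4 * K \<Longrightarrow> (\<Sum>j<n. threshold b (l + j) (int (k * l) - int j)) \<le> \<eta>"
    and long: "\<And>m n. K \<le> m \<Longrightarrow> m < 2 * K \<Longrightarrow>
      (\<Sum>j<n. threshold b (m * l + l + j) (int (2 * K * l) - int j)) \<le> \<eta>'"
    and K: "0 < K" and n: "4 * K * l \<le> n"
  shows "L1 (\<lambda>x. evolve b 0 n (\<lambda>x. u x - v x) x) \<le>
    2 * E * ((1 - couple_rate) ^ K + 2 * \<eta>' + 2 * \<eta> * ((1 - couple_rate) ^ (2 * K) + 2 * \<eta>))"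
proof -
  obtain U V where U0: "U 0 = u" and V0: "V 0 = v"
    and Ucone: "\<And>k. lsv_cone 4 (U k)" and Vcone: "\<And>k. lsv_cone 4 (V k)"
    and eq: "\<And>k. mass (U k) = mass (V k)"
    and Ule: "\<And>k x. x \<in> {0..1} \<Longrightarrow> U (Suc k) x \<le> evolve b (int (k * l)) l (U k) x"
    and Vle: "\<And>k x. x \<in> {0..1} \<Longrightarrow> V (Suc k) x \<le> evolve b (int (k * l)) l (V k) x"
    and diff: "\<And>k x. x \<in> {0..1} \<Longrightarrow>
      evolve b (int (k * l)) l (U k) x - evolve b (int (k * l)) l (V k) x = U (Suc k) x - V (Suc k) x"
    and step: "\<And>k. mass (U (Suc k)) \<le> (1 - couple_rate) * mass (U k) + couple_rate *
       (mass_below (U k) (threshold b l (int (k * l))) + mass_below (V k) (threshold b l (int (k * l))))"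
    using coupling_sequence[OF u v uv, where l = l] by metis
  let ?q = "1 - couple_rate"
  define M where "M k = mass (U k)" for k
  have q: "0 \<le> ?q" "?q \<le> 1"
    using couple_rate by auto
  have \<eta>: "0 \<le> \<eta>"
    using short[of 0 0] K by simp
  have \<eta>': "0 \<le> \<eta>'"
    using long[of K 0] K by simp
  have dom: "U (k + m) x \<le> evolve b (int (k * l)) (m * l) (U k) x"
    "V (k + m) x \<le> evolve b (int (k * l)) (m * l) (V k) x" if "x \<in> {0..1}" for k m x
    by (rule dominated_evolve, erule Ule, rule that) (rule dominated_evolve, erule Vle, rule that)
  have bel: "mass_below (U k) (threshold b L (int (k * l))) \<le> E * S"
    "mass_below (V k) (threshold b L (int (k * l))) \<le> E * S"
    if "\<And>n. (\<Sum>j<n. threshold b (L + j) (int (k * l) - int j)) \<le> S" for k L S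
    using mass_below_dominated[of U k l E N L S] mass_below_dominated[of V k l E N L S]
      Ucone Vcone dom[of _ 0 k] E uE vE U0 V0 that by auto
  have M0: "M 0 \<le> E"
  proof -
    have "M 0 \<le> (\<integral>x. E * evolve b (- int N) N (\<lambda>_. 1) x \<partial>leb01)"
      unfolding M_def U0
      by (intro integral_mono lsv_cone_integrable[OF u] integrable_mult_right integrable_evolve) (auto intro: uE)
    then show ?thesis
      using integral_evolve_1 by simp
  qed
  have step1: "M (Suc k) \<le> ?q * M k + couple_rate * (2 * (E * \<eta>))" if "k < 4 * K" for k
  proof -
    have "mass_below (U k) (threshold b l (int (k * l))) + mass_below (V k) (threshold b l (int (k * l)))
        \<le> E * \<eta> + E * \<eta>"
      using that by (intro add_mono bel short)
    then have "couple_rate * (mass_below (U k) (threshold b l (int (k * l))) +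
        mass_below (V k) (threshold b l (int (k * l)))) \<le> couple_rate * (2 * (E * \<eta>))"
      using couple_rate by (intro mult_left_mono) auto
    then show ?thesis
      using step[of k] unfolding M_def by linarith
  qed
  have M2: "M (2 * K) \<le> E * (?q ^ (2 * K) + 2 * \<eta>)"
  proof -
    have "M (0 + 2 * K) \<le> ?q ^ (2 * K) * M 0 + 2 * (E * \<eta>)"
      using couple_rate E \<eta> by (intro affine_recursion_bound) (auto intro: step1)
    also have "\<dots> \<le> ?q ^ (2 * K) * E + 2 * (E * \<eta>)"
      using q M0 by (intro add_right_mono mult_left_mono) auto
    finally show ?thesis
      by (simp add: algebra_simps)
  qed
  have mono: "M (k + m) \<le> M k" for k m
  proof -
    have "M (k + m) \<le> mass (evolve b (int (k * l)) (m * l) (U k))"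
      unfolding M_def
      by (intro integral_mono integrable_evolve lsv_cone_integrable[OF Ucone] dom) simp
    then show ?thesis
      unfolding M_def by (simp add: integral_evolve[OF lsv_cone_integrable[OF Ucone]])
  qed
  let ?A = "E * \<eta>' + E * (?q ^ (2 * K) + 2 * \<eta>) * \<eta>"
  \<comment> \<open>The last quarter of the blocks, indexed from the middle.\<close>
  have late: "mass_below (U (2 * K + m)) (threshold b l (int ((2 * K + m) * l))) \<le> ?A"
    "mass_below (V (2 * K + m)) (threshold b l (int ((2 * K + m) * l))) \<le> ?A"
    if m: "K \<le> m" "m < 2 * K" for m
  proof -
    have *: "mass_below (W (2 * K + m)) (threshold b l (int ((2 * K + m) * l))) \<le> ?A"
      if W: "\<And>k. lsv_cone 4 (W k)" and Wdom: "\<And>x. x \<in> {0..1} \<Longrightarrow>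
          W (2 * K + m) x \<le> evolve b (int (2 * K * l)) (m * l) (W (2 * K)) x"
        and Wb: "mass_below (W (2 * K)) (threshold b (l + m * l) (int (2 * K * l))) \<le> E * \<eta>'"
        and WM: "mass (W (2 * K)) = M (2 * K)" for W
    proof -
      let ?t = "int (2 * K * l)"
      have t: "int ((2 * K + m) * l) = ?t + int (m * l)"
        by (simp add: algebra_simps)
      have "mass_below (W (2 * K + m)) (threshold b l (?t + int (m * l)))
          \<le> mass_below (evolve b ?t (m * l) (W (2 * K))) (threshold b l (?t + int (m * l)))"
        by (intro mass_below_mono integrable_evolve lsv_cone_integrable[OF W] Wdom)
      also have "\<dots> \<le> mass_below (W (2 * K)) (threshold b (l + m * l) ?t) +
          M (2 * K) * (\<Sum>j<m * l. threshold b (l + j) (?t + int (m * l) - int j))"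
        unfolding WM[symmetric] by (rule mass_below_evolve[OF W]) simp
      also have "\<dots> \<le> E * \<eta>' + M (2 * K) * \<eta>"
      proof (intro add_mono mult_left_mono Wb)
        show "(\<Sum>j<m * l. threshold b (l + j) (?t + int (m * l) - int j)) \<le> \<eta>"
          using short[of "2 * K + m" "m * l"] m unfolding t by simp
        show "0 \<le> M (2 * K)"
          unfolding M_def by (intro integral_nonneg_AE) (use lsv_cone_nonneg[OF Ucone] in auto)
      qed
      also have "\<dots> \<le> ?A"
        using M2 \<eta> by (intro add_left_mono mult_right_mono) auto
      finally show ?thesis
        unfolding t .
    qed
    have long': "(\<Sum>j<n. threshold b (l + m * l + j) (int (2 * K * l) - int j)) \<le> \<eta>'" for n
      using long[OF m, of n] by (simp only: add.commute[of l])
    show "mass_below (U (2 * K + m)) (threshold b l (int ((2 * K + m) * l))) \<le> ?A"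
      by (rule *[where W = U]) (rule Ucone, erule dom, rule bel[OF long'], simp add: M_def)
    show "mass_below (V (2 * K + m)) (threshold b l (int ((2 * K + m) * l))) \<le> ?A"
      by (rule *[where W = V]) (rule Vcone, erule dom, rule bel[OF long'], simp add: M_def eq)
  qed
  have A: "0 \<le> ?A"
    using E \<eta> \<eta>' q by (intro add_nonneg_nonneg mult_nonneg_nonneg) auto
  have M4: "M (4 * K) \<le> ?q ^ K * E + 2 * ?A"
  proof -
    have "M (3 * K + K) \<le> ?q ^ K * M (3 * K) + 2 * ?A"
    proof (rule affine_recursion_bound)
      fix i assume i: "i < K"
      have idx: "2 * K + (K + i) = 3 * K + i" by simp
      note late' = late[of "K + i", unfolded idx]
      have "mass_below (U (3 * K + i)) (threshold b l (int ((3 * K + i) * l))) \<le> ?A"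
        by (rule late'(1)) (use i in simp_all)
      moreover have "mass_below (V (3 * K + i)) (threshold b l (int ((3 * K + i) * l))) \<le> ?A"
        by (rule late'(2)) (use i in simp_all)
      ultimately have "mass_below (U (3 * K + i)) (threshold b l (int ((3 * K + i) * l))) +
          mass_below (V (3 * K + i)) (threshold b l (int ((3 * K + i) * l))) \<le> 2 * ?A"
        by (subst mult_2) (rule add_mono)
      then have "couple_rate * (mass_below (U (3 * K + i)) (threshold b l (int ((3 * K + i) * l))) +
          mass_below (V (3 * K + i)) (threshold b l (int ((3 * K + i) * l)))) \<le> couple_rate * (2 * ?A)"
        using couple_rate(1) by (rule mult_left_mono[OF _ less_imp_le])
      then show "M (3 * K + Suc i) \<le> ?q * M (3 * K + i) + couple_rate * (2 * ?A)"
        using step[of "3 * K + i"] unfolding M_def by simp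
    qed (use couple_rate A in auto)
    also have "\<dots> \<le> ?q ^ K * E + 2 * ?A"
      using q mono[of 0 "3 * K"] M0 by (intro add_right_mono mult_left_mono) auto
    finally show ?thesis by (simp add: algebra_simps)
  qed
  have evU: "evolve b 0 (k * l) u x - evolve b 0 (k * l) v x = U k x - V k x" if "x \<in> {0..1}" for k x
    using that
  proof (induction k arbitrary: x)
    case 0
    then show ?case by (simp add: U0 V0)
  next
    case (Suc k)
    have "evolve b 0 (Suc k * l) w = evolve b (int (k * l)) l (evolve b 0 (k * l) w)" for w
      using evolve_add[of b 0 "k * l" l w] by (simp add: add.commute)
    then have "evolve b 0 (Suc k * l) u x - evolve b 0 (Suc k * l) v x =
        evolve b (int (k * l)) l (\<lambda>x. evolve b 0 (k * l) u x - evolve b 0 (k * l) v x) x"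
      by (simp add: evolve_diff)
    also have "\<dots> = evolve b (int (k * l)) l (\<lambda>x. U k x - V k x) x"
      by (rule evolve_cong[OF Suc.IH Suc.prems])
    also have "\<dots> = U (Suc k) x - V (Suc k) x"
      using diff[OF Suc.prems] by (simp add: evolve_diff)
    finally show ?case .
  qed
  have int: "integrable leb01 (\<lambda>x. u x - v x)"
    using lsv_cone_integrable[OF u] lsv_cone_integrable[OF v] by simp
  have "evolve b 0 n (\<lambda>x. u x - v x) =
      evolve b (int (4 * K * l)) (n - 4 * K * l) (evolve b 0 (4 * K * l) (\<lambda>x. u x - v x))"
    using evolve_add[of b 0 "4 * K * l" "n - 4 * K * l"] n by simp
  then have "L1 (\<lambda>x. evolve b 0 n (\<lambda>x. u x - v x) x) \<le>
      L1 (\<lambda>x. evolve b 0 (4 * K * l) (\<lambda>x. u x - v x) x)"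
    using evolve_L1_contraction[OF integrable_evolve[OF int]] by simp
  also have "\<dots> = L1 (\<lambda>x. U (4 * K) x - V (4 * K) x)"
    by (intro Bochner_Integration.integral_cong) (simp_all add: evolve_diff evU)
  also have "\<dots> \<le> (\<integral>x. U (4 * K) x + V (4 * K) x \<partial>leb01)"
    using lsv_cone_nonneg[OF Ucone] lsv_cone_nonneg[OF Vcone]
    by (intro integral_mono integrable_abs Bochner_Integration.integrable_add Bochner_Integration.integrable_diff
        lsv_cone_integrable[OF Ucone] lsv_cone_integrable[OF Vcone]) (auto simp: abs_if)
  also have "\<dots> = 2 * M (4 * K)"
    using eq[of "4 * K"] lsv_cone_integrable[OF Ucone] lsv_cone_integrable[OF Vcone] by (simp add: M_def)
  also have "\<dots> \<le> 2 * (?q ^ K * E + 2 * ?A)"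
    using M4 by simp
  finally show ?thesis
    by (simp add: algebra_simps)
qed

end

section \<open>Escape from the neutral fixed point\<close>

definition good_count :: "(int \<Rightarrow> real) \<Rightarrow> real \<Rightarrow> int \<Rightarrow> nat \<Rightarrow> nat" where
  "good_count b \<gamma> t n = card {k. k < n \<and> b (t + int k) \<le> \<gamma>}"

lemma good_count_Suc_left:
  "good_count b \<gamma> t (Suc n) = (if b t \<le> \<gamma> then 1 else 0) + good_count b \<gamma> (t + 1) n"
proof -
  have "{k. k < Suc n \<and> b (t + int k) \<le> \<gamma>} =
      (if b t \<le> \<gamma> then {0} else {}) \<union> Suc ` {k. k < n \<and> b (t + 1 + int k) \<le> \<gamma>}"
  proof (intro equalityI subsetI)
    fix k assume "k \<in> {k. k < Suc n \<and> b (t + int k) \<le> \<gamma>}"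
    then show "k \<in> (if b t \<le> \<gamma> then {0} else {}) \<union> Suc ` {k. k < n \<and> b (t + 1 + int k) \<le> \<gamma>}"
      by (cases k) (auto simp: add_ac)
  qed (auto simp: add_ac split: if_splits)
  then show ?thesis
    unfolding good_count_def by (subst card_Un_disjoint[symmetric, of "if b t \<le> \<gamma> then {0} else {}"] |
      simp add: card_image card_insert_if)+
qed

context lsv_environment
begin

lemma threshold_pos: "0 < threshold b n t"
proof (induction n arbitrary: t)
  case (Suc n)
  let ?y = "threshold b n (t + 1)"
  have "left_inv (b t) ?y \<noteq> 0"
    using left_branch_left_inv[OF b_pos[of t], of ?y] Suc[of "t + 1"] threshold_bounds[of n "t + 1"]
    by (metis left_branch_0 less_irrefl less_imp_le)
  then show ?case
    using threshold_bounds[of "Suc n" t] by simp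
qed simp

text \<open>In the coordinate \<open>x\<close> to the power \<open>- \<gamma>\<close> an inverse
  left branch never decreases a point, and one with parameter at most \<open>\<gamma>\<close>
  moves it by at least \<open>\<gamma> / 2\<close>.\<close>

lemma threshold_powr_ge:
  assumes \<gamma>: "0 < \<gamma>"
  shows "1 + \<gamma> / 2 * real (good_count b \<gamma> t n) \<le> threshold b n t powr (- \<gamma>)"
proof (induction n arbitrary: t)
  case (Suc n)
  define y where "y = threshold b n (t + 1)"
  define x where "x = threshold b (Suc n) t"
  have x: "0 < x" "x \<le> 1/2" "left_branch (b t) x = y" "x \<le> y"
    using threshold_pos[of "Suc n" t] threshold_bounds[of n "t + 1"]
      left_inv[OF b_pos[of t], of y] left_inv_le_self[OF b_pos[of t], of y] unfolding x_def y_def by auto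
  have "y powr (- \<gamma>) + (if b t \<le> \<gamma> then \<gamma> / 2 else 0) \<le> x powr (- \<gamma>)"
  proof (cases "b t \<le> \<gamma>")
    case False
    then show ?thesis
      using x \<gamma> by (auto intro!: powr_mono2')
  next
    case True
    define w where "w = (2 * x) powr \<gamma>"
    have w: "0 < w" "w \<le> 1"
      unfolding w_def using x \<gamma> by (auto intro!: powr_le1)
    have "w \<le> (2 * x) powr b t"
      unfolding w_def using True x by (intro powr_mono') auto
    then have "x * (1 + w) \<le> x * (1 + (2 * x) powr b t)"
      using x by (intro mult_left_mono) auto
    moreover have "y = x * (1 + (2 * x) powr b t)"
      using x by (simp add: left_branch_def powr_mult)
    ultimately have "x * (1 + w) \<le> y" by simp
    then have "y powr (- \<gamma>) \<le> (x * (1 + w)) powr (- \<gamma>)"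
      using x w \<gamma> by (intro powr_mono2') auto
    also have "\<dots> = x powr (- \<gamma>) * (1 + w) powr (- \<gamma>)"
      by (rule powr_mult)
    finally have "y powr (- \<gamma>) * (1 + w) powr \<gamma> \<le> x powr (- \<gamma>) * (1 + w) powr (- \<gamma>) * (1 + w) powr \<gamma>"
      by (rule mult_right_mono) simp
    also have "\<dots> = x powr (- \<gamma>)"
      using w by (simp add: mult.assoc powr_add[symmetric])
    finally have 1: "y powr (- \<gamma>) * (1 + w) powr \<gamma> \<le> x powr (- \<gamma>)" .
    have y: "0 < y" "y \<le> 2 * x"
    proof -
      show "0 < y" using x by simp
      have "(2 * x) powr b t \<le> 1"
        using x b_pos[of t] by (intro powr_le1) auto
      then have "x * (1 + (2 * x) powr b t) \<le> x * 2"
        using x by (intro mult_left_mono) auto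
      moreover have "y = x * (1 + (2 * x) powr b t)"
        using x by (simp add: left_branch_def powr_mult)
      ultimately show "y \<le> 2 * x" by simp
    qed
    have "1 = (2 * x) powr (- \<gamma>) * w"
      unfolding w_def using x by (simp add: powr_add[symmetric])
    also have "\<dots> \<le> y powr (- \<gamma>) * w"
      using y \<gamma> w by (intro mult_right_mono powr_mono2') auto
    finally have "\<gamma> / 2 * 1 \<le> \<gamma> / 2 * (y powr (- \<gamma>) * w)"
      using \<gamma> by (intro mult_left_mono) auto
    then have "y powr (- \<gamma>) + \<gamma> / 2 \<le> y powr (- \<gamma>) * (1 + \<gamma> * w / 2)"
      by (simp add: algebra_simps)
    also have "\<dots> \<le> y powr (- \<gamma>) * (1 + w) powr \<gamma>"
      using w \<gamma> by (intro mult_left_mono one_plus_powr_ge) auto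
    finally show ?thesis
      using 1 True by simp
  qed
  moreover have "1 + \<gamma> / 2 * real (good_count b \<gamma> (t + 1) n) \<le> y powr (- \<gamma>)"
    unfolding y_def by (rule Suc.IH)
  ultimately show ?case
    unfolding good_count_Suc_left x_def[symmetric] by (auto simp: algebra_simps split: if_splits)
qed (simp add: good_count_def)

lemma threshold_le:
  assumes \<gamma>: "0 < \<gamma>" and \<theta>: "0 < \<theta>" and n: "0 < n" and good: "\<theta> * real n \<le> real (good_count b \<gamma> t n)"
  shows "threshold b n t \<le> (\<gamma> / 2 * \<theta>) powr (- 1 / \<gamma>) * real n powr (- 1 / \<gamma>)"
proof -
  have "\<gamma> / 2 * (\<theta> * real n) \<le> \<gamma> / 2 * real (good_count b \<gamma> t n)"
    using good \<gamma> by (intro mult_left_mono) auto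
  then have "\<gamma> / 2 * \<theta> * real n \<le> threshold b n t powr (- \<gamma>)"
    using threshold_powr_ge[OF \<gamma>, of t n] by simp
  then have "(threshold b n t powr (- \<gamma>)) powr (- 1 / \<gamma>) \<le> (\<gamma> / 2 * \<theta> * real n) powr (- 1 / \<gamma>)"
    using \<gamma> \<theta> n by (intro powr_mono2') auto
  also have "(threshold b n t powr (- \<gamma>)) powr (- 1 / \<gamma>) = threshold b n t"
    using \<gamma> threshold_pos[of n t] by (simp add: powr_powr)
  also have "(\<gamma> / 2 * \<theta> * real n) powr (- 1 / \<gamma>) = (\<gamma> / 2 * \<theta>) powr (- 1 / \<gamma>) * real n powr (- 1 / \<gamma>)"
    using \<gamma> \<theta> by (subst powr_mult) auto
  finally show ?thesis .
qed

end

text \<open>Comparison with the telescoping sum of an antiderivative.\<close>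

lemma powr_tail_sum_le:
  assumes e: "1 < e" and L: "0 < L"
  shows "(\<Sum>j<n. real (L + j) powr (- e)) \<le> (1 + 1 / (e - 1)) * real L powr (1 - e)"
proof -
  \<comment> \<open>The mean value theorem for the antiderivative on \<open>{x..x +
    1}\<close>.\<close>
  have step: "(x + 1) powr (- e) \<le> (x powr (1 - e) - (x + 1) powr (1 - e)) / (e - 1)"
    if x: "1 \<le> x" for x :: real
  proof -
    have "\<exists>z. x < z \<and> z < x + 1 \<and>
        (x + 1) powr (1 - e) - x powr (1 - e) = (x + 1 - x) * ((1 - e) * z powr (1 - e - 1))"
      using x by (intro MVT2) (auto intro!: derivative_eq_intros)
    then obtain z where z: "x < z" "z < x + 1" "(x + 1) powr (1 - e) - x powr (1 - e) = (1 - e) * z powr (- e)"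
      by auto
    have "(x + 1) powr (- e) \<le> z powr (- e)"
      using z x e by (intro powr_mono2') auto
    then have "(e - 1) * (x + 1) powr (- e) \<le> (e - 1) * z powr (- e)"
      using e by (intro mult_left_mono) auto
    then show ?thesis
      using z e by (simp add: field_simps)
  qed
  have tele: "(\<Sum>j<n. real (L + Suc j) powr (- e)) \<le> (real L powr (1 - e) - real (L + n) powr (1 - e)) / (e - 1)" for n
  proof (induction n)
    case (Suc n)
    show ?case
      using Suc step[of "real (L + n)"] L e by (simp add: add_ac diff_divide_distrib)
  qed simp
  show ?thesis
  proof (cases n)
    case (Suc m)
    have "(\<Sum>j<n. real (L + j) powr (- e)) = real L powr (- e) + (\<Sum>j<m. real (L + Suc j) powr (- e))"
      unfolding Suc by (subst sum.lessThan_Suc_shift) simp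
    also have "\<dots> \<le> real L powr (1 - e) + real L powr (1 - e) / (e - 1)"
    proof (intro add_mono)
      show "real L powr (- e) \<le> real L powr (1 - e)"
        using L by (intro powr_mono) auto
      have "(real L powr (1 - e) - real (L + m) powr (1 - e)) / (e - 1) \<le> real L powr (1 - e) / (e - 1)"
        using e by (intro divide_right_mono) auto
      then show "(\<Sum>j<m. real (L + Suc j) powr (- e)) \<le> real L powr (1 - e) / (e - 1)"
        using tele[of m] by linarith
    qed
    finally show ?thesis by (simp add: algebra_simps)
  qed (use e in simp)
qed

section \<open>Decay for environments with enough good maps\<close>

text \<open>The windows end at the block ends \<open>(k + 1) l\<close> for \<open>k < m\<close>
  and have any length \<open>l + t \<ge> l\<close>; in particular they reach arbitrarily far
  into the past.\<close>

definition good_blocks :: "(int \<Rightarrow> real) \<Rightarrow> real \<Rightarrow> real \<Rightarrow> nat \<Rightarrow> nat \<Rightarrow> bool" where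
  "good_blocks b \<gamma> \<theta> l m \<longleftrightarrow>
     (\<forall>k<m. \<forall>t. \<theta> * real (l + t) \<le> real (good_count b \<gamma> (int (k * l) - int t) (l + t)))"

lemma geometric_le_powr:
  fixes q a :: real
  assumes q: "0 < q" "q < 1"
  shows "\<exists>C>0. \<forall>k>0. q ^ k \<le> C * real k powr (- a)"
proof -
  \<comment> \<open>With \<open>r\<^sup>m = q\<close>, boundedness of \<open>k r\<^sup>k\<close>
    gives the claim after taking the power \<open>m \<ge> a\<close>.\<close>
  define m where "m = Suc (nat \<lceil>a\<rceil>)"
  have m: "0 < m" "a \<le> real m"
    unfolding m_def by linarith+
  define r where "r = q powr (1 / real m)"
  have r: "0 < r" "r < 1"
    unfolding r_def using q m powr_less_mono2[of "1 / real m" q 1] by auto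
  have rm: "r ^ m = q"
    using r q m powr_realpow[of r m] by (simp add: r_def powr_powr)
  have "(\<lambda>n. real n * r ^ n) \<longlonglongrightarrow> 0"
    using r by (intro powser_times_n_limit_0) auto
  then have "Bseq (\<lambda>n. real n * r ^ n)"
    by (intro convergent_imp_Bseq convergentI)
  then obtain C where C: "0 < C" "\<And>n. norm (real n * r ^ n) \<le> C"
    by (auto elim: BseqE)
  have "q ^ k \<le> C ^ m * real k powr (- a)" if k: "0 < k" for k
  proof -
    have "(real k * r ^ k) ^ m \<le> C ^ m"
      using C(2)[of k] r by (intro power_mono) auto
    then have "real k ^ m * q ^ k \<le> C ^ m"
      by (simp add: power_mult_distrib rm[symmetric] power_mult[symmetric] mult.commute)
    then have "q ^ k \<le> C ^ m / real k ^ m"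
      using k by (simp add: pos_le_divide_eq mult.commute)
    also have "\<dots> = C ^ m * real k powr (- real m)"
      using k by (simp add: powr_minus powr_realpow divide_inverse)
    also have "\<dots> \<le> C ^ m * real k powr (- a)"
      using C k m by (intro mult_left_mono powr_mono) auto
    finally show ?thesis .
  qed
  then show ?thesis
    using C by (intro exI[of _ "C ^ m"]) auto
qed

context lsv_environment
begin

text \<open>On good blocks both threshold sums in \<open>coupling_bound\<close> are tails of a
  convergent series of powers.\<close>

lemma coupling_on_good_blocks:
  assumes u: "lsv_cone 4 u" and v: "lsv_cone 4 v" and uv: "mass u = mass v"
    and E: "0 \<le> E"
    and uE: "\<And>x. x \<in> {0..1} \<Longrightarrow> u x \<le> E * evolve b (- int N) N (\<lambda>_. 1) x"
    and vE: "\<And>x. x \<in> {0..1} \<Longrightarrow> v x \<le> E * evolve b (- int N) N (\<lambda>_. 1) x"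
    and \<gamma>: "0 < \<gamma>" "\<gamma> < 1" and \<theta>: "0 < \<theta>" and l: "0 < l"
    and good: "good_blocks b \<gamma> \<theta> l (4 * K)"
    and K: "0 < K" and n: "4 * K * l \<le> n"
  defines "H \<equiv> (\<gamma> / 2 * \<theta>) powr (- 1 / \<gamma>) * (1 + 1 / (1 / \<gamma> - 1))"
  shows "L1 (\<lambda>x. evolve b 0 n (\<lambda>x. u x - v x) x) \<le>
    2 * E * ((1 - couple_rate) ^ K + 2 * (H * real (K * l) powr (1 - 1 / \<gamma>)) +
      2 * (H * real l powr (1 - 1 / \<gamma>)) * ((1 - couple_rate) ^ (2 * K) + 2 * (H * real l powr (1 - 1 / \<gamma>))))"
proof -
  let ?D = "(\<gamma> / 2 * \<theta>) powr (- 1 / \<gamma>)"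
  have e: "1 < 1 / \<gamma>"
    using \<gamma> by simp
  have H: "0 \<le> H"
    unfolding H_def using e by simp
  have thr: "threshold b (l + t) (int (k * l) - int t) \<le> ?D * real (l + t) powr (- (1 / \<gamma>))"
    if "k < 4 * K" for k t
  proof -
    have "threshold b (l + t) (int (k * l) - int t) \<le> ?D * real (l + t) powr (- 1 / \<gamma>)"
      using good that l by (intro threshold_le[OF \<gamma>(1) \<theta>]) (auto simp: good_blocks_def)
    then show ?thesis by simp
  qed
  have sum: "(\<Sum>j<n. ?D * real (L + j) powr (- (1 / \<gamma>))) \<le> H * real L powr (1 - 1 / \<gamma>)" if "0 < L" for L n
  proof -
    have "(\<Sum>j<n. ?D * real (L + j) powr (- (1 / \<gamma>))) = ?D * (\<Sum>j<n. real (L + j) powr (- (1 / \<gamma>)))"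
      by (rule sum_distrib_left[symmetric])
    also have "\<dots> \<le> ?D * ((1 + 1 / (1 / \<gamma> - 1)) * real L powr (1 - 1 / \<gamma>))"
      by (intro mult_left_mono powr_tail_sum_le e that) auto
    finally show ?thesis
      by (simp add: H_def mult_ac)
  qed
  show ?thesis
  proof (rule coupling_bound[OF u v uv E uE vE _ _ K n])
    fix k n assume k: "k < 4 * K"
    have "(\<Sum>j<n. threshold b (l + j) (int (k * l) - int j)) \<le> (\<Sum>j<n. ?D * real (l + j) powr (- (1 / \<gamma>)))"
      by (intro sum_mono thr k)
    also have "\<dots> \<le> H * real l powr (1 - 1 / \<gamma>)"
      by (rule sum[OF l])
    finally show "(\<Sum>j<n. threshold b (l + j) (int (k * l) - int j)) \<le> H * real l powr (1 - 1 / \<gamma>)" .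
  next
    fix m n assume m: "K \<le> m" "m < 2 * K"
    have "threshold b (m * l + l + j) (int (2 * K * l) - int j) \<le> ?D * real ((m * l + l) + j) powr (- (1 / \<gamma>))" for j
      using thr[of "2 * K + m" "m * l + j"] m by (simp add: algebra_simps)
    then have "(\<Sum>j<n. threshold b (m * l + l + j) (int (2 * K * l) - int j)) \<le>
        (\<Sum>j<n. ?D * real ((m * l + l) + j) powr (- (1 / \<gamma>)))"
      by (intro sum_mono)
    also have "\<dots> \<le> H * real (m * l + l) powr (1 - 1 / \<gamma>)"
      by (rule sum) (use l in simp)
    also have "\<dots> \<le> H * real (K * l) powr (1 - 1 / \<gamma>)"
    proof (intro mult_left_mono powr_mono2' H)
      show "real (K * l) \<le> real (m * l + l)"
        using mult_le_mono1[OF m(1), of l] by (simp only: of_nat_le_iff)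
    qed (use K l e in auto)
    finally show "(\<Sum>j<n. threshold b (m * l + l + j) (int (2 * K * l) - int j)) \<le> H * real (K * l) powr (1 - 1 / \<gamma>)" .
  qed
qed

end

text \<open>With \<open>l = K\<^sup>R\<close> the geometric terms are negligible, and the square
  of the one-block bound, of order \<open>l\<close> to the power \<open>2 (1 -
  1/\<gamma>)\<close>, is absorbed because \<open>l\<^sup>2 \<ge> K l\<close>.\<close>

lemma uniform_coupling:
  assumes \<beta>0: "0 < \<beta>0" "\<beta>0 < 1" and \<gamma>: "0 < \<gamma>" "\<gamma> < 1" and \<theta>: "0 < \<theta>" and R: "1 \<le> R"
  shows "\<exists>C\<ge>0. \<forall>b u v E N K n. lsv_environment b \<beta>0 \<longrightarrow> lsv_cone 4 u \<longrightarrow> lsv_cone 4 v \<longrightarrow>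
    mass u = mass v \<longrightarrow> 0 \<le> E \<longrightarrow>
    (\<forall>x\<in>{0..1}. u x \<le> E * evolve b (- int N) N (\<lambda>_. 1) x) \<longrightarrow>
    (\<forall>x\<in>{0..1}. v x \<le> E * evolve b (- int N) N (\<lambda>_. 1) x) \<longrightarrow>
    0 < K \<longrightarrow> good_blocks b \<gamma> \<theta> (K ^ R) (4 * K) \<longrightarrow> 4 * K ^ Suc R \<le> n \<longrightarrow>
    L1 (\<lambda>x. evolve b 0 n (\<lambda>x. u x - v x) x) \<le> E * C * real (K ^ Suc R) powr (1 - 1 / \<gamma>)"
proof -
  \<comment> \<open>The coupling rate depends on the environment only through
    \<open>\<beta>0\<close>; a constant environment serves to name it.\<close>
  interpret E: lsv_environment "\<lambda>_. \<beta>0" \<beta>0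
    by standard (use \<beta>0 in auto)
  define q where "q = 1 - E.couple_rate"
  have q: "0 < q" "q < 1"
    using E.couple_rate by (auto simp: q_def)
  define H where "H = (\<gamma> / 2 * \<theta>) powr (- 1 / \<gamma>) * (1 + 1 / (1 / \<gamma> - 1))"
  have e: "1 < 1 / \<gamma>"
    using \<gamma> by simp
  have H: "0 \<le> H"
    unfolding H_def using e by simp
  obtain C1 where C1: "0 < C1" "\<And>k. 0 < k \<Longrightarrow> q ^ k \<le> C1 * real k powr (- (real (Suc R) * (1 / \<gamma> - 1)))"
    using geometric_le_powr[OF q, of "real (Suc R) * (1 / \<gamma> - 1)"] by auto
  show ?thesis
  proof (intro exI[of _ "2 * (C1 + 2 * H + 2 * H * (C1 + 2 * H))"] conjI allI impI)
    show "0 \<le> 2 * (C1 + 2 * H + 2 * H * (C1 + 2 * H))"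
      using C1 H by simp
    fix b u v E N K n
    assume env: "lsv_environment b \<beta>0" and u: "lsv_cone 4 u" and v: "lsv_cone 4 v"
      and uv: "mass u = mass v" and E: "0 \<le> E"
      and uE: "\<forall>x\<in>{0..1}. u x \<le> E * evolve b (- int N) N (\<lambda>_. 1) x"
      and vE: "\<forall>x\<in>{0..1}. v x \<le> E * evolve b (- int N) N (\<lambda>_. 1) x"
      and K: "0 < K" and good: "good_blocks b \<gamma> \<theta> (K ^ R) (4 * K)" and n: "4 * K ^ Suc R \<le> n"
    interpret lsv_environment b \<beta>0 by (rule env)
    let ?y = "real (K ^ Suc R) powr (1 - 1 / \<gamma>)"
    let ?x = "real (K ^ R) powr (1 - 1 / \<gamma>)"
    have Kpow: "real (K ^ j) powr a = real K powr (real j * a)" for j a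
    proof -
      have "real (K ^ j) = real K powr real j"
        using K by (simp add: powr_realpow)
      then show ?thesis
        by (simp only: powr_powr)
    qed
    have qK: "q ^ K \<le> C1 * ?y"
      using C1(2)[OF K] unfolding Kpow by (simp add: algebra_simps)
    have q2K: "q ^ (2 * K) \<le> q ^ K"
      using q by (intro power_decreasing) auto
    then have q2K: "q ^ (2 * K) \<le> C1 * ?y"
      using qK by linarith
    have "real R * (1 - 1 / \<gamma>) \<le> 0"
      using e by (intro mult_nonneg_nonpos) auto
    then have x1: "?x \<le> 1" "0 \<le> ?x"
      unfolding Kpow using K powr_mono[of "real R * (1 - 1 / \<gamma>)" 0 "real K"] by auto
    have xx: "?x * ?x \<le> ?y"
    proof -
      have "?x * ?x = real K powr ((real R + real R) * (1 - 1 / \<gamma>))"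
        unfolding Kpow using K by (simp add: powr_add[symmetric] algebra_simps)
      also have "\<dots> \<le> real K powr (real (Suc R) * (1 - 1 / \<gamma>))"
        using K R e by (intro powr_mono mult_right_mono_neg) auto
      finally show ?thesis
        unfolding Kpow .
    qed
    have "L1 (\<lambda>x. evolve b 0 n (\<lambda>x. u x - v x) x) \<le>
        2 * E * (q ^ K + 2 * (H * real (K * K ^ R) powr (1 - 1 / \<gamma>)) + 2 * (H * ?x) * (q ^ (2 * K) + 2 * (H * ?x)))"
      unfolding q_def H_def
      by (rule coupling_on_good_blocks[OF u v uv E _ _ \<gamma> \<theta> _ good K])
        (use uE vE K n in \<open>auto simp: mult.assoc\<close>)
    also have "\<dots> \<le> 2 * E * (C1 * ?y + 2 * (H * ?y) + 2 * H * (C1 * ?y + 2 * H * ?y))"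
    proof (intro mult_left_mono add_mono)
      have "2 * (H * ?x) * (q ^ (2 * K) + 2 * (H * ?x)) = 2 * H * (?x * q ^ (2 * K) + 2 * H * (?x * ?x))"
        by (simp add: algebra_simps)
      also have "\<dots> \<le> 2 * H * (1 * (C1 * ?y) + 2 * H * ?y)"
        using H x1 xx q q2K by (intro mult_left_mono add_mono mult_mono) auto
      finally show "2 * (H * ?x) * (q ^ (2 * K) + 2 * (H * ?x)) \<le> 2 * H * (C1 * ?y + 2 * H * ?y)"
        by simp
    qed (use qK E H in auto)
    finally show "L1 (\<lambda>x. evolve b 0 n (\<lambda>x. u x - v x) x) \<le>
        E * (2 * (C1 + 2 * H + 2 * H * (C1 + 2 * H))) * ?y"
      by (simp add: algebra_simps)
  qed
qed

text \<open>The unnormalized form of \<open>g\<^sub>2 L\<^sup>k (g\<^sub>1)\<close>: here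
  \<open>f\<close> stands for the density at time \<open>- k\<close>, and the result belongs to
  time \<open>0\<close>.\<close>

definition observed :: "(int \<Rightarrow> real) \<Rightarrow> nat \<Rightarrow> (real \<Rightarrow> real) \<Rightarrow> (real \<Rightarrow> real) \<Rightarrow> (real \<Rightarrow> real) \<Rightarrow> real \<Rightarrow> real" where
  "observed b k g\<^sub>1 g\<^sub>2 f = (\<lambda>x. g\<^sub>2 x * evolve b (- int k) k (\<lambda>x. g\<^sub>1 x * f x) x)"

definition defect :: "(real \<Rightarrow> real) \<Rightarrow> (real \<Rightarrow> real) \<Rightarrow> real \<Rightarrow> real" where
  "defect h w = (\<lambda>x. w x - mass w * h x)"

definition lip_bounded :: "real \<Rightarrow> (real \<Rightarrow> real) \<Rightarrow> bool" where
  "lip_bounded G g \<longleftrightarrow> 0 \<le> G \<and> (\<forall>x\<in>{0..1}. \<bar>g x\<bar> \<le> G) \<and>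
     (\<forall>x\<in>{0..1}. \<forall>y\<in>{0..1}. \<bar>g x - g y\<bar> \<le> G * \<bar>x - y\<bar>)"

lemma lip_boundedD:
  assumes "lip_bounded G g"
  shows "0 \<le> G" "\<And>x. x \<in> {0..1} \<Longrightarrow> \<bar>g x\<bar> \<le> G"
    "\<And>x y. x \<in> {0..1} \<Longrightarrow> y \<in> {0..1} \<Longrightarrow> \<bar>g x - g y\<bar> \<le> G * \<bar>x - y\<bar>"
  using assms by (auto simp: lip_bounded_def)

text \<open>Add and subtract the affine function of \<open>lsv_cone_mult_affine\<close>.\<close>

lemma lip_bounded_split:
  assumes g: "lip_bounded G g" and f: "lsv_cone K f"
  obtains f\<^sub>1 f\<^sub>2 where "lsv_cone (Suc K) f\<^sub>1" "lsv_cone (Suc K) f\<^sub>2" "\<And>x. g x * f x = f\<^sub>1 x - f\<^sub>2 x"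
    "\<And>x. x \<in> {0..1} \<Longrightarrow> f\<^sub>1 x \<le> 5 * G * f x" "\<And>x. x \<in> {0..1} \<Longrightarrow> f\<^sub>2 x \<le> 5 * G * f x"
proof
  note G = lip_boundedD[OF g]
  show "lsv_cone (Suc K) (\<lambda>x. (g x + (4 * G - G * x)) * f x)"
    by (rule lsv_cone_mult_affine[OF f G(3,2,1)])
  show "lsv_cone (Suc K) (\<lambda>x. (0 + (4 * G - G * x)) * f x)"
    by (rule lsv_cone_mult_affine[OF f]) (use G(1) in auto)
  show "g x * f x = (g x + (4 * G - G * x)) * f x - (0 + (4 * G - G * x)) * f x" for x
    by (simp add: algebra_simps)
  fix x :: real assume x: "x \<in> {0..1}"
  have "0 \<le> f x" "0 \<le> G * x" "g x \<le> G"
    using x G(1) G(2)[OF x] lsv_cone_nonneg[OF f, of x] by auto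
  then show "(g x + (4 * G - G * x)) * f x \<le> 5 * G * f x" "(0 + (4 * G - G * x)) * f x \<le> 5 * G * f x"
    using G(1) by (auto intro!: mult_right_mono)
qed

lemma lip_bounded_measurable:
  assumes g: "lip_bounded G g"
  shows "g \<in> borel_measurable leb01"
proof -
  have "lsv_cone (Suc 0) (\<lambda>x. (g x + (4 * G - G * x)) * 1)"
    by (rule lsv_cone_mult_affine[OF _ lip_boundedD(3,2,1)[OF g]]) (simp add: lsv_cone_const)
  then have "(\<lambda>x. g x + (4 * G - G * x)) \<in> borel_measurable leb01"
    using lsv_cone_integrable by fastforce
  moreover have "(\<lambda>x. 4 * G - G * x) \<in> borel_measurable leb01"
    unfolding leb01_def by (rule measurable_restrict_space1) measurable
  ultimately have "(\<lambda>x. (g x + (4 * G - G * x)) - (4 * G - G * x)) \<in> borel_measurable leb01"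
    by (rule borel_measurable_diff)
  then show ?thesis by simp
qed

context lsv_environment
begin

text \<open>Each of the two multiplications by a Lipschitz function splits a function in two and
  costs one power of \<open>x\<close>, which leads from the cone of the images of
  \<open>1\<close> to \<open>lsv_cone 4\<close>, where coupling works.\<close>

lemma observed_split:
  assumes g1: "lip_bounded G\<^sub>1 g\<^sub>1" and g2: "lip_bounded G\<^sub>2 g\<^sub>2" and f: "lsv_cone 2 f"
  obtains q\<^sub>1 q\<^sub>2 q\<^sub>3 q\<^sub>4 where
    "\<And>q. q \<in> {q\<^sub>1, q\<^sub>2, q\<^sub>3, q\<^sub>4} \<Longrightarrow> lsv_cone 4 q"
    "\<And>q x. q \<in> {q\<^sub>1, q\<^sub>2, q\<^sub>3, q\<^sub>4} \<Longrightarrow> x \<in> {0..1} \<Longrightarrow> q x \<le> 25 * G\<^sub>1 * G\<^sub>2 * evolve b (- int k) k f x"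
    "observed b k g\<^sub>1 g\<^sub>2 f = (\<lambda>x. (q\<^sub>1 x - q\<^sub>2 x) - (q\<^sub>3 x - q\<^sub>4 x))"
proof -
  obtain p\<^sub>1 p\<^sub>2 where p: "lsv_cone 3 p\<^sub>1" "lsv_cone 3 p\<^sub>2" "\<And>x. g\<^sub>1 x * f x = p\<^sub>1 x - p\<^sub>2 x"
    "\<And>x. x \<in> {0..1} \<Longrightarrow> p\<^sub>1 x \<le> 5 * G\<^sub>1 * f x" "\<And>x. x \<in> {0..1} \<Longrightarrow> p\<^sub>2 x \<le> 5 * G\<^sub>1 * f x"
    using lip_bounded_split[OF g1 f] by (metis eval_nat_numeral(3) numeral_2_eq_2)
  let ?T = "evolve b (- int k) k"
  have ev: "lsv_cone 3 (?T p\<^sub>1)" "lsv_cone 3 (?T p\<^sub>2)"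
    by (intro lsv_cone_evolve p; simp)+
  have le: "?T p\<^sub>1 x \<le> 5 * G\<^sub>1 * ?T f x" "?T p\<^sub>2 x \<le> 5 * G\<^sub>1 * ?T f x" if "x \<in> {0..1}" for x
    using evolve_mono[OF p(4) that, where t = "- int k" and n = k] evolve_mono[OF p(5) that, where t = "- int k" and n = k]
    unfolding evolve_scale by auto
  have eq4: "Suc 3 = 4" by simp
  obtain q\<^sub>1 q\<^sub>2 where q12: "lsv_cone 4 q\<^sub>1" "lsv_cone 4 q\<^sub>2" "\<And>x. g\<^sub>2 x * ?T p\<^sub>1 x = q\<^sub>1 x - q\<^sub>2 x"
    "\<And>x. x \<in> {0..1} \<Longrightarrow> q\<^sub>1 x \<le> 5 * G\<^sub>2 * ?T p\<^sub>1 x" "\<And>x. x \<in> {0..1} \<Longrightarrow> q\<^sub>2 x \<le> 5 * G\<^sub>2 * ?T p\<^sub>1 x"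
    using lip_bounded_split[OF g2 ev(1)] unfolding eq4 by blast
  obtain q\<^sub>3 q\<^sub>4 where q34: "lsv_cone 4 q\<^sub>3" "lsv_cone 4 q\<^sub>4" "\<And>x. g\<^sub>2 x * ?T p\<^sub>2 x = q\<^sub>3 x - q\<^sub>4 x"
    "\<And>x. x \<in> {0..1} \<Longrightarrow> q\<^sub>3 x \<le> 5 * G\<^sub>2 * ?T p\<^sub>2 x" "\<And>x. x \<in> {0..1} \<Longrightarrow> q\<^sub>4 x \<le> 5 * G\<^sub>2 * ?T p\<^sub>2 x"
    using lip_bounded_split[OF g2 ev(2)] unfolding eq4 by blast
  have G2: "0 \<le> 5 * G\<^sub>2"
    using lip_boundedD(1)[OF g2] by simp
  have le25: "5 * G\<^sub>2 * ?T p\<^sub>1 x \<le> 25 * G\<^sub>1 * G\<^sub>2 * ?T f x" "5 * G\<^sub>2 * ?T p\<^sub>2 x \<le> 25 * G\<^sub>1 * G\<^sub>2 * ?T f x"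
    if "x \<in> {0..1}" for x
    using mult_left_mono[OF le(1)[OF that] G2] mult_left_mono[OF le(2)[OF that] G2] by (simp_all add: mult_ac)
  show thesis
  proof (rule that[of q\<^sub>1 q\<^sub>2 q\<^sub>3 q\<^sub>4])
    show "lsv_cone 4 q" if "q \<in> {q\<^sub>1, q\<^sub>2, q\<^sub>3, q\<^sub>4}" for q
      using that q12 q34 by auto
    show "q x \<le> 25 * G\<^sub>1 * G\<^sub>2 * ?T f x" if "q \<in> {q\<^sub>1, q\<^sub>2, q\<^sub>3, q\<^sub>4}" "x \<in> {0..1}" for q x
      using that(1) q12(4,5)[OF that(2)] q34(4,5)[OF that(2)] le25[OF that(2)] by auto
    have "(\<lambda>x. g\<^sub>1 x * f x) = (\<lambda>x. p\<^sub>1 x - p\<^sub>2 x)"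
      using p(3) by auto
    then show "observed b k g\<^sub>1 g\<^sub>2 f = (\<lambda>x. (q\<^sub>1 x - q\<^sub>2 x) - (q\<^sub>3 x - q\<^sub>4 x))"
      by (simp add: observed_def evolve_diff right_diff_distrib q12 q34)
  qed
qed

lemma observed_integrable:
  assumes g1: "g\<^sub>1 \<in> borel_measurable leb01" "\<And>x. x \<in> {0..1} \<Longrightarrow> \<bar>g\<^sub>1 x\<bar> \<le> G\<^sub>1"
    and g2: "g\<^sub>2 \<in> borel_measurable leb01" "\<And>x. x \<in> {0..1} \<Longrightarrow> \<bar>g\<^sub>2 x\<bar> \<le> G\<^sub>2"
    and G: "0 \<le> G\<^sub>1" "0 \<le> G\<^sub>2" and f: "integrable leb01 f"
  shows integrable_observed: "integrable leb01 (observed b k g\<^sub>1 g\<^sub>2 f)"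
    and observed_L1_le: "L1 (observed b k g\<^sub>1 g\<^sub>2 f) \<le> G\<^sub>1 * G\<^sub>2 * L1 f"
proof -
  have mult: "integrable leb01 (\<lambda>x. g x * u x) \<and> L1 (\<lambda>x. g x * u x) \<le> G * L1 u"
    if g: "g \<in> borel_measurable leb01" "\<And>x. x \<in> {0..1} \<Longrightarrow> \<bar>g x\<bar> \<le> G" and u: "integrable leb01 u" for g u :: "real \<Rightarrow> real" and G
  proof
    have le: "\<bar>g x * u x\<bar> \<le> G * \<bar>u x\<bar>" if "x \<in> {0..1}" for x
      unfolding abs_mult using g(2)[OF that] by (rule mult_right_mono) simp
    show int: "integrable leb01 (\<lambda>x. g x * u x)"
    proof (rule Bochner_Integration.integrable_bound)
      show "integrable leb01 (\<lambda>x. G * \<bar>u x\<bar>)"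
        using u by simp
      show "(\<lambda>x. g x * u x) \<in> borel_measurable leb01"
        by (intro borel_measurable_times g borel_measurable_integrable[OF u])
      show "AE x in leb01. norm (g x * u x) \<le> norm (G * \<bar>u x\<bar>)"
        by (intro AE_I2) (use le in \<open>force intro: order_trans[OF _ abs_ge_self]\<close>)
    qed
    have "L1 (\<lambda>x. g x * u x) \<le> (\<integral>x. G * \<bar>u x\<bar> \<partial>leb01)"
      using int u le by (intro integral_mono) auto
    then show "L1 (\<lambda>x. g x * u x) \<le> G * L1 u"
      by simp
  qed
  note 1 = mult[OF g1 f]
  note 2 = mult[OF g2 integrable_evolve[OF conjunct1[OF 1], of "- int k" k]]
  show "integrable leb01 (observed b k g\<^sub>1 g\<^sub>2 f)"
    unfolding observed_def using 2 by simp
  have "L1 (observed b k g\<^sub>1 g\<^sub>2 f) \<le> G\<^sub>2 * L1 (\<lambda>x. evolve b (- int k) k (\<lambda>x. g\<^sub>1 x * f x) x)"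
    unfolding observed_def using 2 by simp
  also have "\<dots> \<le> G\<^sub>2 * L1 (\<lambda>x. g\<^sub>1 x * f x)"
    by (intro mult_left_mono G evolve_L1_contraction conjunct1[OF 1])
  also have "\<dots> \<le> G\<^sub>2 * (G\<^sub>1 * L1 f)"
    by (intro mult_left_mono G conjunct2[OF 1])
  finally show "L1 (observed b k g\<^sub>1 g\<^sub>2 f) \<le> G\<^sub>1 * G\<^sub>2 * L1 f"
    by (simp add: mult_ac)
qed

lemma defect_integrable: "integrable leb01 w \<Longrightarrow> integrable leb01 h \<Longrightarrow> integrable leb01 (defect h w)"
  by (simp add: defect_def)

lemma evolve_defect_trivial:
  assumes w: "integrable leb01 w" and h: "integrable leb01 h" "L1 h = 1"
  shows "L1 (evolve b t n (defect h w)) \<le> 2 * L1 w"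
proof -
  have "L1 (evolve b t n (defect h w)) \<le> L1 (defect h w)"
    by (intro evolve_L1_contraction defect_integrable w h)
  also have "\<dots> \<le> (\<integral>x. \<bar>w x\<bar> + \<bar>\<integral>x. w x \<partial>leb01\<bar> * \<bar>h x\<bar> \<partial>leb01)"
    using w h by (intro integral_mono integrable_abs defect_integrable)
      (auto simp: defect_def abs_mult[symmetric] intro: abs_triangle_ineq4)
  also have "\<dots> = L1 w + \<bar>\<integral>x. w x \<partial>leb01\<bar>"
    using w h by simp
  also have "\<dots> \<le> 2 * L1 w"
    using integral_abs_bound[of leb01 w] by simp
  finally show ?thesis .
qed

end

lemma nat_power_between:
  fixes n R :: nat
  assumes "4 \<le> n"
  shows "\<exists>K>0. 4 * K ^ Suc R \<le> n \<and> n \<le> 4 * 2 ^ Suc R * K ^ Suc R"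
proof -
  have "n < 4 * Suc n ^ Suc R"
    using self_le_power[of "Suc n" "Suc R"] by simp
  then obtain K where K: "\<not> n < 4 * K ^ Suc R" "n < 4 * Suc K ^ Suc R"
    using ex_least_nat_less[of "\<lambda>K. n < 4 * K ^ Suc R" "Suc n"] by auto
  have "0 < K"
    using K assms by (cases K) auto
  moreover have "Suc K ^ Suc R \<le> (2 * K) ^ Suc R"
    using \<open>0 < K\<close> by (intro power_mono) auto
  then have "n \<le> 4 * (2 * K) ^ Suc R"
    using K(2) by linarith
  then have "n \<le> 4 * 2 ^ Suc R * K ^ Suc R"
    by (simp only: power_mult_distrib mult.assoc)
  ultimately show ?thesis
    using K(1) by (intro exI[of _ K]) auto
qed

text \<open>The factor \<open>B\<close> need only pay for the scales \<open>K\<close> on which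
  the blocks are not good: for given \<open>n\<close> the scale with \<open>4 K ^ Suc R\<close>
  comparable to \<open>n\<close> is used if it is good, and the trivial bound \<open>2 G\<^sub>1
  G\<^sub>2\<close> otherwise. The bound is uniform in \<open>N\<close>, which later tends to
  infinity.\<close>

lemma uniform_decay:
  assumes \<beta>0: "0 < \<beta>0" "\<beta>0 < 1" and \<gamma>: "0 < \<gamma>" "\<gamma> < 1" and \<theta>: "0 < \<theta>" and R: "1 \<le> R"
  shows "\<exists>C\<ge>0. \<forall>b g\<^sub>1 g\<^sub>2 G\<^sub>1 G\<^sub>2 B N k n. lsv_environment b \<beta>0 \<longrightarrow> lip_bounded G\<^sub>1 g\<^sub>1 \<longrightarrow> lip_bounded G\<^sub>2 g\<^sub>2 \<longrightarrow>
    1 \<le> B \<longrightarrow> (\<forall>K>0. \<not> good_blocks b \<gamma> \<theta> (K ^ R) (4 * K) \<longrightarrow> real (K ^ Suc R) powr (1 / \<gamma> - 1) \<le> B) \<longrightarrow>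
    0 < n \<longrightarrow>
    L1 (evolve b 0 n (defect (evolve b (- int (N + k)) (N + k) (\<lambda>_. 1))
        (observed b k g\<^sub>1 g\<^sub>2 (evolve b (- int (N + k)) N (\<lambda>_. 1)))))
      \<le> C * G\<^sub>1 * G\<^sub>2 * B * real n powr (1 - 1 / \<gamma>)"
proof -
  obtain C where C: "0 \<le> C" and "\<forall>b u v E N K n. lsv_environment b \<beta>0 \<longrightarrow> lsv_cone 4 u \<longrightarrow> lsv_cone 4 v \<longrightarrow>
    mass u = mass v \<longrightarrow> 0 \<le> E \<longrightarrow>
    (\<forall>x\<in>{0..1}. u x \<le> E * evolve b (- int N) N (\<lambda>_. 1) x) \<longrightarrow>
    (\<forall>x\<in>{0..1}. v x \<le> E * evolve b (- int N) N (\<lambda>_. 1) x) \<longrightarrow>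
    0 < K \<longrightarrow> good_blocks b \<gamma> \<theta> (K ^ R) (4 * K) \<longrightarrow> 4 * K ^ Suc R \<le> n \<longrightarrow>
    L1 (\<lambda>x. evolve b 0 n (\<lambda>x. u x - v x) x) \<le> E * C * real (K ^ Suc R) powr (1 - 1 / \<gamma>)"
    using uniform_coupling[OF \<beta>0 \<gamma> \<theta> R] by (elim exE conjE) (rule that)
  note coupling = this(2)[rule_format]
  define a where "a = 1 / \<gamma> - 1"
  have a: "0 < a" "1 - 1 / \<gamma> = - a"
    using \<gamma> by (auto simp: a_def)
  define D where "D = real (4 * 2 ^ Suc R) powr a"
  have "1 \<le> real (4 * 2 ^ Suc R)"
    using one_le_power[of "2 :: real" "Suc R"] by simp
  then have D: "1 \<le> D"
    unfolding D_def using a by (intro ge_one_powr_ge_zero) auto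
  show ?thesis
  proof (intro exI[of _ "(100 * C + 2) * D"] conjI allI impI)
    show "0 \<le> (100 * C + 2) * D"
      using C D by simp
    fix b g\<^sub>1 g\<^sub>2 G\<^sub>1 G\<^sub>2 B N k n
    assume env: "lsv_environment b \<beta>0" and g1: "lip_bounded G\<^sub>1 g\<^sub>1" and g2: "lip_bounded G\<^sub>2 g\<^sub>2"
      and B: "1 \<le> B" and bad: "\<forall>K>0. \<not> good_blocks b \<gamma> \<theta> (K ^ R) (4 * K) \<longrightarrow> real (K ^ Suc R) powr (1 / \<gamma> - 1) \<le> B"
      and n: "0 < (n::nat)"
    interpret lsv_environment b \<beta>0 by (rule env)
    define h where "h = evolve b (- int (N + k)) (N + k) (\<lambda>_. 1)"
    define f where "f = evolve b (- int (N + k)) N (\<lambda>_. 1)"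
    define w where "w = observed b k g\<^sub>1 g\<^sub>2 f"
    have hf: "h = evolve b (- int k) k f"
      unfolding h_def f_def by (simp add: evolve_add)
    have cone: "lsv_cone 2 h" "lsv_cone 2 f"
      unfolding h_def f_def by (rule lsv_cone_evolve_1)+
    have int: "integrable leb01 h" "integrable leb01 f"
      using cone by (auto intro: lsv_cone_integrable)
    have mass: "mass h = 1" "mass f = 1"
      unfolding h_def f_def by (rule integral_evolve_1)+
    have "L1 u = mass u" if "lsv_cone 2 u" for u
      by (intro Bochner_Integration.integral_cong) (auto simp: lsv_cone_nonneg[OF that])
    then have abs: "L1 h = 1" "L1 f = 1"
      using cone mass by auto
    note G1 = lip_boundedD[OF g1] and G2 = lip_boundedD[OF g2]
    note m1 = lip_bounded_measurable[OF g1] and m2 = lip_bounded_measurable[OF g2]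
    have w_int: "integrable leb01 w" and w_L1: "L1 w \<le> G\<^sub>1 * G\<^sub>2"
      using observed_integrable[OF m1 G1(2) m2 G2(2) G1(1) G2(1) int(2), of k] abs by (auto simp: w_def)
    have G: "0 \<le> G\<^sub>1 * G\<^sub>2"
      using G1 G2 by simp
    have trivial: "L1 (evolve b 0 n (defect h w)) \<le> 2 * (G\<^sub>1 * G\<^sub>2)"
      using evolve_defect_trivial[OF w_int int(1) abs(1), of 0 n] w_L1 by simp
    have "L1 (evolve b 0 n (defect h w)) \<le> (100 * C + 2) * (G\<^sub>1 * G\<^sub>2) * (B * (D * real n powr (- a)))"
    proof (cases "n < 4")
      case True
      have "real n powr a \<le> D"
        unfolding D_def
      proof (intro powr_mono2)
        have "(4::nat) * 1 \<le> 4 * 2 ^ Suc R"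
          by (intro mult_left_mono) auto
        with True have "n \<le> 4 * 2 ^ Suc R" by linarith
        then show "real n \<le> real (4 * 2 ^ Suc R)"
          by (simp only: of_nat_le_iff)
      qed (use a in auto)
      then have "1 \<le> D * real n powr (- a)"
        using n by (simp add: powr_minus field_simps)
      then have 1: "1 * 1 \<le> B * (D * real n powr (- a))"
        using B by (intro mult_mono) auto
      have "2 * (G\<^sub>1 * G\<^sub>2) * 1 \<le> (100 * C + 2) * (G\<^sub>1 * G\<^sub>2) * (B * (D * real n powr (- a)))"
        using 1 C G1(1) G2(1) by (intro mult_mono) auto
      then show ?thesis
        using trivial by simp
    next
      case False
      then obtain K where K: "0 < K" "4 * K ^ Suc R \<le> n" "n \<le> 4 * 2 ^ Suc R * K ^ Suc R"
        using nat_power_between[of n R] by auto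
      have "real n \<le> real (4 * 2 ^ Suc R * K ^ Suc R)"
        using K(3) by (simp only: of_nat_le_iff)
      then have "real (4 * 2 ^ Suc R) powr (- a) * real (K ^ Suc R) powr (- a) \<le> real n powr (- a)"
        using n a by (subst powr_mult[symmetric]) (auto intro!: powr_mono2' simp: mult_ac)
      then have "D * (real (4 * 2 ^ Suc R) powr (- a) * real (K ^ Suc R) powr (- a)) \<le> D * real n powr (- a)"
        using D by (intro mult_left_mono) auto
      moreover have "D * real (4 * 2 ^ Suc R) powr (- a) = 1"
        unfolding D_def by (simp add: powr_add[symmetric] add_pos_pos)
      ultimately have KD: "real (K ^ Suc R) powr (- a) \<le> D * real n powr (- a)"
        by (simp only: mult.assoc[symmetric] mult_1)
      show ?thesis
      proof (cases "good_blocks b \<gamma> \<theta> (K ^ R) (4 * K)")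
        case False
        then have "real (K ^ Suc R) powr a \<le> B"
          using bad K(1) by (simp add: a_def)
        then have "real (K ^ Suc R) powr a * real (K ^ Suc R) powr (- a) \<le> B * (D * real n powr (- a))"
          using KD B by (intro mult_mono) auto
        moreover have "real (K ^ Suc R) powr a * real (K ^ Suc R) powr (- a) = 1"
          using K(1) by (simp add: powr_add[symmetric])
        ultimately have 1: "1 \<le> B * (D * real n powr (- a))" by linarith
        have "2 * (G\<^sub>1 * G\<^sub>2) * 1 \<le> (100 * C + 2) * (G\<^sub>1 * G\<^sub>2) * (B * (D * real n powr (- a)))"
          using 1 C G1(1) G2(1) by (intro mult_mono) auto
        then show ?thesis
          using trivial by simp
      next
        case True
        obtain q\<^sub>1 q\<^sub>2 q\<^sub>3 q\<^sub>4 where q: "\<And>q. q \<in> {q\<^sub>1, q\<^sub>2, q\<^sub>3, q\<^sub>4} \<Longrightarrow> lsv_cone 4 q"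
          "\<And>q x. q \<in> {q\<^sub>1, q\<^sub>2, q\<^sub>3, q\<^sub>4} \<Longrightarrow> x \<in> {0..1} \<Longrightarrow> q x \<le> 25 * G\<^sub>1 * G\<^sub>2 * h x"
          and wq: "w = (\<lambda>x. (q\<^sub>1 x - q\<^sub>2 x) - (q\<^sub>3 x - q\<^sub>4 x))"
          unfolding w_def hf using observed_split[OF g1 g2 cone(2), of k] by blast
        have qint: "integrable leb01 q" if "q \<in> {q\<^sub>1, q\<^sub>2, q\<^sub>3, q\<^sub>4}" for q
          by (rule lsv_cone_integrable[OF q(1)[OF that]])
        have part: "L1 (evolve b 0 n (defect h q)) \<le>
            25 * G\<^sub>1 * G\<^sub>2 * C * real (K ^ Suc R) powr (- a)" if qin: "q \<in> {q\<^sub>1, q\<^sub>2, q\<^sub>3, q\<^sub>4}" for q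
        proof -
          let ?m = "\<integral>x. q x \<partial>leb01"
          have m0: "0 \<le> ?m"
            by (intro integral_nonneg_AE AE_I2) (use lsv_cone_nonneg[OF q(1)[OF qin]] in auto)
          have "?m \<le> (\<integral>x. 25 * G\<^sub>1 * G\<^sub>2 * h x \<partial>leb01)"
            by (intro integral_mono qint[OF qin] integrable_mult_right int) (use q(2)[OF qin] in auto)
          then have m: "?m \<le> 25 * G\<^sub>1 * G\<^sub>2"
            using mass(1) by simp
          have "L1 (\<lambda>x. evolve b 0 n (\<lambda>x. q x - ?m * h x) x) \<le>
              25 * G\<^sub>1 * G\<^sub>2 * C * real (K ^ Suc R) powr (1 - 1 / \<gamma>)"
          proof (rule coupling[OF env q(1)[OF qin] _ _ _ _ _ K(1) True K(2)])
            show "lsv_cone 4 (\<lambda>x. ?m * h x)"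
              using lsv_cone_mono[OF cone(1), of 4] by (intro lsv_cone_scale m0) simp
            show "?m = (\<integral>x. ?m * h x \<partial>leb01)"
              using mass(1) by simp
            show "0 \<le> 25 * G\<^sub>1 * G\<^sub>2"
              using G by simp
            show "q x \<le> 25 * G\<^sub>1 * G\<^sub>2 * evolve b (- int (N + k)) (N + k) (\<lambda>_. 1) x" if "x \<in> {0..1}" for x
              using q(2)[OF qin that] unfolding h_def .
            show "?m * h x \<le> 25 * G\<^sub>1 * G\<^sub>2 * evolve b (- int (N + k)) (N + k) (\<lambda>_. 1) x" if "x \<in> {0..1}" for x
              unfolding h_def[symmetric]
            proof -
              from that have "0 \<le> h x"
                using lsv_cone_nonneg[OF cone(1)] by auto
              then show "?m * h x \<le> 25 * G\<^sub>1 * G\<^sub>2 * h x"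
                by (rule mult_right_mono[OF m])
            qed
          qed
          then show ?thesis
            unfolding defect_def a(2) .
        qed
        have "defect h w = (\<lambda>x. (defect h q\<^sub>1 x - defect h q\<^sub>2 x) - (defect h q\<^sub>3 x - defect h q\<^sub>4 x))"
          unfolding wq defect_def using qint by (simp add: algebra_simps)
        then have split: "evolve b 0 n (defect h w) = (\<lambda>x. (evolve b 0 n (defect h q\<^sub>1) x - evolve b 0 n (defect h q\<^sub>2) x) -
            (evolve b 0 n (defect h q\<^sub>3) x - evolve b 0 n (defect h q\<^sub>4) x))"
          by (simp only: evolve_diff)
        have eint: "integrable leb01 (\<lambda>x. \<bar>evolve b 0 n (defect h q) x\<bar>)" if "q \<in> {q\<^sub>1, q\<^sub>2, q\<^sub>3, q\<^sub>4}" for q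
          by (intro integrable_abs integrable_evolve defect_integrable qint that int)
        have "L1 (evolve b 0 n (defect h w)) \<le>
          (\<integral>x. (\<bar>evolve b 0 n (defect h q\<^sub>1) x\<bar> + \<bar>evolve b 0 n (defect h q\<^sub>2) x\<bar>) +
            (\<bar>evolve b 0 n (defect h q\<^sub>3) x\<bar> + \<bar>evolve b 0 n (defect h q\<^sub>4) x\<bar>) \<partial>leb01)"
        proof (rule integral_mono)
          show "integrable leb01 (\<lambda>x. \<bar>evolve b 0 n (defect h w) x\<bar>)"
            by (intro integrable_abs integrable_evolve defect_integrable w_int int)
        qed (use eint in \<open>auto simp: split\<close>)
        also have "\<dots> = (L1 (evolve b 0 n (defect h q\<^sub>1)) + L1 (evolve b 0 n (defect h q\<^sub>2))) +
            (L1 (evolve b 0 n (defect h q\<^sub>3)) + L1 (evolve b 0 n (defect h q\<^sub>4)))"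
          using eint by simp
        also have "\<dots> \<le> 100 * C * (G\<^sub>1 * G\<^sub>2) * real (K ^ Suc R) powr (- a)"
          using part[of q\<^sub>1] part[of q\<^sub>2] part[of q\<^sub>3] part[of q\<^sub>4] by (simp add: algebra_simps)
        also have "\<dots> \<le> (100 * C + 2) * (G\<^sub>1 * G\<^sub>2) * (B * (D * real n powr (- a)))"
        proof (intro mult_mono mult_right_mono)
          have "1 * (D * real n powr (- a)) \<le> B * (D * real n powr (- a))"
            using B D by (intro mult_right_mono) auto
          then show "real (K ^ Suc R) powr (- a) \<le> B * (D * real n powr (- a))"
            using KD by linarith
        qed (use C G1(1) G2(1) in auto)
        finally show ?thesis .
      qed
    qed
    then show "L1 (evolve b 0 n (defect (evolve b (- int (N + k)) (N + k) (\<lambda>_. 1))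
        (observed b k g\<^sub>1 g\<^sub>2 (evolve b (- int (N + k)) N (\<lambda>_. 1)))))
      \<le> (100 * C + 2) * D * G\<^sub>1 * G\<^sub>2 * B * real n powr (1 - 1 / \<gamma>)"
      unfolding h_def w_def f_def a(2) by (simp only: mult_ac)
  qed
qed

section \<open>The driving system\<close>

definition orbit_env :: "'w measure \<Rightarrow> ('w \<Rightarrow> 'w) \<Rightarrow> ('w \<Rightarrow> real) \<Rightarrow> 'w \<Rightarrow> int \<Rightarrow> real" where
  "orbit_env P \<sigma> \<beta> \<omega> = (\<lambda>t. \<beta> (int_iterate P \<sigma> t \<omega>))"

context invertible_ergodic
begin

abbreviation \<sigma>inv :: "'w \<Rightarrow> 'w" where "\<sigma>inv \<equiv> the_inv_into (space P) \<sigma>"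

lemma \<sigma>_space: "\<omega> \<in> space P \<Longrightarrow> \<sigma> \<omega> \<in> space P"
  using bij by (auto simp: bij_betw_def)

lemma \<sigma>inv_space: "\<omega> \<in> space P \<Longrightarrow> \<sigma>inv \<omega> \<in> space P"
  using measurable_space[OF measurable_inverse] .

lemma \<sigma>inv_\<sigma>: "\<omega> \<in> space P \<Longrightarrow> \<sigma>inv (\<sigma> \<omega>) = \<omega>"
  using bij by (auto simp: bij_betw_def intro: the_inv_into_f_f)

lemma \<sigma>_\<sigma>inv: "\<omega> \<in> space P \<Longrightarrow> \<sigma> (\<sigma>inv \<omega>) = \<omega>"
  using bij by (auto simp: bij_betw_def intro: f_the_inv_into_f)

lemma int_iterate_0 [simp]: "int_iterate P \<sigma> 0 \<omega> = \<omega>"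
  by (simp add: int_iterate_def)

lemma int_iterate_of_nat: "int_iterate P \<sigma> (int n) \<omega> = (\<sigma> ^^ n) \<omega>"
  by (simp add: int_iterate_def)

lemma funpow_in_space:
  assumes "\<And>\<omega>. \<omega> \<in> space P \<Longrightarrow> f \<omega> \<in> space P" "\<omega> \<in> space P"
  shows "(f ^^ n) \<omega> \<in> space P"
  using assms by (induction n) auto

lemma int_iterate_space: "\<omega> \<in> space P \<Longrightarrow> int_iterate P \<sigma> k \<omega> \<in> space P"
  unfolding int_iterate_def using funpow_in_space[OF \<sigma>_space] funpow_in_space[OF \<sigma>inv_space] by auto

lemma int_iterate_plus_1:
  assumes \<omega>: "\<omega> \<in> space P"
  shows "int_iterate P \<sigma> (k + 1) \<omega> = \<sigma> (int_iterate P \<sigma> k \<omega>)"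
proof (cases "0 \<le> k")
  case True
  then have "nat (k + 1) = Suc (nat k)" by simp
  then show ?thesis
    using True by (simp add: int_iterate_def)
next
  case False
  then have k: "nat (- k) = Suc (nat (- (k + 1)))" by simp
  have "\<sigma> (\<sigma>inv ((\<sigma>inv ^^ nat (- (k + 1))) \<omega>)) = (\<sigma>inv ^^ nat (- (k + 1))) \<omega>"
    by (intro \<sigma>_\<sigma>inv funpow_in_space \<sigma>inv_space \<omega>)
  then show ?thesis
    using False k by (cases "k = -1") (auto simp: int_iterate_def)
qed

lemma int_iterate_minus_1:
  assumes \<omega>: "\<omega> \<in> space P"
  shows "int_iterate P \<sigma> (k - 1) \<omega> = \<sigma>inv (int_iterate P \<sigma> k \<omega>)"
  using int_iterate_plus_1[OF \<omega>, of "k - 1"] \<sigma>inv_\<sigma>[OF int_iterate_space[OF \<omega>, of "k - 1"]] by simp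

lemma int_iterate_add:
  assumes \<omega>: "\<omega> \<in> space P"
  shows "int_iterate P \<sigma> j (int_iterate P \<sigma> k \<omega>) = int_iterate P \<sigma> (j + k) \<omega>"
proof (induction j rule: int_induct[where k = 0])
  case (step1 j)
  then show ?case
    using int_iterate_plus_1[OF int_iterate_space[OF \<omega>], of j k] int_iterate_plus_1[OF \<omega>, of "j + k"]
    by (simp add: algebra_simps)
next
  case (step2 j)
  then show ?case
    using int_iterate_minus_1[OF int_iterate_space[OF \<omega>], of j k] int_iterate_minus_1[OF \<omega>, of "j + k"]
    by (simp add: algebra_simps)
qed simp

lemma funpow_invariant:
  assumes f: "f \<in> P \<rightarrow>\<^sub>M P" and inv: "distr P P f = P"
  shows "f ^^ n \<in> P \<rightarrow>\<^sub>M P \<and> distr P P (f ^^ n) = P"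
proof (induction n)
  case 0
  have "distr P P id = distr P P (\<lambda>x. x)"
    by (rule distr_cong) auto
  then show ?case
    by (simp add: distr_id)
next
  case (Suc n)
  have meas: "f \<circ> (f ^^ n) \<in> P \<rightarrow>\<^sub>M P"
    using Suc f by (intro measurable_comp) auto
  have "distr (distr P P (f ^^ n)) P f = distr P P (f \<circ> (f ^^ n))"
    using Suc f by (intro distr_distr) auto
  moreover have "distr (distr P P (f ^^ n)) P f = P"
    using Suc inv by simp
  ultimately show ?case
    unfolding funpow.simps using meas by (intro conjI) (rule meas, metis)
qed

lemma \<sigma>inv_invariant: "distr P P \<sigma>inv = P"
proof -
  have "distr P P \<sigma>inv = distr (distr P P \<sigma>) P \<sigma>inv"
    by (simp add: measure_preserving)
  also have "\<dots> = distr P P (\<sigma>inv \<circ> \<sigma>)"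
    by (rule distr_distr[OF measurable_inverse measurable_map])
  also have "\<dots> = distr P P (\<lambda>x. x)"
    by (rule distr_cong) (auto simp: \<sigma>inv_\<sigma>)
  finally show ?thesis
    by (simp add: distr_id)
qed

lemma int_iterate_invariant:
  shows measurable_int_iterate: "int_iterate P \<sigma> k \<in> P \<rightarrow>\<^sub>M P"
    and distr_int_iterate: "distr P P (int_iterate P \<sigma> k) = P"
  using funpow_invariant[OF measurable_map measure_preserving] funpow_invariant[OF measurable_inverse \<sigma>inv_invariant]
  by (auto simp: int_iterate_def)

lemma AE_int_iterate:
  assumes "AE \<omega> in P. Q \<omega>"
  shows "AE \<omega> in P. Q (int_iterate P \<sigma> k \<omega>)"
proof -
  have "AE \<omega> in distr P P (int_iterate P \<sigma> k). Q \<omega>"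
    unfolding distr_int_iterate by (rule assms)
  then show ?thesis
    by (rule AE_distrD[OF measurable_int_iterate])
qed

lemma prob_int_iterate:
  assumes "{\<omega> \<in> space P. Q \<omega>} \<in> sets P"
  shows "prob {\<omega> \<in> space P. Q (int_iterate P \<sigma> k \<omega>)} = prob {\<omega> \<in> space P. Q \<omega>}"
proof -
  have "prob {\<omega> \<in> space P. Q \<omega>} = measure (distr P P (int_iterate P \<sigma> k)) {\<omega> \<in> space P. Q \<omega>}"
    by (simp add: distr_int_iterate)
  also have "\<dots> = prob (int_iterate P \<sigma> k -` {\<omega> \<in> space P. Q \<omega>} \<inter> space P)"
    by (rule measure_distr[OF measurable_int_iterate assms])
  also have "int_iterate P \<sigma> k -` {\<omega> \<in> space P. Q \<omega>} \<inter> space P = {\<omega> \<in> space P. Q (int_iterate P \<sigma> k \<omega>)}"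
    using int_iterate_space by auto
  finally show ?thesis by simp
qed

end

section \<open>Few good maps are unlikely\<close>

locale mixing_environment = invertible_ergodic P \<sigma> for P :: "'w measure" and \<sigma> +
  fixes \<beta> :: "'w \<Rightarrow> real" and \<gamma> :: real
  assumes \<beta>_measurable: "\<beta> \<in> borel_measurable P"
begin

text \<open>The \<sigma>-algebra \<open>events_from P \<sigma> \<beta> J\<close> as a measure
  space, so that measurability of functions with respect to it can be expressed.\<close>

abbreviation param_algebra :: "int set \<Rightarrow> 'w measure" where
  "param_algebra J \<equiv> sigma (space P) {(\<lambda>\<omega>. \<beta> (int_iterate P \<sigma> j \<omega>)) -` A \<inter> space P | j A. j \<in> J \<and> A \<in> sets borel}"

lemma sets_param_algebra: "sets (param_algebra J) = events_from P \<sigma> \<beta> J"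
  unfolding events_from_def by (rule sets_measure_of) auto

lemma space_param_algebra [simp]: "space (param_algebra J) = space P"
  by (rule space_measure_of) auto

lemma events_from_mono: "J \<subseteq> J' \<Longrightarrow> events_from P \<sigma> \<beta> J \<subseteq> events_from P \<sigma> \<beta> J'"
  unfolding events_from_def by (rule sigma_sets_mono') blast

lemma events_from_subset: "events_from P \<sigma> \<beta> J \<subseteq> sets P"
  unfolding events_from_def
  by (rule sets.sigma_sets_subset) (use measurable_sets[OF measurable_compose[OF measurable_int_iterate \<beta>_measurable]] in auto)

lemma alpha_bound:
  assumes A: "A \<in> events_from P \<sigma> \<beta> {..i}" and B: "B \<in> events_from P \<sigma> \<beta> {j..}" and ij: "i + int n \<le> j"
  shows "\<bar>prob (A \<inter> B) - prob A * prob B\<bar> \<le> alpha_mixing P \<sigma> \<beta> n"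
  unfolding alpha_mixing_def
proof (rule cSup_upper)
  have "B \<in> events_from P \<sigma> \<beta> {i + int n..}"
    using B events_from_mono[of "{j..}" "{i + int n..}"] ij by auto
  then show "\<bar>prob (A \<inter> B) - prob A * prob B\<bar> \<in> {\<bar>prob (A \<inter> B) - prob A * prob B\<bar> | i A B.
            A \<in> events_from P \<sigma> \<beta> {..i} \<and> B \<in> events_from P \<sigma> \<beta> {i + int n..}}"
    using A by blast
  have "\<bar>prob (A \<inter> B) - prob A * prob B\<bar> \<le> 1" for A B
  proof -
    have "0 \<le> prob A * prob B" "prob A * prob B \<le> 1 * 1"
      by (intro mult_nonneg_nonneg mult_mono; simp)+
    then show ?thesis
      using prob_le_1[of "A \<inter> B"] measure_nonneg[of P "A \<inter> B"] unfolding abs_le_iff by linarith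
  qed
  then show "bdd_above {\<bar>prob (A \<inter> B) - prob A * prob B\<bar> | i A B.
            A \<in> events_from P \<sigma> \<beta> {..i} \<and> B \<in> events_from P \<sigma> \<beta> {i + int n..}}"
    by (auto simp: bdd_above_def)
qed

lemma alpha_nonneg: "0 \<le> alpha_mixing P \<sigma> \<beta> n"
proof -
  have "space P \<in> events_from P \<sigma> \<beta> J" for J
    unfolding sets_param_algebra[symmetric] using sets.top[of "param_algebra J"] by simp
  from alpha_bound[OF this this, of 0 n "int n"] show ?thesis by simp
qed

lemma alpha_le_1: "alpha_mixing P \<sigma> \<beta> n \<le> 1"
  unfolding alpha_mixing_def
proof (rule cSup_least)
  have "space P \<in> events_from P \<sigma> \<beta> J" for J
    unfolding sets_param_algebra[symmetric] using sets.top[of "param_algebra J"] by simp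
  then show "{\<bar>prob (A \<inter> B) - prob A * prob B\<bar> | i A B.
            A \<in> events_from P \<sigma> \<beta> {..i} \<and> B \<in> events_from P \<sigma> \<beta> {i + int n..}} \<noteq> {}"
    by blast
  fix x assume "x \<in> {\<bar>prob (A \<inter> B) - prob A * prob B\<bar> | i A B.
            A \<in> events_from P \<sigma> \<beta> {..i} \<and> B \<in> events_from P \<sigma> \<beta> {i + int n..}}"
  then obtain A B where x: "x = \<bar>prob (A \<inter> B) - prob A * prob B\<bar>" by blast
  have "0 \<le> prob A * prob B" "prob A * prob B \<le> 1 * 1"
    by (intro mult_nonneg_nonneg mult_mono; simp)+
  then show "x \<le> 1"
    using prob_le_1[of "A \<inter> B"] measure_nonneg[of P "A \<inter> B"] unfolding x abs_le_iff by linarith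
qed

definition good :: "int \<Rightarrow> 'w set" where
  "good t = {\<omega> \<in> space P. \<beta> (int_iterate P \<sigma> t \<omega>) \<le> \<gamma>}"

abbreviation count :: "int \<Rightarrow> nat \<Rightarrow> 'w \<Rightarrow> nat" where
  "count t n \<omega> \<equiv> good_count (orbit_env P \<sigma> \<beta> \<omega>) \<gamma> t n"

lemma good_in_events: "t \<in> J \<Longrightarrow> good t \<in> events_from P \<sigma> \<beta> J"
proof -
  assume "t \<in> J"
  then have "(\<lambda>\<omega>. \<beta> (int_iterate P \<sigma> t \<omega>)) -` {..\<gamma>} \<inter> space P \<in> events_from P \<sigma> \<beta> J"
    unfolding events_from_def by (intro sigma_sets.Basic CollectI exI[of _ t] exI[of _ "{..\<gamma>}"]) auto
  also have "(\<lambda>\<omega>. \<beta> (int_iterate P \<sigma> t \<omega>)) -` {..\<gamma>} \<inter> space P = good t"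
    by (auto simp: good_def)
  finally show ?thesis .
qed

lemma good_sets [measurable]: "good t \<in> sets P"
  using good_in_events[of t UNIV] events_from_subset by auto

lemma prob_good: "prob (good t) = prob (good 0)"
  using prob_int_iterate[of "\<lambda>\<omega>. \<beta> \<omega> \<le> \<gamma>" t] good_sets[of 0] by (simp add: good_def)

lemma count_eq_sum: "\<omega> \<in> space P \<Longrightarrow> real (count t n \<omega>) = (\<Sum>k<n. indicator (good (t + int k)) \<omega>)"
proof -
  assume \<omega>: "\<omega> \<in> space P"
  have "(\<Sum>k<n. indicator (good (t + int k)) \<omega> :: real) = (\<Sum>k\<in>{k \<in> {..<n}. \<omega> \<in> good (t + int k)}. 1)"
    by (simp add: indicator_def sum.If_cases Int_def)
  then show ?thesis
    using \<omega> by (simp add: good_count_def orbit_env_def good_def)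
qed

lemma count_measurable_events:
  assumes "\<And>k. k < n \<Longrightarrow> t + int k \<in> J"
  shows "{\<omega> \<in> space P. real (count t n \<omega>) < c} \<in> events_from P \<sigma> \<beta> J"
proof -
  have "(\<lambda>\<omega>. \<Sum>k<n. indicator (good (t + int k)) \<omega> :: real) \<in> borel_measurable (param_algebra J)"
    by (intro borel_measurable_sum borel_measurable_indicator) (auto simp: sets_param_algebra assms intro: good_in_events)
  then have "{\<omega> \<in> space (param_algebra J). (\<Sum>k<n. indicator (good (t + int k)) \<omega> :: real) < c} \<in> sets (param_algebra J)"
    by measurable
  also have "{\<omega> \<in> space (param_algebra J). (\<Sum>k<n. indicator (good (t + int k)) \<omega> :: real) < c} =
      {\<omega> \<in> space P. real (count t n \<omega>) < c}"
    by (auto simp: count_eq_sum)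
  finally show ?thesis
    by (simp add: sets_param_algebra)
qed

lemma count_sets [measurable]: "{\<omega> \<in> space P. real (count t n \<omega>) < c} \<in> sets P"
  using count_measurable_events[of n t UNIV c] events_from_subset by auto

lemma covariance_good: "prob (good i \<inter> good j) - prob (good 0) * prob (good 0) \<le> alpha_mixing P \<sigma> \<beta> (nat \<bar>i - j\<bar>)"
proof -
  have *: "prob (good i \<inter> good j) - prob (good 0) * prob (good 0) \<le> alpha_mixing P \<sigma> \<beta> (nat \<bar>i - j\<bar>)" if "i \<le> j" for i j
    using alpha_bound[OF good_in_events good_in_events, of i i j j "nat \<bar>i - j\<bar>"] that
    by (simp add: prob_good[of i] prob_good[of j] abs_le_iff)
  show ?thesis
    using *[of i j] *[of j i] by (cases "i \<le> j") (auto simp: Int_commute abs_minus_commute)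
qed

text \<open>The covariances are bounded by mixing coefficients, and each row of the covariance
  matrix meets every coefficient at most twice.\<close>

lemma variance_count:
  assumes A: "\<And>n. (\<Sum>k<n. alpha_mixing P \<sigma> \<beta> k) \<le> A"
  shows "(\<integral>\<omega>. ((\<Sum>k<n. indicator (good (t + int k)) \<omega>) - prob (good 0) * real n)\<^sup>2 \<partial>P) \<le> 2 * A * real n"
proof -
  let ?p = "prob (good 0)" and ?X = "\<lambda>k. indicator (good (t + int k)) :: 'w \<Rightarrow> real"
  have row: "(\<Sum>j<n. alpha_mixing P \<sigma> \<beta> (nat \<bar>int i - int j\<bar>)) \<le> 2 * A" if i: "i < n" for i
  proof -
    have "(\<Sum>j<n. alpha_mixing P \<sigma> \<beta> (nat \<bar>int i - int j\<bar>)) =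
        (\<Sum>j<i. alpha_mixing P \<sigma> \<beta> (nat \<bar>int i - int j\<bar>)) + (\<Sum>j=i..<n. alpha_mixing P \<sigma> \<beta> (nat \<bar>int i - int j\<bar>))"
      using i by (subst sum.union_disjoint[symmetric]) (auto intro!: sum.cong)
    also have "(\<Sum>j<i. alpha_mixing P \<sigma> \<beta> (nat \<bar>int i - int j\<bar>)) = (\<Sum>j<i. alpha_mixing P \<sigma> \<beta> (Suc j))"
      by (rule sum.reindex_bij_witness[of _ "\<lambda>j. i - Suc j" "\<lambda>j. i - Suc j"])
        (auto simp: nat_diff_distrib' intro!: arg_cong[where f = "alpha_mixing P \<sigma> \<beta>"])
    also have "(\<Sum>j<i. alpha_mixing P \<sigma> \<beta> (Suc j)) \<le> (\<Sum>k<Suc i. alpha_mixing P \<sigma> \<beta> k)"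
      by (subst sum.lessThan_Suc_shift) (simp add: alpha_nonneg)
    also have "\<dots> \<le> A"
      by (rule A)
    also have "(\<Sum>j=i..<n. alpha_mixing P \<sigma> \<beta> (nat \<bar>int i - int j\<bar>)) = (\<Sum>k<n - i. alpha_mixing P \<sigma> \<beta> k)"
      by (rule sum.reindex_bij_witness[of _ "\<lambda>k. i + k" "\<lambda>j. j - i"])
        (auto intro!: arg_cong[where f = "alpha_mixing P \<sigma> \<beta>"])
    also have "\<dots> \<le> A"
      by (rule A)
    finally show ?thesis by simp
  qed
  have int1: "integrable P (\<lambda>\<omega>. (?X i \<omega> - ?p) * (?X j \<omega> - ?p))" for i j
    by (rule integrable_const_bound[where B = 1])
      (auto intro!: AE_I2 mult_le_one simp: abs_mult indicator_def)
  have int2: "(\<integral>\<omega>. (?X i \<omega> - ?p) * (?X j \<omega> - ?p) \<partial>P) = prob (good (t + int i) \<inter> good (t + int j)) - ?p * ?p" for i j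
  proof -
    have "(?X i \<omega> - ?p) * (?X j \<omega> - ?p) =
        indicator (good (t + int i) \<inter> good (t + int j)) \<omega> - ?p * ?X i \<omega> - ?p * ?X j \<omega> + ?p * ?p" for \<omega>
      by (simp add: indicator_inter_arith algebra_simps)
    then have "(\<integral>\<omega>. (?X i \<omega> - ?p) * (?X j \<omega> - ?p) \<partial>P) =
        (\<integral>\<omega>. indicator (good (t + int i) \<inter> good (t + int j)) \<omega> - ?p * ?X i \<omega> - ?p * ?X j \<omega> + ?p * ?p \<partial>P)"
      by simp
    also have "\<dots> = prob (good (t + int i) \<inter> good (t + int j)) - ?p * prob (good (t + int i)) - ?p * prob (good (t + int j)) + ?p * ?p"
    proof -
      have i: "integrable P (indicator B :: 'w \<Rightarrow> real)" "(\<integral>\<omega>. indicator B \<omega> \<partial>P) = prob B" if "B \<in> sets P" for B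
        using that by (auto simp: integrable_indicator_iff less_top[symmetric] sets.Int_space_eq2)
      have g: "good (t + int i) \<in> sets P" "good (t + int j) \<in> sets P" "good (t + int i) \<inter> good (t + int j) \<in> sets P"
        by auto
      show ?thesis
        using i[OF g(1)] i[OF g(2)] i[OF g(3)] by (simp add: prob_space)
    qed
    finally show ?thesis
      by (simp add: prob_good[of "t + int i"] prob_good[of "t + int j"])
  qed
  have "((\<Sum>k<n. ?X k \<omega>) - ?p * real n)\<^sup>2 = (\<Sum>i<n. \<Sum>j<n. (?X i \<omega> - ?p) * (?X j \<omega> - ?p))" for \<omega>
  proof -
    have "(\<Sum>k<n. ?X k \<omega>) - ?p * real n = (\<Sum>k<n. ?X k \<omega> - ?p)"
      by (simp add: sum_subtractf mult.commute)
    then show ?thesis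
      by (simp only: power2_eq_square sum_product)
  qed
  then have "(\<integral>\<omega>. ((\<Sum>k<n. ?X k \<omega>) - ?p * real n)\<^sup>2 \<partial>P) =
      (\<integral>\<omega>. (\<Sum>i<n. \<Sum>j<n. (?X i \<omega> - ?p) * (?X j \<omega> - ?p)) \<partial>P)"
    by simp
  also have "\<dots> = (\<Sum>i<n. \<Sum>j<n. prob (good (t + int i) \<inter> good (t + int j)) - ?p * ?p)"
    using int1 by (simp add: int2 Bochner_Integration.integral_sum Bochner_Integration.integrable_sum)
  also have "\<dots> \<le> (\<Sum>i<n. \<Sum>j<n. alpha_mixing P \<sigma> \<beta> (nat \<bar>int i - int j\<bar>))"
  proof (intro sum_mono)
    fix i j
    show "prob (good (t + int i) \<inter> good (t + int j)) - ?p * ?p \<le> alpha_mixing P \<sigma> \<beta> (nat \<bar>int i - int j\<bar>)"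
      using covariance_good[of "t + int i" "t + int j"] by simp
  qed
  also have "\<dots> \<le> (\<Sum>i<n. 2 * A)"
    by (intro sum_mono row) auto
  finally show ?thesis
    by (simp add: mult.commute)
qed

text \<open>Chebyshev's inequality with the variance bound above; the threshold is half the
  expected number.\<close>

lemma count_deviation:
  assumes A: "\<And>n. (\<Sum>k<n. alpha_mixing P \<sigma> \<beta> k) \<le> A" and p: "0 < prob (good 0)" and n: "0 < n"
  shows "prob {\<omega> \<in> space P. real (count t n \<omega>) < prob (good 0) / 2 * real n} \<le> 8 * A / (prob (good 0))\<^sup>2 / real n"
proof -
  let ?p = "prob (good 0)" and ?S = "\<lambda>\<omega>. \<Sum>k<n. indicator (good (t + int k)) \<omega> :: real"
  define E where "E = {\<omega> \<in> space P. real (count t n \<omega>) < ?p / 2 * real n}"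
  have E: "E \<in> sets P" "E \<inter> space P = E"
    unfolding E_def by (rule count_sets) auto
  have bd: "\<bar>?S \<omega> - ?p * real n\<bar> \<le> real n" for \<omega>
  proof -
    have "?S \<omega> \<le> (\<Sum>k<n. 1)"
      by (intro sum_mono) (simp add: indicator_def)
    then have "?S \<omega> \<le> real n" by simp
    moreover have "0 \<le> ?S \<omega>"
      by (intro sum_nonneg) (simp add: indicator_def)
    moreover have "0 \<le> ?p * real n" by simp
    moreover have "?p * real n \<le> 1 * real n"
      by (rule mult_right_mono[OF prob_le_1]) simp
    ultimately show ?thesis
      unfolding abs_le_iff by linarith
  qed
  have int: "integrable P (\<lambda>\<omega>. (?S \<omega> - ?p * real n)\<^sup>2)"
  proof (rule integrable_const_bound[where B = "(real n)\<^sup>2"])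
    show "AE \<omega> in P. norm ((?S \<omega> - ?p * real n)\<^sup>2) \<le> (real n)\<^sup>2"
      using power_mono[OF bd abs_ge_zero, where n = 2] by (intro AE_I2) simp
  qed measurable
  have "(?p / 2 * real n)\<^sup>2 * prob E = (\<integral>\<omega>. (?p / 2 * real n)\<^sup>2 * indicator E \<omega> \<partial>P)"
    by (simp add: E)
  also have "\<dots> \<le> (\<integral>\<omega>. (?S \<omega> - ?p * real n)\<^sup>2 \<partial>P)"
  proof (rule integral_mono[OF _ int])
    show "integrable P (\<lambda>\<omega>. (?p / 2 * real n)\<^sup>2 * indicator E \<omega>)"
      by (intro integrable_mult_right integrable_real_indicator) (auto simp: emeasure_eq_measure E)
    fix \<omega> assume \<omega>: "\<omega> \<in> space P"
    show "(?p / 2 * real n)\<^sup>2 * indicator E \<omega> \<le> (?S \<omega> - ?p * real n)\<^sup>2"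
    proof (cases "\<omega> \<in> E")
      case True
      then have "real (count t n \<omega>) < ?p / 2 * real n"
        unfolding E_def by blast
      then have "?p / 2 * real n \<le> ?p * real n - ?S \<omega>"
        unfolding count_eq_sum[OF \<omega>] by (simp add: field_simps)
      then have "(?p / 2 * real n)\<^sup>2 \<le> (?p * real n - ?S \<omega>)\<^sup>2"
        using p by (intro power_mono) auto
      then show ?thesis
        using True by (simp add: power2_commute)
    qed simp
  qed
  also have "\<dots> \<le> 2 * A * real n"
    by (rule variance_count[OF A])
  finally show ?thesis
    unfolding E_def[symmetric] using p n by (simp add: field_simps power2_eq_square)
qed

end

context mixing_environment
begin

lemma alpha_partial_sums:
  assumes q: "2 < q" and C: "0 \<le> C" and \<alpha>: "\<And>n. 0 < n \<Longrightarrow> alpha_mixing P \<sigma> \<beta> n \<le> C * real n powr (1 - q)"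
  shows "(\<Sum>k<n. alpha_mixing P \<sigma> \<beta> k) \<le> 1 + C * (1 + 1 / (q - 2))"
proof (cases n)
  case (Suc m)
  have "(\<Sum>k<n. alpha_mixing P \<sigma> \<beta> k) = alpha_mixing P \<sigma> \<beta> 0 + (\<Sum>k<m. alpha_mixing P \<sigma> \<beta> (Suc k))"
    unfolding Suc by (rule sum.lessThan_Suc_shift)
  also have "\<dots> \<le> 1 + (\<Sum>k<m. C * real (1 + k) powr (- (q - 1)))"
    using \<alpha> by (intro add_mono alpha_le_1 sum_mono) (force simp: minus_diff_eq)
  also have "(\<Sum>k<m. C * real (1 + k) powr (- (q - 1))) = C * (\<Sum>k<m. real (1 + k) powr (- (q - 1)))"
    by (rule sum_distrib_left[symmetric])
  also have "\<dots> \<le> C * ((1 + 1 / ((q - 1) - 1)) * real 1 powr (1 - (q - 1)))"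
    using q C by (intro mult_left_mono powr_tail_sum_le) auto
  finally show ?thesis by simp
qed (use C q in simp)

lemma count_subwindow_le: "count (t + int k) n \<omega> \<le> count t m \<omega>" if "k + n \<le> m"
proof -
  have "(\<lambda>j. j + k) ` {j. j < n \<and> orbit_env P \<sigma> \<beta> \<omega> (t + int k + int j) \<le> \<gamma>} \<subseteq>
      {j. j < m \<and> orbit_env P \<sigma> \<beta> \<omega> (t + int j) \<le> \<gamma>}"
    using that by (auto simp: add_ac)
  then have "card ((\<lambda>j. j + k) ` {j. j < n \<and> orbit_env P \<sigma> \<beta> \<omega> (t + int k + int j) \<le> \<gamma>}) \<le>
      card {j. j < m \<and> orbit_env P \<sigma> \<beta> \<omega> (t + int j) \<le> \<gamma>}"
    by (intro card_mono) auto
  then show ?thesis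
    unfolding good_count_def by (subst (asm) card_image) auto
qed

text \<open>The windows \<open>E i\<close> are separated by gaps of their own length
  \<open>d\<close>, so mixing makes them independent up to an error \<open>alpha_mixing P
  \<sigma> \<beta> d\<close> for each.\<close>

lemma prob_all_blocks_bad:
  fixes d m :: nat and t :: int and c e :: real
  defines "E \<equiv> \<lambda>i. {\<omega> \<in> space P. real (count (t + int (2 * i * d)) d \<omega>) < c}"
  assumes e: "\<And>i. prob (E i) \<le> e"
  shows "prob {\<omega> \<in> space P. \<forall>i<m. \<omega> \<in> E i} \<le> e ^ m + real m * alpha_mixing P \<sigma> \<beta> d
    \<and> {\<omega> \<in> space P. \<forall>i<m. \<omega> \<in> E i} \<in> events_from P \<sigma> \<beta> {..t + int (2 * m * d) - int d}"
proof (induction m)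
  case 0
  have "space P \<in> events_from P \<sigma> \<beta> J" for J
    unfolding sets_param_algebra[symmetric] using sets.top[of "param_algebra J"] by simp
  then show ?case
    by (simp add: prob_space)
next
  case (Suc m)
  let ?F = "\<lambda>m. {\<omega> \<in> space P. \<forall>i<m. \<omega> \<in> E i}"
  have F: "?F (Suc m) = ?F m \<inter> E m"
    by (auto simp: less_Suc_eq E_def)
  have Em: "E m \<in> events_from P \<sigma> \<beta> {t + int (2 * m * d)..<t + int (2 * m * d) + int d}"
    unfolding E_def by (rule count_measurable_events) auto
  have Em1: "E m \<in> events_from P \<sigma> \<beta> {t + int (2 * m * d)..}"
    by (rule subsetD[OF events_from_mono Em]) auto
  have Em2: "E m \<in> events_from P \<sigma> \<beta> {..t + int (2 * Suc m * d) - int d}"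
    by (rule subsetD[OF events_from_mono Em]) (auto simp: algebra_simps)
  have Fm: "?F m \<in> events_from P \<sigma> \<beta> {..t + int (2 * m * d) - int d}"
    using Suc by blast
  then have Fm2: "?F m \<in> events_from P \<sigma> \<beta> {..t + int (2 * Suc m * d) - int d}"
    using events_from_mono[of "{..t + int (2 * m * d) - int d}" "{..t + int (2 * Suc m * d) - int d}"] by auto
  have "?F m \<inter> E m \<in> events_from P \<sigma> \<beta> {..t + int (2 * Suc m * d) - int d}"
    using Fm2 Em2 unfolding sets_param_algebra[symmetric] by (rule sets.Int)
  moreover have "prob (?F m \<inter> E m) \<le> e ^ Suc m + real (Suc m) * alpha_mixing P \<sigma> \<beta> d"
  proof -
    have "prob (?F m \<inter> E m) \<le> prob (?F m) * prob (E m) + alpha_mixing P \<sigma> \<beta> d"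
      using alpha_bound[OF Fm Em1, of d] by (simp add: abs_le_iff)
    also have "prob (?F m) * prob (E m) \<le> (e ^ m + real m * alpha_mixing P \<sigma> \<beta> d) * prob (E m)"
      using Suc by (intro mult_right_mono) auto
    also have "\<dots> = e ^ m * prob (E m) + real m * alpha_mixing P \<sigma> \<beta> d * prob (E m)"
      by (rule distrib_right)
    also have "\<dots> \<le> e ^ m * e + real m * alpha_mixing P \<sigma> \<beta> d * 1"
    proof (intro add_mono mult_left_mono e prob_le_1)
      have "0 \<le> e"
        using e[of 0] measure_nonneg[of P "E 0"] by linarith
      then show "0 \<le> e ^ m" by simp
    qed (simp add: alpha_nonneg)
    finally show ?thesis
      by (simp add: algebra_simps)
  qed
  ultimately show ?case
    unfolding F by simp
qed

text \<open>Cut the window into \<open>2 J\<close> blocks of equal length. If the whole window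
  has a small enough proportion of good parameters, then every block contains less than half of
  the expected number. Only every second block is considered. Chebyshev's inequality alone gives
  only the decay \<open>1 / n\<close> for one block; with \<open>J \<ge> q - 1\<close> nearly
  independent blocks its contribution is no larger than the mixing error. Since only a positive
  proportion is needed, losing a factor \<open>8 J\<close> in \<open>\<theta>\<close> is
  harmless.\<close>

lemma few_good_maps_unlikely:
  assumes p: "0 < prob (good 0)" and q: "2 < q" and C: "0 \<le> C"
    and \<alpha>: "\<And>n. 0 < n \<Longrightarrow> alpha_mixing P \<sigma> \<beta> n \<le> C * real n powr (1 - q)"
  shows "\<exists>\<theta>>0. \<exists>D\<ge>0. \<forall>t n. 0 < n \<longrightarrow>
    prob {\<omega> \<in> space P. real (count t n \<omega>) < \<theta> * real n} \<le> D * real n powr (1 - q)"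
proof -
  define A where "A = 8 * (1 + C * (1 + 1 / (q - 2))) / (prob (good 0))\<^sup>2"
  have A: "0 \<le> A"
    unfolding A_def using C q by (intro divide_nonneg_nonneg mult_nonneg_nonneg add_nonneg_nonneg) auto
  \<comment> \<open>As many blocks as needed to bring \<open>(1/d)\<^sup>J\<close> below
    \<open>d\<close> to the power \<open>1 - q\<close>.\<close>
  define J where "J = Suc (nat \<lceil>q\<rceil>)"
  have J: "0 < J" "q - 1 \<le> real J"
    unfolding J_def by linarith+
  define \<theta> where "\<theta> = prob (good 0) / (8 * real J)"
  define D where "D = (A ^ J + real J * C) * real (4 * J) powr (q - 1) + real (2 * J) powr (q - 1)"
  have dev: "prob {\<omega> \<in> space P. real (count t d \<omega>) < prob (good 0) / 2 * real d} \<le> A / real d" if "0 < d" for t d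
    using count_deviation[OF alpha_partial_sums[OF q C \<alpha>] p that, of t] by (simp add: A_def)
  have "prob {\<omega> \<in> space P. real (count t n \<omega>) < \<theta> * real n} \<le> D * real n powr (1 - q)" if n: "0 < n" for t n
  proof (cases "n < 2 * J")
    case True
    have "real n powr (q - 1) \<le> real (2 * J) powr (q - 1)"
      using True q by (intro powr_mono2) auto
    also have "\<dots> \<le> D"
      unfolding D_def using A C by simp
    finally have "real n powr (q - 1) * real n powr (1 - q) \<le> D * real n powr (1 - q)"
      by (rule mult_right_mono) simp
    then have "1 \<le> D * real n powr (1 - q)"
      using n by (simp add: powr_add[symmetric])
    then show ?thesis
      by (rule order_trans[OF prob_le_1])
  next
    case False
    define d where "d = n div (2 * J)"
    have d: "0 < d" "2 * J * d \<le> n" "n < 2 * J * d + 2 * J"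
      unfolding d_def using False J by (auto simp: div_greater_zero_iff)
        (metis add.commute dividend_less_times_div mult_2 mult_pos_pos zero_less_numeral)
    have "2 * J * 1 \<le> 2 * J * d"
      using d(1) by (intro mult_left_mono) auto
    then have n4: "n \<le> 4 * J * d"
      using d(3) by linarith
    let ?c = "prob (good 0) / 2 * real d"
    let ?E = "\<lambda>i. {\<omega> \<in> space P. real (count (t + int (2 * i * d)) d \<omega>) < ?c}"
    have "real n \<le> real (4 * J * d)"
      using n4 by (simp only: of_nat_le_iff)
    then have "\<theta> * real n \<le> \<theta> * real (4 * J * d)"
      using p unfolding \<theta>_def by (intro mult_left_mono) auto
    also have "\<dots> = ?c"
      using J by (simp add: \<theta>_def)
    finally have \<theta>c: "\<theta> * real n \<le> ?c" .
    have "prob {\<omega> \<in> space P. real (count t n \<omega>) < \<theta> * real n} \<le> prob {\<omega> \<in> space P. \<forall>i<J. \<omega> \<in> ?E i}"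
    proof (rule finite_measure_mono)
      show "{\<omega> \<in> space P. \<forall>i<J. \<omega> \<in> ?E i} \<in> sets P"
        by measurable
      show "{\<omega> \<in> space P. real (count t n \<omega>) < \<theta> * real n} \<subseteq> {\<omega> \<in> space P. \<forall>i<J. \<omega> \<in> ?E i}"
      proof (intro subsetI CollectI conjI allI impI)
        fix \<omega> i assume \<omega>: "\<omega> \<in> {\<omega> \<in> space P. real (count t n \<omega>) < \<theta> * real n}" and i: "i < J"
        have "2 * i * d + d \<le> 2 * J * d"
          using i mult_le_mono1[of "2 * i + 1" "2 * J" d] by (simp add: algebra_simps)
        then have "count (t + int (2 * i * d)) d \<omega> \<le> count t n \<omega>"
          using d(2) by (intro count_subwindow_le) linarith
        then show "real (count (t + int (2 * i * d)) d \<omega>) < ?c"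
          using \<omega> \<theta>c by auto
      qed auto
    qed
    also have "\<dots> \<le> (A / real d) ^ J + real J * alpha_mixing P \<sigma> \<beta> d"
      using prob_all_blocks_bad[where e = "A / real d" and m = J and d = d and c = ?c and t = t] dev[OF d(1)] by blast
    also have "\<dots> \<le> A ^ J * real d powr (1 - q) + real J * (C * real d powr (1 - q))"
    proof (intro add_mono mult_left_mono \<alpha> d)
      have "(A / real d) ^ J = A ^ J / real d ^ J"
        by (rule power_divide)
      also have "\<dots> = A ^ J * real d powr (- real J)"
        using d(1) by (simp add: powr_minus powr_realpow divide_inverse)
      also have "\<dots> \<le> A ^ J * real d powr (1 - q)"
        using A J d(1) by (intro mult_left_mono powr_mono) auto
      finally show "(A / real d) ^ J \<le> A ^ J * real d powr (1 - q)" .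
    qed simp
    also have "\<dots> = (A ^ J + real J * C) * real d powr (1 - q)"
      by (simp add: algebra_simps)
    also have "\<dots> \<le> (A ^ J + real J * C) * (real (4 * J) powr (q - 1) * real n powr (1 - q))"
    proof (intro mult_left_mono)
      have "real (4 * J) powr (1 - q) * real d powr (1 - q) \<le> real n powr (1 - q)"
        using n n4 q by (subst powr_mult[symmetric]) (auto intro!: powr_mono2' simp flip: of_nat_mult)
      then have "real (4 * J) powr (q - 1) * (real (4 * J) powr (1 - q) * real d powr (1 - q)) \<le>
          real (4 * J) powr (q - 1) * real n powr (1 - q)"
        by (rule mult_left_mono) simp
      moreover have "real (4 * J) powr (q - 1) * real (4 * J) powr (1 - q) = 1"
        using J by (simp add: powr_add[symmetric])
      ultimately show "real d powr (1 - q) \<le> real (4 * J) powr (q - 1) * real n powr (1 - q)"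
        by (simp only: mult.assoc[symmetric] mult_1)
    qed (use A C in auto)
    also have "\<dots> \<le> D * real n powr (1 - q)"
      unfolding D_def by (simp add: distrib_right mult.assoc)
    finally show ?thesis .
  qed
  moreover have "0 < \<theta>" "0 \<le> D"
    using p J A C by (auto simp: \<theta>_def D_def)
  ultimately show ?thesis by blast
qed

section \<open>The random constant\<close>

definition bad :: "real \<Rightarrow> nat \<Rightarrow> nat \<Rightarrow> 'w set" where
  "bad \<theta> R K = {\<omega> \<in> space P. \<not> good_blocks (orbit_env P \<sigma> \<beta> \<omega>) \<gamma> \<theta> (K ^ R) (4 * K)}"

lemma bad_eq: "bad \<theta> R K = (\<Union>k\<in>{..<4 * K}. \<Union>t.
    {\<omega> \<in> space P. real (count (int (k * K ^ R) - int t) (K ^ R + t) \<omega>) < \<theta> * real (K ^ R + t)})"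
  by (auto simp: bad_def good_blocks_def not_le)

lemma bad_sets [measurable]: "bad \<theta> R K \<in> sets P"
  unfolding bad_eq by (intro sets.finite_UN sets.countable_UN) auto

text \<open>Sum the previous bound over the \<open>4 K\<close> block ends and over the lengths
  \<open>K ^ R + t\<close>; summing over the lengths raises the exponent from \<open>1 -
  q\<close> to \<open>2 - q\<close>.\<close>

lemma prob_bad:
  assumes q: "2 < q" and D: "0 \<le> D" "\<And>t n. 0 < n \<Longrightarrow>
    prob {\<omega> \<in> space P. real (count t n \<omega>) < \<theta> * real n} \<le> D * real n powr (1 - q)" and K: "0 < K"
  shows "prob (bad \<theta> R K) \<le> 4 * D * (1 + 1 / (q - 2)) * real K powr (1 - real R * (q - 2))"
proof -
  let ?l = "K ^ R"
  let ?E = "\<lambda>k t. {\<omega> \<in> space P. real (count (int (k * ?l) - int t) (?l + t) \<omega>) < \<theta> * real (?l + t)}"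
  let ?S = "D * ((1 + 1 / (q - 2)) * real ?l powr (2 - q))"
  have l: "0 < ?l"
    using K by simp
  have E: "prob (?E k t) \<le> D * real (?l + t) powr (- (q - 1))" for k t
    unfolding minus_diff_eq by (rule D(2)) (use l in simp)
  have partial: "(\<Sum>t<n. prob (?E k t)) \<le> ?S" for k n
  proof -
    have "(\<Sum>t<n. prob (?E k t)) \<le> D * (\<Sum>t<n. real (?l + t) powr (- (q - 1)))"
      unfolding sum_distrib_left by (intro sum_mono E)
    also have "\<dots> \<le> D * ((1 + 1 / ((q - 1) - 1)) * real ?l powr (1 - (q - 1)))"
      using q l D by (intro mult_left_mono powr_tail_sum_le) auto
    finally show ?thesis by simp
  qed
  have summable: "summable (\<lambda>t. prob (?E k t))" for k
    by (rule bounded_imp_summable[OF measure_nonneg, of _ _ ?S])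
      (use partial[of _ "Suc _"] in \<open>simp only: lessThan_Suc_atMost\<close>)
  have row: "prob (\<Union>t. ?E k t) \<le> ?S" for k
  proof -
    have "prob (\<Union>t. ?E k t) \<le> (\<Sum>t. prob (?E k t))"
      by (rule finite_measure_subadditive_countably[OF _ summable]) auto
    also have "\<dots> \<le> ?S"
      by (rule suminf_le_const[OF summable partial])
    finally show ?thesis .
  qed
  have "prob (bad \<theta> R K) \<le> (\<Sum>k<4 * K. prob (\<Union>t. ?E k t))"
    unfolding bad_eq by (rule finite_measure_subadditive_finite) auto
  also have "\<dots> \<le> (\<Sum>k<4 * K. ?S)"
    by (intro sum_mono row)
  also have "\<dots> = 4 * D * (1 + 1 / (q - 2)) * (real K * real ?l powr (2 - q))"
    by simp
  also have "real K * real ?l powr (2 - q) = real K powr (1 - real R * (q - 2))"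
  proof -
    have "real ?l = real K powr real R"
      using K by (simp add: powr_realpow)
    then have "real ?l powr (2 - q) = real K powr (real R * (2 - q))"
      by (simp only: powr_powr)
    then have "real K * real ?l powr (2 - q) = real K powr 1 * real K powr (real R * (2 - q))"
      using K by simp
    also have "\<dots> = real K powr (1 - real R * (q - 2))"
      unfolding powr_add[symmetric] by (simp add: algebra_simps)
    finally show ?thesis .
  qed
  finally show ?thesis .
qed

text \<open>Take for \<open>B\<^sup>p\<close> the sum over the bad scales \<open>K\<close> of
  the weights \<open>K ^ Suc R\<close> to the power \<open>a p / s\<close>, plus
  \<open>1\<close>. Then \<open>B\<^sup>s\<close> dominates the required value on each bad
  scale. The expectation of the term for \<open>K\<close> is of order \<open>K\<close> to the
  power \<open>1 - R (q - 2) + (R + 1) a p / s\<close>, which is summable for large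
  \<open>R\<close> because of the strict inequality between \<open>q - 2\<close> and \<open>a p
  / s\<close>.\<close>

lemma random_constant:
  assumes p0: "0 < prob (good 0)" and q2: "2 < q" and C: "0 \<le> C"
    and \<alpha>: "\<And>n. 0 < n \<Longrightarrow> alpha_mixing P \<sigma> \<beta> n \<le> C * real n powr (1 - q)"
    and a: "0 < a" and ps: "1 \<le> p" "1 \<le> s" and q: "p / s * a + 2 < q"
  obtains \<theta> R B where "0 < \<theta>" "1 \<le> R" "in_Lp P p B"
    "AE \<omega> in P. 1 \<le> B \<omega> \<and> (\<forall>K>0. \<not> good_blocks (orbit_env P \<sigma> \<beta> \<omega>) \<gamma> \<theta> (K ^ R) (4 * K) \<longrightarrow>
       real (K ^ Suc R) powr a \<le> B \<omega> powr s)"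
proof -
  obtain \<theta> D where \<theta>: "0 < \<theta>" and D: "0 \<le> D" "\<And>t n. 0 < n \<Longrightarrow>
    prob {\<omega> \<in> space P. real (count t n \<omega>) < \<theta> * real n} \<le> D * real n powr (1 - q)"
    using few_good_maps_unlikely[OF p0 q2 C \<alpha>] by auto
  define c where "c = p / s * a"
  have c: "0 < c" "0 < q - 2 - c"
    using ps a q by (auto simp: c_def)
  \<comment> \<open>Chosen such that the series of the expectations is dominated by
    \<open>\<Sum>K. 1 / K\<^sup>2\<close>.\<close>
  define R where "R = Suc (nat \<lceil>(3 + c) / (q - 2 - c)\<rceil>)"
  have R: "1 \<le> R" "(3 + c) / (q - 2 - c) \<le> real R"
    unfolding R_def by linarith+
  define W where "W K = real (K ^ Suc R) powr c" for K
  define X where "X K \<omega> = W K * indicator (bad \<theta> R K) \<omega>" for K and \<omega> :: 'w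
  define M where "M = 4 * D * (1 + 1 / (q - 2))"
  have M: "0 \<le> M"
    unfolding M_def using D q2 by simp
  have W1: "1 \<le> W K" if "0 < K" for K
    unfolding W_def using one_le_power[of "real K" "Suc R"] that c by (intro ge_one_powr_ge_zero) auto
  have W0: "0 \<le> W K" for K
    by (simp add: W_def)
  have WP: "W K * prob (bad \<theta> R K) \<le> M * real K powr (- 2)" for K
  proof (cases "K = 0")
    case False
    then have K: "0 < K" by simp
    have "W K = real K powr (real (Suc R) * c)"
    proof -
      have "real (K ^ Suc R) = real K powr real (Suc R)"
        using K by (subst powr_realpow) auto
      then show ?thesis
        unfolding W_def by (simp only: powr_powr)
    qed
    then have "W K * prob (bad \<theta> R K) \<le> real K powr (real (Suc R) * c) * (M * real K powr (1 - real R * (q - 2)))"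
      unfolding M_def by (simp only:) (intro mult_left_mono prob_bad[OF q2 D K], auto)
    also have "\<dots> = M * real K powr (real (Suc R) * c + (1 - real R * (q - 2)))"
      by (simp add: powr_add)
    also have "\<dots> \<le> M * real K powr (- 2)"
    proof (intro mult_left_mono powr_mono M)
      have "3 + c \<le> real R * (q - 2 - c)"
        using R(2) c by (simp add: pos_divide_le_eq)
      then show "real (Suc R) * c + (1 - real R * (q - 2)) \<le> - 2"
        by (simp add: algebra_simps)
    qed (use K in auto)
    finally show ?thesis .
  qed (simp add: W_def M)
  have "summable (\<lambda>K. real K powr (- 2))"
    by (subst summable_real_powr_iff) simp
  then have summable_WP: "summable (\<lambda>K. W K * prob (bad \<theta> R K))"
  proof (rule summable_comparison_test'[where N = 0, OF summable_mult[where c = M]])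
    show "norm (W K * prob (bad \<theta> R K)) \<le> M * real K powr (- 2)" for K
      unfolding real_norm_def abs_of_nonneg[OF mult_nonneg_nonneg[OF W0 measure_nonneg]] by (rule WP)
  qed
  \<comment> \<open>By Borel-Cantelli almost every point has finitely many bad scales, so the
    random series is a finite sum there.\<close>
  have "summable (\<lambda>K. prob (bad \<theta> R K))"
  proof (rule summable_comparison_test'[OF summable_WP])
    fix K :: nat assume "1 \<le> K"
    then show "norm (prob (bad \<theta> R K)) \<le> W K * prob (bad \<theta> R K)"
      using mult_right_mono[OF W1 measure_nonneg, of K P "bad \<theta> R K"] by simp
  qed
  then have "AE \<omega> in P. eventually (\<lambda>K. \<omega> \<in> space P - bad \<theta> R K) sequentially"
    by (intro borel_cantelli_AE1) (auto simp: emeasure_eq_measure)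
  then have AE_summable: "AE \<omega> in P. summable (\<lambda>K. X K \<omega>)"
  proof (rule AE_mp, intro AE_I2 impI)
    fix \<omega> assume "eventually (\<lambda>K. \<omega> \<in> space P - bad \<theta> R K) sequentially"
    then have "eventually (\<lambda>K. X K \<omega> = 0) sequentially"
      by eventually_elim (simp add: X_def)
    then show "summable (\<lambda>K. X K \<omega>)"
      using summable_cong[of "\<lambda>K. X K \<omega>" "\<lambda>_. 0"] by simp
  qed
  have X_meas: "X K \<in> borel_measurable P" for K
    unfolding X_def by measurable
  have X_int: "integrable P (X K)" for K
    unfolding X_def by (intro integrable_mult_right integrable_real_indicator) (auto simp: emeasure_eq_measure)
  have X0: "0 \<le> X K \<omega>" for K \<omega>
    unfolding X_def using W0 by simp
  have "(\<integral>\<omega>. norm (X K \<omega>) \<partial>P) = W K * prob (bad \<theta> R K)" for K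
    using W0 unfolding X_def by (simp add: sets.Int_space_eq2)
  then have sum_int: "integrable P (\<lambda>\<omega>. \<Sum>K. X K \<omega>)"
    using AE_summable X0 by (intro integrable_suminf X_int) (simp_all add: summable_WP)
  define B where "B \<omega> = (1 + (\<Sum>K. X K \<omega>)) powr (1 / p)" for \<omega>
  have AE_B: "AE \<omega> in P. 1 \<le> B \<omega> \<and> \<bar>B \<omega>\<bar> powr p = 1 + (\<Sum>K. X K \<omega>) \<and>
      (\<forall>K>0. \<not> good_blocks (orbit_env P \<sigma> \<beta> \<omega>) \<gamma> \<theta> (K ^ R) (4 * K) \<longrightarrow> real (K ^ Suc R) powr a \<le> B \<omega> powr s)"
    using AE_summable
  proof (rule AE_mp, intro AE_I2 impI conjI allI)
    fix \<omega> assume \<omega>: "\<omega> \<in> space P" and sm: "summable (\<lambda>K. X K \<omega>)"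
    have nn: "0 \<le> (\<Sum>K. X K \<omega>)"
      by (rule suminf_nonneg[OF sm X0])
    show "1 \<le> B \<omega>"
      unfolding B_def using nn ps by (intro ge_one_powr_ge_zero) auto
    show "\<bar>B \<omega>\<bar> powr p = 1 + (\<Sum>K. X K \<omega>)"
      unfolding B_def using nn ps by (simp add: powr_powr)
    fix K :: nat assume K: "0 < K" and ng: "\<not> good_blocks (orbit_env P \<sigma> \<beta> \<omega>) \<gamma> \<theta> (K ^ R) (4 * K)"
    have "W K = X K \<omega>"
      using \<omega> ng by (simp add: X_def bad_def)
    also have "\<dots> \<le> (\<Sum>K. X K \<omega>)"
      using sum_le_suminf[OF sm, of "{K}"] X0 by simp
    finally have "W K powr (s / p) \<le> (1 + (\<Sum>K. X K \<omega>)) powr (s / p)"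
      using ps W0 by (intro powr_mono2) auto
    also have "\<dots> = B \<omega> powr s"
      unfolding B_def by (simp add: powr_powr)
    also have "W K powr (s / p) = real (K ^ Suc R) powr a"
      unfolding W_def powr_powr using ps by (simp add: c_def)
    finally show "real (K ^ Suc R) powr a \<le> B \<omega> powr s" .
  qed
  have "in_Lp P p B"
    unfolding in_Lp_def
  proof
    have "(\<lambda>\<omega>. \<Sum>K. X K \<omega>) \<in> borel_measurable P"
      by (rule borel_measurable_integrable[OF sum_int])
    then show B_meas: "B \<in> borel_measurable P"
      unfolding B_def by measurable
    show "integrable P (\<lambda>\<omega>. \<bar>B \<omega>\<bar> powr p)"
    proof (rule integrable_cong_AE_imp)
      show "integrable P (\<lambda>\<omega>. 1 + (\<Sum>K. X K \<omega>))"
        using sum_int by simp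
      show "(\<lambda>\<omega>. \<bar>B \<omega>\<bar> powr p) \<in> borel_measurable P"
        using B_meas by measurable
      show "AE \<omega> in P. 1 + (\<Sum>K. X K \<omega>) = \<bar>B \<omega>\<bar> powr p"
        using AE_B by (rule AE_mp) (auto intro!: AE_I2)
    qed
  qed
  moreover have "AE \<omega> in P. 1 \<le> B \<omega> \<and> (\<forall>K>0. \<not> good_blocks (orbit_env P \<sigma> \<beta> \<omega>) \<gamma> \<theta> (K ^ R) (4 * K) \<longrightarrow>
       real (K ^ Suc R) powr a \<le> B \<omega> powr s)"
    using AE_B by (rule AE_mp) (auto intro!: AE_I2)
  ultimately show thesis
    using that[OF \<theta> R(1)] by blast
qed

end

text \<open>The logarithmic factor is at most \<open>1\<close> from \<open>n = 3\<close> on; the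
  finitely many terms to which the asymptotic bound does not apply are at most
  \<open>1\<close>.\<close>

lemma alpha_mixing_polynomial:
  fixes \<alpha> :: "nat \<Rightarrow> real"
  assumes "\<alpha> \<in> O(\<lambda>n. real n powr (- q + 1) * ln (real n) powr (- \<iota>))" and \<iota>: "0 \<le> \<iota>" and q: "1 \<le> q"
    and \<alpha>: "\<And>n. \<alpha> n \<le> 1"
  shows "\<exists>C\<ge>0. \<forall>n>0. \<alpha> n \<le> C * real n powr (1 - q)"
proof -
  obtain c where c: "0 < c" "eventually (\<lambda>n. norm (\<alpha> n) \<le> c * norm (real n powr (- q + 1) * ln (real n) powr (- \<iota>))) sequentially"
    using landau_o.bigE[OF assms(1)] by blast
  then obtain N where N: "\<And>n. N \<le> n \<Longrightarrow> norm (\<alpha> n) \<le> c * norm (real n powr (- q + 1) * ln (real n) powr (- \<iota>))"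
    by (auto simp: eventually_sequentially)
  define m where "m = max N 3"
  have "\<alpha> n \<le> (c + real m powr (q - 1)) * real n powr (1 - q)" if n: "0 < n" for n
  proof (cases "m \<le> n")
    case True
    have "exp 1 \<le> (3 :: real)"
      by (rule exp_le)
    then have "1 \<le> ln (real n)"
      using True by (subst ln_ge_iff) (auto simp: m_def)
    then have "ln (real n) powr (- \<iota>) \<le> 1"
      using \<iota> powr_mono[of "- \<iota>" 0 "ln (real n)"] by simp
    then have "real n powr (- q + 1) * ln (real n) powr (- \<iota>) \<le> real n powr (- q + 1) * 1"
      by (intro mult_left_mono) auto
    then have "c * (real n powr (- q + 1) * ln (real n) powr (- \<iota>)) \<le> c * real n powr (1 - q)"
      using c by (intro mult_left_mono) (auto simp: add.commute)
    moreover have "\<alpha> n \<le> c * (real n powr (- q + 1) * ln (real n) powr (- \<iota>))"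
      using N[of n] True by (auto simp: m_def)
    moreover have "0 \<le> real m powr (q - 1) * real n powr (1 - q)"
      by simp
    ultimately show ?thesis
      unfolding distrib_right by linarith
  next
    case False
    have "\<alpha> n \<le> real n powr (q - 1) * real n powr (1 - q)"
      using \<alpha>[of n] n by (simp add: powr_add[symmetric])
    also have "\<dots> \<le> (c + real m powr (q - 1)) * real n powr (1 - q)"
    proof (intro mult_right_mono)
      have "real n powr (q - 1) \<le> real m powr (q - 1)"
        using False q by (intro powr_mono2) auto
      then show "real n powr (q - 1) \<le> c + real m powr (q - 1)"
        using c by linarith
    qed simp
    finally show ?thesis .
  qed
  then show ?thesis
    using c by (intro exI[of _ "c + real m powr (q - 1)"]) auto
qed

section \<open>The invariant densities\<close>

lemma transfer_eq:
  assumes b: "0 < b" and x: "x \<in> {0..1}"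
  shows "transfer b \<phi> x = indicator {..<1} x * left_transfer b \<phi> x + right_transfer \<phi> x"
proof -
  let ?l = "left_inv b x" and ?r = "(1 + x) / 2"
  have lsvl: "lsv b y = left_branch b y" if "y < 1/2" for y
    using that by (simp add: lsv_def left_branch_def)
  have right: "y \<in> {0..1} \<and> lsv b y = x \<longleftrightarrow> y = ?r" if "1/2 \<le> y" for y
    using that x by (auto simp: lsv_def)
  have left: "y \<in> {0..1} \<and> lsv b y = x \<longleftrightarrow> x < 1 \<and> y = ?l" if "y < 1/2" for y
  proof
    assume y: "y \<in> {0..1} \<and> lsv b y = x"
    then have "left_branch b y = x" using lsvl[OF that] by simp
    then show "x < 1 \<and> y = ?l"
      using y that left_branch_strict_mono[OF b, of y "1/2"] left_inv_left_branch[OF b, of y] by auto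
  next
    assume "x < 1 \<and> y = ?l"
    then show "y \<in> {0..1} \<and> lsv b y = x"
      using x that lsvl[OF that] left_inv[OF b, of x] by auto
  qed
  have rd: "lsv_deriv b ?r = 2" "\<not> ?r < 1/2"
    using x by (auto simp: lsv_deriv_def)
  have mem: "y \<in> {y \<in> {0..1}. lsv b y = x} \<longleftrightarrow> (x < 1 \<and> y = ?l \<and> y < 1/2) \<or> y = ?r" for y
  proof (cases "y < 1/2")
    case True
    then have "y \<noteq> ?r"
      using rd(2) by blast
    with left[OF True] True show ?thesis
      by blast
  next
    case False
    with right[of y] show ?thesis
      by (auto simp: not_less)
  qed
  show ?thesis
  proof (cases "x < 1")
    case True
    have "?l \<noteq> 1/2"
      using left_branch_left_inv[OF b, of x] left_branch_half[of b] x True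
      by (metis atLeastAtMost_iff less_irrefl less_imp_le)
    then have l: "?l < 1/2"
      using left_inv_le_half[OF b, of x] x by simp
    have "{y \<in> {0..1}. lsv b y = x} = {?l, ?r}"
      using l True unfolding set_eq_iff mem by blast
    moreover have "?l \<noteq> ?r"
      using l rd(2) by auto
    ultimately show ?thesis
      using True l rd by (simp add: transfer_def left_transfer_def right_transfer_def lsv_deriv_def left_deriv_def)
  next
    case False
    have "{y \<in> {0..1}. lsv b y = x} = {?r}"
      using False unfolding set_eq_iff mem by blast
    then show ?thesis
      using False rd by (simp add: transfer_def right_transfer_def)
  qed
qed

lemma transfer_measurable:
  assumes b: "0 < b" and \<phi>: "\<phi> \<in> borel_measurable leb01"
  shows "transfer b \<phi> \<in> borel_measurable leb01"
proof -
  have ind: "(indicator {..<1} :: real \<Rightarrow> real) \<in> borel_measurable leb01"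
    unfolding leb01_def by (rule measurable_restrict_space1) auto
  have "(\<lambda>x. indicator {..<1} x * left_transfer b \<phi> x + right_transfer \<phi> x) \<in> borel_measurable leb01"
    by (intro borel_measurable_add borel_measurable_times ind left_transfer_measurable right_transfer_measurable b \<phi>)
  then show ?thesis
    by (subst measurable_cong[OF transfer_eq[OF b]]) auto
qed

lemma transfer_AE_eq_full: 
  assumes b: "0 < b"
  shows "AE x in leb01. transfer b \<phi> x = full_transfer b \<phi> x"
  using AE_leb01_neq[of 1] AE_space
  by eventually_elim (simp add: transfer_eq[OF b] full_transfer_def)

lemma full_transfer_cong_AE:
  assumes b: "0 < b" and u: "integrable leb01 u" and v: "integrable leb01 v" and uv: "AE x in leb01. u x = v x"
  shows "AE x in leb01. full_transfer b u x = full_transfer b v x"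
proof -
  have d: "integrable leb01 (\<lambda>x. \<bar>u x - v x\<bar>)"
    using u v by simp
  have "L1 (\<lambda>x. full_transfer b u x - full_transfer b v x) \<le> (\<integral>x. full_transfer b (\<lambda>x. \<bar>u x - v x\<bar>) x \<partial>leb01)"
  proof (rule integral_mono)
    show "\<bar>full_transfer b u x - full_transfer b v x\<bar> \<le> full_transfer b (\<lambda>x. \<bar>u x - v x\<bar>) x" if "x \<in> space leb01" for x
      using full_transfer_abs_le[OF b, of x "\<lambda>x. u x - v x"] that by (simp add: full_transfer_diff)
  qed (use integrable_full_transfer[OF b] u v d in auto)
  also have "\<dots> = L1 (\<lambda>x. u x - v x)"
    by (rule integral_full_transfer[OF b d])
  also have "\<dots> = 0"
    using d uv by (subst integral_nonneg_eq_0_iff_AE) auto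
  finally have "L1 (\<lambda>x. full_transfer b u x - full_transfer b v x) \<le> 0" .
  then have "L1 (\<lambda>x. full_transfer b u x - full_transfer b v x) = 0"
    by (rule order.antisym) (simp add: integral_nonneg_AE)
  then have "AE x in leb01. \<bar>full_transfer b u x - full_transfer b v x\<bar> = 0"
    using integrable_full_transfer[OF b] u v by (subst (asm) integral_nonneg_eq_0_iff_AE) auto
  then show ?thesis
    by eventually_elim simp
qed

text \<open>Limits in \<open>L\<^sup>1\<close> are unique almost everywhere.\<close>

lemma AE_eq_of_L1_limit:
  fixes u v :: "real \<Rightarrow> real"
  assumes u: "integrable leb01 u" and v: "integrable leb01 v" and w: "\<And>N. integrable leb01 (w N)"
    and "(\<lambda>N. \<integral>x. \<bar>w N x - u x\<bar> \<partial>leb01) \<longlonglongrightarrow> 0" "(\<lambda>N. \<integral>x. \<bar>w N x - v x\<bar> \<partial>leb01) \<longlonglongrightarrow> 0"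
  shows "AE x in leb01. u x = v x"
proof -
  have "L1 (\<lambda>x. u x - v x) \<le> L1 (\<lambda>x. w N x - u x) + L1 (\<lambda>x. w N x - v x)" for N
  proof -
    have "L1 (\<lambda>x. u x - v x) \<le> (\<integral>x. \<bar>w N x - u x\<bar> + \<bar>w N x - v x\<bar> \<partial>leb01)"
      using u v w by (intro integral_mono) auto
    then show ?thesis
      using u v w by simp
  qed
  moreover have "(\<lambda>N. L1 (\<lambda>x. w N x - u x) + L1 (\<lambda>x. w N x - v x)) \<longlonglongrightarrow> 0 + 0"
    by (intro tendsto_add assms)
  ultimately have "L1 (\<lambda>x. u x - v x) \<le> 0"
    by (intro LIMSEQ_le_const[where X = "\<lambda>N. L1 (\<lambda>x. w N x - u x) + L1 (\<lambda>x. w N x - v x)"]) auto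
  then have "L1 (\<lambda>x. u x - v x) = 0"
    by (rule order.antisym) (simp add: integral_nonneg_AE)
  then have "AE x in leb01. \<bar>u x - v x\<bar> = 0"
    using u v by (subst (asm) integral_nonneg_eq_0_iff_AE) auto
  then show ?thesis
    by eventually_elim simp
qed

text \<open>\<open>H t\<close> stands for the invariant density at the point
  \<open>\<sigma>\<^sup>t \<omega>\<close> of the orbit. It enters as the limit in
  \<open>L\<^sup>1\<close> of the images of \<open>1\<close> started further and further in the
  past.\<close>

locale limit_density = lsv_environment +
  fixes H :: "int \<Rightarrow> real \<Rightarrow> real"
  assumes H_integrable: "\<And>t. integrable leb01 (H t)"
    and H_nonneg: "\<And>t x. x \<in> {0..1} \<Longrightarrow> 0 \<le> H t x"
    and H_mass: "\<And>t. mass (H t) = 1"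
    and H_limit: "\<And>t. (\<lambda>N. \<integral>x. \<bar>evolve b (t - int N) N (\<lambda>_. 1) x - H t x\<bar> \<partial>leb01) \<longlonglongrightarrow> 0"
begin

lemma H_measurable: "H t \<in> borel_measurable leb01"
  by (rule borel_measurable_integrable[OF H_integrable])

lemma integrable_evolve_1: "integrable leb01 (evolve b t n (\<lambda>_. 1))"
  by (intro integrable_evolve) simp

text \<open>The approximating functions are bounded below by \<open>floor_const\<close>, so
  replacing \<open>H t\<close> by its maximum with this constant does not increase their
  distance to it.\<close>

lemma H_pos: "AE x in leb01. 0 < H t x"
proof -
  let ?f = "\<lambda>x. max (H t x) floor_const"
  have fi: "integrable leb01 ?f"
    by (intro integrable_max H_integrable) simp
  have lim: "(\<lambda>N. \<integral>x. \<bar>evolve b (t - int N) N (\<lambda>_. 1) x - ?f x\<bar> \<partial>leb01) \<longlonglongrightarrow> 0"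
  proof (rule tendsto_sandwich[OF _ _ tendsto_const H_limit[of t]])
    show "\<forall>\<^sub>F N in sequentially. 0 \<le> L1 (\<lambda>x. evolve b (t - int N) N (\<lambda>_. 1) x - ?f x)"
      by (intro always_eventually allI integral_nonneg_AE) auto
    show "\<forall>\<^sub>F N in sequentially. L1 (\<lambda>x. evolve b (t - int N) N (\<lambda>_. 1) x - ?f x) \<le>
        L1 (\<lambda>x. evolve b (t - int N) N (\<lambda>_. 1) x - H t x)"
    proof (intro always_eventually allI integral_mono)
      fix N x assume "x \<in> space leb01"
      then show "\<bar>evolve b (t - int N) N (\<lambda>_. 1) x - ?f x\<bar> \<le> \<bar>evolve b (t - int N) N (\<lambda>_. 1) x - H t x\<bar>"
        using evolve_1_ge[of x "t - int N" N] by (auto simp: max_def)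
    qed (use fi H_integrable integrable_evolve_1 in auto)
  qed
  have "AE x in leb01. H t x = ?f x"
    by (rule AE_eq_of_L1_limit[OF H_integrable fi integrable_evolve_1 H_limit lim])
  then show ?thesis
    by eventually_elim (use floor_const_pos in linarith)
qed

text \<open>Both sides are limits of the same images of \<open>1\<close>.\<close>

lemma H_step: "AE x in leb01. full_transfer (b t) (H t) x = H (t + 1) x"
proof (rule AE_eq_of_L1_limit)
  let ?w = "\<lambda>N. evolve b (t + 1 - int (Suc N)) (Suc N) (\<lambda>_. 1)"
  show "(\<lambda>N. \<integral>x. \<bar>?w N x - H (t + 1) x\<bar> \<partial>leb01) \<longlonglongrightarrow> 0"
    using LIMSEQ_Suc[OF H_limit[of "t + 1"]] .
  have w: "?w N = full_transfer (b t) (evolve b (t - int N) N (\<lambda>_. 1))" for N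
    by simp
  have d: "integrable leb01 (\<lambda>x. evolve b (t - int N) N (\<lambda>_. 1) x - H t x)" for N
    using H_integrable integrable_evolve_1 by simp
  have contr: "L1 (\<lambda>x. ?w N x - full_transfer (b t) (H t) x) \<le>
      L1 (\<lambda>x. evolve b (t - int N) N (\<lambda>_. 1) x - H t x)" for N
    unfolding w using evolve_L1_contraction[OF d[of N], of t 1] by (simp add: full_transfer_diff)
  show "(\<lambda>N. \<integral>x. \<bar>?w N x - full_transfer (b t) (H t) x\<bar> \<partial>leb01) \<longlonglongrightarrow> 0"
  proof (rule tendsto_sandwich[OF _ _ tendsto_const H_limit[of t]])
    show "\<forall>\<^sub>F N in sequentially. 0 \<le> L1 (\<lambda>x. ?w N x - full_transfer (b t) (H t) x)"
      by (intro always_eventually allI integral_nonneg_AE) auto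
    show "\<forall>\<^sub>F N in sequentially. L1 (\<lambda>x. ?w N x - full_transfer (b t) (H t) x) \<le>
        L1 (\<lambda>x. evolve b (t - int N) N (\<lambda>_. 1) x - H t x)"
      by (intro always_eventually allI contr)
  qed
qed (rule integrable_full_transfer[OF b_pos H_integrable] H_integrable integrable_evolve_1)+

lemma evolve_cong_AE:
  assumes u: "integrable leb01 u" and v: "integrable leb01 v" and uv: "AE x in leb01. u x = v x"
  shows "AE x in leb01. evolve b t n u x = evolve b t n v x"
proof (induction n)
  case (Suc n)
  then show ?case
    unfolding evolve.simps by (intro full_transfer_cong_AE[OF b_pos] integrable_evolve u v)
qed (use uv in simp)

lemma evolve_mono_AE:
  assumes u: "integrable leb01 u" and v: "integrable leb01 v" and uv: "AE x in leb01. u x \<le> v x"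
  shows "AE x in leb01. evolve b t n u x \<le> evolve b t n v x"
proof -
  have "AE x in leb01. u x = min (u x) (v x)"
    using uv by eventually_elim simp
  then have "AE x in leb01. evolve b t n u x = evolve b t n (\<lambda>x. min (u x) (v x)) x"
    by (intro evolve_cong_AE u integrable_min v)
  then show ?thesis
    using AE_space
  proof eventually_elim
    case (elim x)
    have "evolve b t n (\<lambda>x. min (u x) (v x)) x \<le> evolve b t n v x"
      using elim(2) by (intro evolve_mono) auto
    then show ?case
      using elim(1) by simp
  qed
qed

lemma evolve_H: "AE x in leb01. evolve b t n (H t) x = H (t + int n) x"
proof (induction n)
  case (Suc n)
  have "AE x in leb01. full_transfer (b (t + int n)) (evolve b t n (H t)) x = full_transfer (b (t + int n)) (H (t + int n)) x"
    by (intro full_transfer_cong_AE[OF b_pos] integrable_evolve H_integrable Suc)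
  then show ?case
    using H_step[of "t + int n"] by eventually_elim (simp add: add_ac)
qed simp

text \<open>The iterates \<open>norm_transfer_iterate\<close> along an orbit, written in terms
  of \<open>b\<close> and \<open>H\<close> only.\<close>

primrec normalized :: "int \<Rightarrow> nat \<Rightarrow> (real \<Rightarrow> real) \<Rightarrow> real \<Rightarrow> real" where
  "normalized t 0 \<phi> = \<phi>"
| "normalized t (Suc n) \<phi> = (\<lambda>x. transfer (b (t + int n)) (\<lambda>y. normalized t n \<phi> y * H (t + int n) y) x / H (t + int n + 1) x)"

lemma integrable_mult_H:
  assumes \<phi>: "\<phi> \<in> borel_measurable leb01" and bd: "AE x in leb01. \<bar>\<phi> x\<bar> \<le> G"
  shows "integrable leb01 (\<lambda>x. \<phi> x * H t x)"
proof (rule Bochner_Integration.integrable_bound)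
  show "integrable leb01 (\<lambda>x. G * H t x)"
    by (intro integrable_mult_right H_integrable)
  show "(\<lambda>x. \<phi> x * H t x) \<in> borel_measurable leb01"
    by (intro borel_measurable_times \<phi> H_measurable)
  show "AE x in leb01. norm (\<phi> x * H t x) \<le> norm (G * H t x)"
    using bd AE_space
  proof eventually_elim
    case (elim x)
    then show ?case
      using H_nonneg[of x t] by (auto simp: abs_mult intro!: mult_right_mono)
  qed
qed

lemma normalized_measurable: "\<phi> \<in> borel_measurable leb01 \<Longrightarrow> normalized t n \<phi> \<in> borel_measurable leb01"
  by (induction n)
    (auto intro!: borel_measurable_divide transfer_measurable[OF b_pos] borel_measurable_times H_measurable)

text \<open>Since \<open>H\<close> is positive almost everywhere, dividing by it and multiplying
  back at the next step cancel. The bound then follows from positivity of \<open>evolve\<close>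
  and \<open>evolve_H\<close>.\<close>

lemma normalized_evolve:
  assumes \<phi>: "\<phi> \<in> borel_measurable leb01" and bd: "AE x in leb01. \<bar>\<phi> x\<bar> \<le> G"
  shows "AE x in leb01. normalized t n \<phi> x * H (t + int n) x = evolve b t n (\<lambda>x. \<phi> x * H t x) x"
    and "AE x in leb01. \<bar>normalized t n \<phi> x\<bar> \<le> G"
proof -
  have int: "integrable leb01 (\<lambda>x. \<phi> x * H t x)"
    by (rule integrable_mult_H[OF \<phi> bd])
  have bound: "AE x in leb01. \<bar>normalized t n \<phi> x\<bar> \<le> G"
    if eq: "AE x in leb01. normalized t n \<phi> x * H (t + int n) x = evolve b t n (\<lambda>x. \<phi> x * H t x) x" for n
  proof -
    have "AE x in leb01. \<phi> x * H t x \<le> G * H t x"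
      using bd AE_space by eventually_elim (auto intro!: mult_right_mono H_nonneg)
    then have up: "AE x in leb01. evolve b t n (\<lambda>x. \<phi> x * H t x) x \<le> evolve b t n (\<lambda>x. G * H t x) x"
      by (intro evolve_mono_AE int integrable_mult_right H_integrable)
    have "AE x in leb01. (- G) * H t x \<le> \<phi> x * H t x"
      using bd AE_space by eventually_elim (intro mult_right_mono H_nonneg, auto)
    then have low: "AE x in leb01. evolve b t n (\<lambda>x. (- G) * H t x) x \<le> evolve b t n (\<lambda>x. \<phi> x * H t x) x"
      by (intro evolve_mono_AE int integrable_mult_right H_integrable)
    show ?thesis
      using up low eq evolve_H[of t n] H_pos[of "t + int n"]
    proof eventually_elim
      case (elim x)
      have "normalized t n \<phi> x * H (t + int n) x \<le> G * H (t + int n) x"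
        "(- G) * H (t + int n) x \<le> normalized t n \<phi> x * H (t + int n) x"
        using elim unfolding evolve_scale by auto
      then have "normalized t n \<phi> x \<le> G" "- G \<le> normalized t n \<phi> x"
        using elim(5) mult_le_cancel_right_pos by blast+
      then show ?case by (simp add: abs_le_iff)
    qed
  qed
  have main: "AE x in leb01. normalized t n \<phi> x * H (t + int n) x = evolve b t n (\<lambda>x. \<phi> x * H t x) x" for n
  proof (induction n)
    case (Suc n)
    let ?u = "\<lambda>x. normalized t n \<phi> x * H (t + int n) x"
    have "integrable leb01 ?u"
      by (rule integrable_mult_H[OF normalized_measurable[OF \<phi>] bound[OF Suc]])
    then have "AE x in leb01. full_transfer (b (t + int n)) ?u x =
        full_transfer (b (t + int n)) (evolve b t n (\<lambda>x. \<phi> x * H t x)) x"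
      by (intro full_transfer_cong_AE[OF b_pos] integrable_evolve int Suc)
    then show ?case
      using H_pos[of "t + int n + 1"] transfer_AE_eq_full[OF b_pos[of "t + int n"], of ?u]
    proof eventually_elim
      case (elim x)
      then have "normalized t (Suc n) \<phi> x * H (t + int n + 1) x = transfer (b (t + int n)) ?u x"
        by simp
      then show ?case
        using elim by (simp add: add_ac)
    qed
  qed simp
  show "AE x in leb01. normalized t n \<phi> x * H (t + int n) x = evolve b t n (\<lambda>x. \<phi> x * H t x) x"
    by (rule main)
  show "AE x in leb01. \<bar>normalized t n \<phi> x\<bar> \<le> G"
    by (rule bound[OF main])
qed

lemma observed_diff: "observed b k g\<^sub>1 g\<^sub>2 (\<lambda>x. u x - v x) = (\<lambda>x. observed b k g\<^sub>1 g\<^sub>2 u x - observed b k g\<^sub>1 g\<^sub>2 v x)"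
  by (simp add: observed_def right_diff_distrib evolve_diff)

text \<open>The bounds for images of \<open>1\<close> pass to the limit \<open>H\<close>,
  because \<open>observed\<close> and \<open>evolve\<close> are bounded operators on
  \<open>L\<^sup>1\<close>.\<close>

lemma defect_limit:
  assumes g1: "lip_bounded G\<^sub>1 g\<^sub>1" and g2: "lip_bounded G\<^sub>2 g\<^sub>2"
    and bound: "\<And>N. L1 (evolve b 0 n (defect (evolve b (- int (N + k)) (N + k) (\<lambda>_. 1))
        (observed b k g\<^sub>1 g\<^sub>2 (evolve b (- int (N + k)) N (\<lambda>_. 1))))) \<le> D"
  shows "L1 (evolve b 0 n (defect (H 0) (observed b k g\<^sub>1 g\<^sub>2 (H (- int k))))) \<le> D"
proof -
  define h where "h N = evolve b (- int (N + k)) (N + k) (\<lambda>_. 1)" for N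
  define f where "f N = evolve b (- int (N + k)) N (\<lambda>_. 1)" for N
  define w where "w N = observed b k g\<^sub>1 g\<^sub>2 (f N)" for N
  define w' where "w' = observed b k g\<^sub>1 g\<^sub>2 (H (- int k))"
  note G1 = lip_boundedD[OF g1] and G2 = lip_boundedD[OF g2]
  note m1 = lip_bounded_measurable[OF g1] and m2 = lip_bounded_measurable[OF g2]
  have obs: "integrable leb01 (observed b k g\<^sub>1 g\<^sub>2 u)"
    "L1 (observed b k g\<^sub>1 g\<^sub>2 u) \<le> G\<^sub>1 * G\<^sub>2 * L1 u"
    if "integrable leb01 u" for u
    using observed_integrable[OF m1 G1(2) m2 G2(2) G1(1) G2(1) that, of k] by auto
  have h: "integrable leb01 (h N)" and f: "integrable leb01 (f N)" for N
    unfolding h_def f_def by (rule integrable_evolve_1)+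
  have w: "integrable leb01 (w N)" and w': "integrable leb01 w'" for N
    unfolding w_def w'_def by (rule obs(1)[OF f], rule obs(1)[OF H_integrable])
  have habs: "L1 (h N) = 1" for N
  proof -
    have "L1 (h N) = mass (h N)"
      unfolding h_def
      by (intro Bochner_Integration.integral_cong) (auto simp: abs_of_nonneg lsv_cone_nonneg[OF lsv_cone_evolve_1])
    then show ?thesis
      using integral_evolve_1 by (simp add: h_def)
  qed
  have hlim: "(\<lambda>N. \<integral>x. \<bar>h N x - H 0 x\<bar> \<partial>leb01) \<longlonglongrightarrow> 0"
    using LIMSEQ_ignore_initial_segment[OF H_limit[of 0], of k] by (simp add: h_def)
  have flim: "(\<lambda>N. \<integral>x. \<bar>f N x - H (- int k) x\<bar> \<partial>leb01) \<longlonglongrightarrow> 0"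
  proof -
    have "- int k - int N = - int (N + k)" for N by simp
    then show ?thesis
      using H_limit[of "- int k"] by (simp only: f_def)
  qed
  define e where "e N = 2 * (G\<^sub>1 * G\<^sub>2 * L1 (\<lambda>x. f N x - H (- int k) x)) +
      \<bar>\<integral>x. w' x \<partial>leb01\<bar> * L1 (\<lambda>x. h N x - H 0 x)" for N
  have elim: "(\<lambda>N. D + e N) \<longlonglongrightarrow> D + (2 * (G\<^sub>1 * G\<^sub>2 * 0) + \<bar>\<integral>x. w' x \<partial>leb01\<bar> * 0)"
    unfolding e_def by (intro tendsto_intros hlim flim)
  have "L1 (evolve b 0 n (defect (H 0) w')) \<le> D + e N" for N
  proof -
    let ?I = "\<lambda>u. \<integral>x. u x \<partial>leb01"
    have ww: "L1 (\<lambda>x. w N x - w' x) \<le> G\<^sub>1 * G\<^sub>2 * L1 (\<lambda>x. f N x - H (- int k) x)"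
      using obs(2)[of "\<lambda>x. f N x - H (- int k) x"] f[of N] H_integrable
      unfolding observed_diff w_def w'_def by simp
    have di: "integrable leb01 (defect (H 0) w')" "integrable leb01 (defect (h N) (w N))"
      by (intro defect_integrable w w' h H_integrable)+
    have "L1 (evolve b 0 n (defect (H 0) w')) \<le>
        (\<integral>x. \<bar>evolve b 0 n (defect (h N) (w N)) x\<bar> + \<bar>evolve b 0 n (\<lambda>x. defect (H 0) w' x - defect (h N) (w N) x) x\<bar> \<partial>leb01)"
      by (intro integral_mono integrable_abs Bochner_Integration.integrable_add integrable_evolve di
          Bochner_Integration.integrable_diff) (simp add: evolve_diff)
    also have "\<dots> = L1 (evolve b 0 n (defect (h N) (w N))) +
        L1 (\<lambda>x. evolve b 0 n (\<lambda>x. defect (H 0) w' x - defect (h N) (w N) x) x)"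
      by (intro Bochner_Integration.integral_add integrable_abs integrable_evolve di Bochner_Integration.integrable_diff)
    also have "\<dots> \<le> D + L1 (\<lambda>x. defect (H 0) w' x - defect (h N) (w N) x)"
      using bound[of N] unfolding h_def[symmetric] f_def[symmetric] w_def[symmetric]
      by (intro add_mono evolve_L1_contraction Bochner_Integration.integrable_diff di)
    also have "L1 (\<lambda>x. defect (H 0) w' x - defect (h N) (w N) x) \<le>
        (\<integral>x. \<bar>w N x - w' x\<bar> + (\<bar>?I w'\<bar> * \<bar>h N x - H 0 x\<bar> + \<bar>?I (w N) - ?I w'\<bar> * \<bar>h N x\<bar>) \<partial>leb01)"
    proof (rule integral_mono)
      fix x
      have "defect (H 0) w' x - defect (h N) (w N) x =
          - (w N x - w' x) + (?I w' * (h N x - H 0 x) + (?I (w N) - ?I w') * h N x)"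
        by (simp add: defect_def algebra_simps)
      then show "\<bar>defect (H 0) w' x - defect (h N) (w N) x\<bar> \<le>
          \<bar>w N x - w' x\<bar> + (\<bar>?I w'\<bar> * \<bar>h N x - H 0 x\<bar> + \<bar>?I (w N) - ?I w'\<bar> * \<bar>h N x\<bar>)"
        unfolding abs_mult[symmetric] by linarith
    qed (use di w[of N] w' h[of N] H_integrable[of 0] in auto)
    also have "\<dots> = L1 (\<lambda>x. w N x - w' x) + (\<bar>?I w'\<bar> * L1 (\<lambda>x. h N x - H 0 x) + \<bar>?I (w N) - ?I w'\<bar>)"
      using w[of N] w' h[of N] H_integrable[of 0] habs[of N] by simp
    also have "\<bar>?I (w N) - ?I w'\<bar> \<le> L1 (\<lambda>x. w N x - w' x)"
      using integral_abs_bound[of leb01 "\<lambda>x. w N x - w' x"] w[of N] w' by simp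
    finally show ?thesis
      using ww unfolding e_def by linarith
  qed
  then show ?thesis
    unfolding w'_def[symmetric] using LIMSEQ_le_const[OF elim] by auto
qed

text \<open>Multiplying by the density \<open>H (int n)\<close>, which is the image of \<open>H
  0\<close>, turns centering with respect to the invariant measure into
  \<open>defect\<close>.\<close>

lemma centered_L1:
  fixes k n :: nat
  assumes g1: "lip_bounded G\<^sub>1 g\<^sub>1" and g2: "lip_bounded G\<^sub>2 g\<^sub>2"
  defines "\<phi> \<equiv> \<lambda>x. g\<^sub>2 x * normalized (- int k) k g\<^sub>1 x"
  shows "normalized 0 n \<phi> \<in> borel_measurable leb01"
    and "AE x in leb01. \<bar>normalized 0 n \<phi> x\<bar> \<le> G\<^sub>1 * G\<^sub>2"
    and "(\<integral>x. \<bar>normalized 0 n \<phi> x - (\<integral>y. normalized 0 n \<phi> y * H (int n) y \<partial>leb01)\<bar> * H (int n) x \<partial>leb01) =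
      L1 (evolve b 0 n (defect (H 0) (observed b k g\<^sub>1 g\<^sub>2 (H (- int k)))))"
proof -
  note G1 = lip_boundedD[OF g1] and G2 = lip_boundedD[OF g2]
  note m1 = lip_bounded_measurable[OF g1] and m2 = lip_bounded_measurable[OF g2]
  define w where "w = observed b k g\<^sub>1 g\<^sub>2 (H (- int k))"
  have b1: "AE x in leb01. \<bar>g\<^sub>1 x\<bar> \<le> G\<^sub>1"
    using G1(2) by (intro AE_I2) simp
  have \<phi>m: "\<phi> \<in> borel_measurable leb01"
    unfolding \<phi>_def by (intro borel_measurable_times m2 normalized_measurable m1)
  have \<phi>b: "AE x in leb01. \<bar>\<phi> x\<bar> \<le> G\<^sub>1 * G\<^sub>2"
    using normalized_evolve(2)[OF m1 b1, of "- int k" k] AE_space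
  proof eventually_elim
    case (elim x)
    then have "\<bar>g\<^sub>2 x\<bar> * \<bar>normalized (- int k) k g\<^sub>1 x\<bar> \<le> G\<^sub>2 * G\<^sub>1"
      using G2(1) G2(2)[of x] by (intro mult_mono) auto
    then show ?case
      by (simp add: \<phi>_def abs_mult mult.commute)
  qed
  show "normalized 0 n \<phi> \<in> borel_measurable leb01"
    by (rule normalized_measurable[OF \<phi>m])
  show "AE x in leb01. \<bar>normalized 0 n \<phi> x\<bar> \<le> G\<^sub>1 * G\<^sub>2"
    by (rule normalized_evolve(2)[OF \<phi>m \<phi>b])
  have wint: "integrable leb01 w"
    unfolding w_def by (rule observed_integrable(1)[OF m1 G1(2) m2 G2(2) G1(1) G2(1) H_integrable])
  have \<phi>int: "integrable leb01 (\<lambda>x. \<phi> x * H 0 x)"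
    by (rule integrable_mult_H[OF \<phi>m \<phi>b])
  have w: "AE x in leb01. \<phi> x * H 0 x = w x"
    using normalized_evolve(1)[OF m1 b1, of "- int k" k]
    by eventually_elim (simp add: \<phi>_def w_def observed_def mult.assoc)
  have ev: "AE x in leb01. normalized 0 n \<phi> x * H (int n) x = evolve b 0 n w x"
    using normalized_evolve(1)[OF \<phi>m \<phi>b, of 0 n] evolve_cong_AE[OF \<phi>int wint w, of 0 n]
    by eventually_elim simp
  have nm: "(\<lambda>x. normalized 0 n \<phi> x * H (int n) x) \<in> borel_measurable leb01"
    by (intro borel_measurable_times normalized_measurable \<phi>m H_measurable)
  have mean: "(\<integral>y. normalized 0 n \<phi> y * H (int n) y \<partial>leb01) = mass w" (is "?m = _")
    using integral_cong_AE[OF nm borel_measurable_integrable[OF integrable_evolve[OF wint]] ev] integral_evolve[OF wint]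
    by simp
  show "(\<integral>x. \<bar>normalized 0 n \<phi> x - ?m\<bar> * H (int n) x \<partial>leb01) =
      L1 (evolve b 0 n (defect (H 0) (observed b k g\<^sub>1 g\<^sub>2 (H (- int k)))))"
    unfolding w_def[symmetric]
  proof (rule integral_cong_AE)
    show "(\<lambda>x. \<bar>normalized 0 n \<phi> x - ?m\<bar> * H (int n) x) \<in> borel_measurable leb01"
      by (intro borel_measurable_times borel_measurable_abs borel_measurable_diff normalized_measurable \<phi>m H_measurable
          borel_measurable_const)
    show "(\<lambda>x. \<bar>evolve b 0 n (defect (H 0) w) x\<bar>) \<in> borel_measurable leb01"
      by (intro borel_measurable_abs borel_measurable_integrable integrable_evolve defect_integrable wint H_integrable)
    show "AE x in leb01. \<bar>normalized 0 n \<phi> x - ?m\<bar> * H (int n) x = \<bar>evolve b 0 n (defect (H 0) w) x\<bar>"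
      using ev evolve_H[of 0 n] H_pos[of "int n"]
    proof eventually_elim
      case (elim x)
      have "\<bar>normalized 0 n \<phi> x - ?m\<bar> * H (int n) x = \<bar>(normalized 0 n \<phi> x - ?m) * H (int n) x\<bar>"
        using elim(3) by (simp add: abs_mult)
      also have "(normalized 0 n \<phi> x - ?m) * H (int n) x = evolve b 0 n (defect (H 0) w) x"
        using elim by (simp add: left_diff_distrib mean defect_def evolve_diff evolve_scale)
      finally show ?case .
    qed
  qed
qed

end

section \<open>From the L1 estimate to the L^s estimate\<close>

text \<open>The infimum of the Lipschitz constants is itself one.\<close>

lemma lip_bounded_Lip_norm:
  assumes "is_Lip g"
  shows "lip_bounded (Lip_norm g) g"
proof -
  define S where "S = {K. K-lipschitz_on {0..1} g}"
  define A where "A = (SUP x\<in>{0..1::real}. \<bar>g x\<bar>)"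
  obtain K where K: "K \<in> S"
    using assms by (auto simp: is_Lip_def S_def)
  have lip: "\<bar>g x - g y\<bar> \<le> K * \<bar>x - y\<bar>" if "K \<in> S" "x \<in> {0..1}" "y \<in> {0..1}" for K x y
    using lipschitz_onD[of K "{0..1}" g x y] that by (simp add: S_def dist_real_def)
  have nonneg: "0 \<le> K" if "K \<in> S" for K
    using that lipschitz_on_nonneg by (auto simp: S_def)
  have "\<bar>g x\<bar> \<le> \<bar>g 0\<bar> + K" if "x \<in> {0..1}" for x
  proof -
    have "\<bar>g x - g 0\<bar> \<le> K * \<bar>x - 0\<bar>"
      using that by (intro lip K) auto
    also have "\<dots> \<le> K * 1"
      using that nonneg[OF K] by (intro mult_left_mono) auto
    finally show ?thesis by linarith
  qed
  then have bdd: "bdd_above ((\<lambda>x. \<bar>g x\<bar>) ` {0..1})"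
    by (rule bdd_aboveI2)
  have A: "\<bar>g x\<bar> \<le> A" if "x \<in> {0..1}" for x
    unfolding A_def by (rule cSUP_upper[OF that bdd])
  have "0 \<le> A"
    using A[of 0] abs_ge_zero[of "g 0"] by simp
  have "0 \<le> Inf S"
    using K nonneg by (intro cInf_greatest) auto
  have Inf: "\<bar>g x - g y\<bar> \<le> Inf S * \<bar>x - y\<bar>" if xy: "x \<in> {0..1}" "y \<in> {0..1}" for x y
  proof (cases "x = y")
    case False
    have "\<bar>g x - g y\<bar> / \<bar>x - y\<bar> \<le> Inf S"
      using K lip[OF _ xy] False by (intro cInf_greatest) (auto simp: pos_divide_le_eq)
    then show ?thesis
      using False by (simp add: pos_divide_le_eq)
  qed simp
  have L: "Lip_norm g = A + Inf S"
    by (simp add: Lip_norm_def A_def S_def)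
  show ?thesis
    unfolding lip_bounded_def L
  proof (intro conjI ballI)
    show "0 \<le> A + Inf S"
      using \<open>0 \<le> A\<close> \<open>0 \<le> Inf S\<close> by simp
    show "\<bar>g x\<bar> \<le> A + Inf S" if "x \<in> {0..1}" for x
      using A[OF that] \<open>0 \<le> Inf S\<close> by simp
    show "\<bar>g x - g y\<bar> \<le> (A + Inf S) * \<bar>x - y\<bar>" if "x \<in> {0..1}" "y \<in> {0..1}" for x y
      using Inf[OF that] \<open>0 \<le> A\<close> by (simp add: distrib_right add_increasing)
  qed
qed

text \<open>Interpolation: \<open>|f|\<^sup>s \<le> M powr (s - 1) * |f|\<close> where
  \<open>|f| \<le> M\<close>.\<close>

lemma Lp_norm_le_of_L1:
  assumes "prob_space \<mu>" and f: "f \<in> borel_measurable \<mu>" and bd: "AE x in \<mu>. \<bar>f x\<bar> \<le> M"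
    and M: "0 \<le> M" and s: "1 \<le> s" and D: "(\<integral>x. \<bar>f x\<bar> \<partial>\<mu>) \<le> D"
  shows "in_Lp \<mu> s f" and "Lp_norm \<mu> s f \<le> (M powr (s - 1) * D) powr (1 / s)"
proof -
  interpret prob_space \<mu> by fact
  have pw: "\<bar>f x\<bar> powr s \<le> M powr (s - 1) * \<bar>f x\<bar>" if "\<bar>f x\<bar> \<le> M" for x
  proof (cases "f x = 0")
    case False
    then have "\<bar>f x\<bar> powr s = \<bar>f x\<bar> powr (s - 1) * \<bar>f x\<bar> powr 1"
      by (simp only: powr_add[symmetric]) simp
    also have "\<dots> \<le> M powr (s - 1) * \<bar>f x\<bar> powr 1"
      using that s by (intro mult_right_mono powr_mono2) auto
    finally show ?thesis
      using False by simp
  qed (use M in simp)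
  have int: "integrable \<mu> (\<lambda>x. \<bar>f x\<bar>)"
    by (rule integrable_const_bound[where B = M]) (use bd f in auto)
  have ints: "integrable \<mu> (\<lambda>x. \<bar>f x\<bar> powr s)"
  proof (rule Bochner_Integration.integrable_bound)
    show "integrable \<mu> (\<lambda>x. M powr (s - 1) * \<bar>f x\<bar>)"
      using int by simp
    show "(\<lambda>x. \<bar>f x\<bar> powr s) \<in> borel_measurable \<mu>"
      using f by measurable
    show "AE x in \<mu>. norm (\<bar>f x\<bar> powr s) \<le> norm (M powr (s - 1) * \<bar>f x\<bar>)"
      using bd by eventually_elim (use pw in \<open>simp add: abs_mult\<close>)
  qed
  then show "in_Lp \<mu> s f"
    using f by (simp add: in_Lp_def)
  have "(\<integral>x. \<bar>f x\<bar> powr s \<partial>\<mu>) \<le> (\<integral>x. M powr (s - 1) * \<bar>f x\<bar> \<partial>\<mu>)"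
    using bd int by (intro integral_mono_AE ints) (auto elim!: eventually_mono intro: pw)
  also have "\<dots> = M powr (s - 1) * (\<integral>x. \<bar>f x\<bar> \<partial>\<mu>)"
    by simp
  also have "\<dots> \<le> M powr (s - 1) * D"
    using D by (intro mult_left_mono) auto
  finally show "Lp_norm \<mu> s f \<le> (M powr (s - 1) * D) powr (1 / s)"
    unfolding Lp_norm_def using s by (intro powr_mono2) (auto intro!: integral_nonneg_AE)
qed

context limit_density
begin

lemma centered_Lp_norm_le:
  fixes k n :: nat
  assumes g1: "lip_bounded G\<^sub>1 g\<^sub>1" and g2: "lip_bounded G\<^sub>2 g\<^sub>2" and s: "1 \<le> s" and C: "0 \<le> C" and B: "0 \<le> B" and n: "0 < n"
    and bound: "\<And>N. L1 (evolve b 0 n (defect (evolve b (- int (N + k)) (N + k) (\<lambda>_. 1))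
        (observed b k g\<^sub>1 g\<^sub>2 (evolve b (- int (N + k)) N (\<lambda>_. 1)))))
        \<le> C * G\<^sub>1 * G\<^sub>2 * B powr s * real n powr (- a)"
  defines "\<mu> \<equiv> density leb01 (\<lambda>x. ennreal (H (int n) x))"
    and "f \<equiv> normalized 0 n (\<lambda>x. g\<^sub>2 x * normalized (- int k) k g\<^sub>1 x)"
  shows "in_Lp \<mu> s (centered \<mu> f)"
    and "Lp_norm \<mu> s (centered \<mu> f) \<le> 2 * C powr (1 / s) * (1 + G\<^sub>1) * (1 + G\<^sub>2) * B * real n powr (- (1 / s) * a)"
proof -
  note fm = centered_L1(1)[OF g1 g2, where k = k and n = n, folded f_def]
  note fb = centered_L1(2)[OF g1 g2, where k = k and n = n, folded f_def]
  note L1 = centered_L1(3)[OF g1 g2, where k = k and n = n, folded f_def]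
  note G = lip_boundedD(1)[OF g1] lip_boundedD(1)[OF g2]
  let ?h = "H (int n)"
  \<comment> \<open>Working with \<open>1 + G\<close> instead of \<open>G\<close> keeps the
    bound positive.\<close>
  define M where "M = 2 * ((1 + G\<^sub>1) * (1 + G\<^sub>2))"
  have h0: "AE x in leb01. 0 \<le> ?h x"
    using H_nonneg by (intro AE_I2) simp
  have "emeasure \<mu> (space \<mu>) = (\<integral>\<^sup>+ x. ennreal (?h x) \<partial>leb01)"
    unfolding \<mu>_def using H_measurable sets.top[of leb01] by (subst emeasure_density) (auto intro!: nn_integral_cong)
  also have "\<dots> = 1"
    by (subst nn_integral_eq_integral[OF H_integrable h0]) (simp add: H_mass)
  finally have \<mu>: "prob_space \<mu>"
    by (rule prob_spaceI)
  then interpret \<mu>: prob_space \<mu> .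
  have sets: "sets \<mu> = sets leb01"
    by (simp add: \<mu>_def)
  have meas: "g \<in> borel_measurable \<mu>" if "g \<in> borel_measurable leb01" for g :: "real \<Rightarrow> real"
    using that measurable_cong_sets[OF sets refl] by blast
  have AE_\<mu>: "AE x in \<mu>. Q x" if "AE x in leb01. Q x" for Q
    unfolding \<mu>_def using that H_measurable by (subst AE_density) (auto elim: eventually_mono)
  have int_\<mu>: "(\<integral>x. g x \<partial>\<mu>) = (\<integral>x. g x * ?h x \<partial>leb01)" if "g \<in> borel_measurable leb01" for g :: "real \<Rightarrow> real"
    unfolding \<mu>_def using integral_density[OF that H_measurable h0] by (simp add: mult.commute)
  define m where "m = (\<integral>x. f x \<partial>\<mu>)"
  have c: "centered \<mu> f = (\<lambda>x. f x - m)"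
    by (simp add: centered_def m_def fun_eq_iff)
  have fb\<mu>: "AE x in \<mu>. \<bar>f x\<bar> \<le> G\<^sub>1 * G\<^sub>2"
    by (rule AE_\<mu>[OF fb])
  have fint: "integrable \<mu> f"
    by (rule \<mu>.integrable_const_bound[where B = "G\<^sub>1 * G\<^sub>2"]) (use fb\<mu> meas[OF fm] in auto)
  have "\<bar>m\<bar> \<le> (\<integral>x. \<bar>f x\<bar> \<partial>\<mu>)"
    unfolding m_def by (rule integral_abs_bound)
  also have "\<dots> \<le> (\<integral>x. G\<^sub>1 * G\<^sub>2 \<partial>\<mu>)"
    using fint fb\<mu> by (intro integral_mono_AE) auto
  finally have mb: "\<bar>m\<bar> \<le> G\<^sub>1 * G\<^sub>2"
    by (simp add: \<mu>.prob_space)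
  have GM: "2 * (G\<^sub>1 * G\<^sub>2) \<le> M" "0 < M"
    using G unfolding M_def by (auto simp: algebra_simps intro!: add_pos_nonneg)
  have cb: "AE x in \<mu>. \<bar>f x - m\<bar> \<le> M"
    using fb\<mu> by eventually_elim (use mb GM in linarith)
  have cm: "(\<lambda>x. f x - m) \<in> borel_measurable leb01"
    using fm by measurable
  have D: "(\<integral>x. \<bar>f x - m\<bar> \<partial>\<mu>) \<le> C * G\<^sub>1 * G\<^sub>2 * B powr s * real n powr (- a)"
  proof -
    have "(\<integral>x. \<bar>f x - m\<bar> \<partial>\<mu>) = (\<integral>x. \<bar>f x - m\<bar> * ?h x \<partial>leb01)"
      by (rule int_\<mu>[OF borel_measurable_abs[OF cm]])
    also have "\<dots> = L1 (evolve b 0 n (defect (H 0) (observed b k g\<^sub>1 g\<^sub>2 (H (- int k)))))"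
      unfolding m_def int_\<mu>[OF fm] by (rule L1)
    also have "\<dots> \<le> C * G\<^sub>1 * G\<^sub>2 * B powr s * real n powr (- a)"
      by (rule defect_limit[OF g1 g2 bound])
    finally show ?thesis .
  qed
  note Lp = Lp_norm_le_of_L1[OF \<mu> meas[OF cm] cb less_imp_le[OF GM(2)] s D]
  show "in_Lp \<mu> s (centered \<mu> f)"
    unfolding c by (rule Lp(1))
  have "M powr (s - 1) * (C * G\<^sub>1 * G\<^sub>2 * B powr s * real n powr (- a)) =
      M powr (s - 1) * (G\<^sub>1 * G\<^sub>2) * (C * B powr s * real n powr (- a))"
    by (simp only: mult_ac)
  also have "\<dots> \<le> M powr (s - 1) * M powr 1 * (C * B powr s * real n powr (- a))"
    using GM G C by (intro mult_left_mono mult_right_mono) auto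
  also have "M powr (s - 1) * M powr 1 = M powr s"
    by (subst powr_add[symmetric]) simp
  finally have "(M powr (s - 1) * (C * G\<^sub>1 * G\<^sub>2 * B powr s * real n powr (- a))) powr (1 / s)
      \<le> (M powr s * (C * B powr s * real n powr (- a))) powr (1 / s)"
    using s G C by (intro powr_mono2) auto
  also have "\<dots> = M * C powr (1 / s) * B * real n powr (- (1 / s) * a)"
    using s GM(2) C B by (simp add: powr_mult powr_powr)
  also have "\<dots> = 2 * C powr (1 / s) * (1 + G\<^sub>1) * (1 + G\<^sub>2) * B * real n powr (- (1 / s) * a)"
    unfolding M_def by (simp only: mult_ac)
  finally show "Lp_norm \<mu> s (centered \<mu> f) \<le> 2 * C powr (1 / s) * (1 + G\<^sub>1) * (1 + G\<^sub>2) * B * real n powr (- (1 / s) * a)"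
    unfolding c by (rule order_trans[OF Lp(2)])
qed

end

section \<open>Orbits of the driving system as environments\<close>

context invertible_ergodic
begin

lemma funpow_int_iterate:
  "\<omega> \<in> space P \<Longrightarrow> (\<sigma> ^^ m) (int_iterate P \<sigma> u \<omega>) = int_iterate P \<sigma> (u + int m) \<omega>"
  using int_iterate_add[of \<omega> "int m" u] by (simp add: int_iterate_of_nat add.commute)

text \<open>\<open>transfer\<close> and \<open>full_transfer\<close> differ at one point only,
  and \<open>full_transfer\<close> does not see null sets.\<close>

lemma cocycle_transfer_AE:
  assumes \<omega>: "\<omega> \<in> space P" and env: "lsv_environment (orbit_env P \<sigma> \<beta> \<omega>) \<beta>0" and \<phi>: "integrable leb01 \<phi>"
  shows "cocycle_iterate \<sigma> (\<lambda>\<omega>. transfer (\<beta> \<omega>)) m (int_iterate P \<sigma> u \<omega>) \<phi> \<in> borel_measurable leb01 \<and>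
    (AE x in leb01. cocycle_iterate \<sigma> (\<lambda>\<omega>. transfer (\<beta> \<omega>)) m (int_iterate P \<sigma> u \<omega>) \<phi> x =
       evolve (orbit_env P \<sigma> \<beta> \<omega>) u m \<phi> x)"
proof -
  interpret lsv_environment "orbit_env P \<sigma> \<beta> \<omega>" \<beta>0 by (rule env)
  show ?thesis
  proof (induction m)
    case 0
    then show ?case
      using \<phi> by auto
  next
    case (Suc m)
    let ?\<psi> = "cocycle_iterate \<sigma> (\<lambda>\<omega>. transfer (\<beta> \<omega>)) m (int_iterate P \<sigma> u \<omega>) \<phi>"
    let ?b = "orbit_env P \<sigma> \<beta> \<omega> (u + int m)"
    have step: "cocycle_iterate \<sigma> (\<lambda>\<omega>. transfer (\<beta> \<omega>)) (Suc m) (int_iterate P \<sigma> u \<omega>) \<phi> = transfer ?b ?\<psi>"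
      by (simp add: funpow_int_iterate[OF \<omega>] orbit_env_def)
    have \<psi>: "integrable leb01 ?\<psi>"
      by (rule integrable_cong_AE_imp[OF integrable_evolve[OF \<phi>]]) (use Suc in \<open>auto elim: eventually_mono\<close>)
    have "AE x in leb01. full_transfer ?b ?\<psi> x = full_transfer ?b (evolve (orbit_env P \<sigma> \<beta> \<omega>) u m \<phi>) x"
      using Suc by (intro full_transfer_cong_AE[OF b_pos] \<psi> integrable_evolve \<phi>) auto
    then have "AE x in leb01. transfer ?b ?\<psi> x = evolve (orbit_env P \<sigma> \<beta> \<omega>) u (Suc m) \<phi> x"
      using transfer_AE_eq_full[OF b_pos[of "u + int m"], of ?\<psi>] by eventually_elim simp
    then show ?case
      unfolding step using Suc transfer_measurable[OF b_pos] by blast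
  qed
qed

lemma limit_density_orbit:
  assumes \<omega>: "\<omega> \<in> space P" and env: "lsv_environment (orbit_env P \<sigma> \<beta> \<omega>) \<beta>0"
    and h: "is_racim_density P \<sigma> \<beta> h"
    and lim: "\<And>t. (\<lambda>n. \<integral>x. \<bar>cocycle_iterate \<sigma> (\<lambda>\<omega>. transfer (\<beta> \<omega>)) n
        (int_iterate P \<sigma> (- int n) (int_iterate P \<sigma> t \<omega>)) (\<lambda>_. 1) x - h (int_iterate P \<sigma> t \<omega>) x\<bar> \<partial>leb01) \<longlonglongrightarrow> 0"
  shows "limit_density (orbit_env P \<sigma> \<beta> \<omega>) \<beta>0 (\<lambda>t. h (int_iterate P \<sigma> t \<omega>))"
proof -
  interpret lsv_environment "orbit_env P \<sigma> \<beta> \<omega>" \<beta>0 by (rule env)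
  have hm: "h \<omega>' \<in> borel_measurable leb01" and h0: "\<And>x. x \<in> {0..1} \<Longrightarrow> 0 \<le> h \<omega>' x"
    and mass: "(\<integral>\<^sup>+ x. ennreal (h \<omega>' x) \<partial>leb01) = 1" if "\<omega>' \<in> space P" for \<omega>'
  proof -
    show m: "h \<omega>' \<in> borel_measurable leb01" and "\<And>x. x \<in> {0..1} \<Longrightarrow> 0 \<le> h \<omega>' x"
      using h that by (auto simp: is_racim_density_def)
    have "racim h \<in> P \<rightarrow>\<^sub>M prob_algebra leb01"
      using h by (simp add: is_racim_density_def)
    from measurable_space[OF this that] have "prob_space (racim h \<omega>')"
      by (simp add: space_prob_algebra)
    then have "emeasure (racim h \<omega>') (space leb01) = 1"
      using prob_space.emeasure_space_1[of "racim h \<omega>'"] by (simp add: racim_def)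
    moreover have "emeasure (racim h \<omega>') (space leb01) = (\<integral>\<^sup>+ x. ennreal (h \<omega>' x) \<partial>leb01)"
      unfolding racim_def using m sets.top[of leb01] by (subst emeasure_density) (auto intro!: nn_integral_cong)
    ultimately show "(\<integral>\<^sup>+ x. ennreal (h \<omega>' x) \<partial>leb01) = 1" by simp
  qed
  have AE0: "AE x in leb01. 0 \<le> h \<omega>' x" if "\<omega>' \<in> space P" for \<omega>'
    using h0[OF that] by (intro AE_I2) simp
  have hint: "integrable leb01 (h \<omega>')" if "\<omega>' \<in> space P" for \<omega>'
    using hm[OF that] AE0[OF that] mass[OF that] by (intro integrableI_nonneg) auto
  show ?thesis
  proof
    fix t
    note sp = int_iterate_space[OF \<omega>, of t]
    show "integrable leb01 (h (int_iterate P \<sigma> t \<omega>))"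
      by (rule hint[OF sp])
    show "0 \<le> h (int_iterate P \<sigma> t \<omega>) x" if "x \<in> {0..1}" for x
      by (rule h0[OF sp that])
    show "mass (h (int_iterate P \<sigma> t \<omega>)) = 1"
      using mass[OF sp] by (subst integral_eq_nn_integral[OF hm[OF sp] AE0[OF sp]]) simp
    show "(\<lambda>N. \<integral>x. \<bar>evolve (orbit_env P \<sigma> \<beta> \<omega>) (t - int N) N (\<lambda>_. 1) x - h (int_iterate P \<sigma> t \<omega>) x\<bar> \<partial>leb01) \<longlonglongrightarrow> 0"
    proof (rule Lim_transform_eventually[OF lim[of t]], intro always_eventually allI)
      fix N
      let ?c = "cocycle_iterate \<sigma> (\<lambda>\<omega>. transfer (\<beta> \<omega>)) N (int_iterate P \<sigma> (- int N) (int_iterate P \<sigma> t \<omega>)) (\<lambda>_. 1)"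
      let ?e = "evolve (orbit_env P \<sigma> \<beta> \<omega>) (t - int N) N (\<lambda>_. 1)"
      have "int_iterate P \<sigma> (- int N) (int_iterate P \<sigma> t \<omega>) = int_iterate P \<sigma> (t - int N) \<omega>"
        using int_iterate_add[OF \<omega>, of "- int N" t] by (simp add: algebra_simps)
      then have c: "?c \<in> borel_measurable leb01" "AE x in leb01. ?c x = ?e x"
        using cocycle_transfer_AE[OF \<omega> env, of "\<lambda>_. 1" N "t - int N"] by auto
      have em: "?e \<in> borel_measurable leb01"
        by (intro evolve_measurable) simp
      show "L1 (\<lambda>x. ?c x - h (int_iterate P \<sigma> t \<omega>) x) = L1 (\<lambda>x. ?e x - h (int_iterate P \<sigma> t \<omega>) x)"
        using c(2) by (intro integral_cong_AE borel_measurable_abs borel_measurable_diff c(1) em hm[OF sp])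
          (auto elim: eventually_mono)
    qed
  qed
qed

end

theorem corollary27:
  fixes P :: "'w measure" and \<sigma> :: "'w \<Rightarrow> 'w" and \<beta> :: "'w \<Rightarrow> real"
    and \<gamma> p s q \<iota> :: real
  assumes "invertible_ergodic P \<sigma>"
    and "\<beta> \<in> borel_measurable P" and "\<And>\<omega>. \<omega> \<in> space P \<Longrightarrow> 0 < \<beta> \<omega> \<and> \<beta> \<omega> < 1"
    and "esssup P (\<lambda>\<omega>. ereal (\<beta> \<omega>)) < 1"
    and "0 < \<gamma>" and "measure P {\<omega> \<in> space P. \<beta> \<omega> \<le> \<gamma>} > 0"
    and "\<gamma> < 1/2" and "1 \<le> p" and "1 \<le> s"
    and "alpha_mixing P \<sigma> \<beta> \<in> O(\<lambda>n. real n powr (- q + 1) * ln (real n) powr (- \<iota>))"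
    and "\<iota> > q" and "q > p / s * (1 / \<gamma> - 1) + 2"
  shows "\<exists>C B. in_Lp P p B \<and>
    (\<forall>h. is_racim_density P \<sigma> \<beta> h \<longrightarrow>
      (\<forall>r i j :: nat. r \<le> i \<and> i < j \<longrightarrow>
        (AE \<omega> in P. \<forall>g\<^sub>1 g\<^sub>2. is_Lip g\<^sub>1 \<and> is_Lip g\<^sub>2 \<longrightarrow>
          (let \<mu> = racim h ((\<sigma> ^^ j) \<omega>);
               f = centered \<mu> (norm_transfer_iterate \<sigma> \<beta> h (j - i) ((\<sigma> ^^ i) \<omega>)
                     (\<lambda>x. g\<^sub>2 x * norm_transfer_iterate \<sigma> \<beta> h (i - r) ((\<sigma> ^^ r) \<omega>) g\<^sub>1 x))
           in in_Lp \<mu> s f \<and>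
              Lp_norm \<mu> s f \<le> C * (1 + Lip_norm g\<^sub>1) * (1 + Lip_norm g\<^sub>2) * B ((\<sigma> ^^ i) \<omega>)
                * real (j - i) powr (- (1 / s) * (1 / \<gamma> - 1))))))"
proof -
  interpret invertible_ergodic P \<sigma> by (rule assms(1))
  interpret mixing_environment P \<sigma> \<beta> \<gamma>
    by unfold_locales (rule assms(2))
  have \<gamma>: "0 < \<gamma>" "\<gamma> < 1" and a: "0 < 1 / \<gamma> - 1"
    using assms(5,7) by auto
  have "0 < p / s * (1 / \<gamma> - 1)"
    using a assms(8,9) by (intro mult_pos_pos divide_pos_pos) auto
  then have q: "2 < q"
    using assms(12) by linarith
  obtain A where A: "0 \<le> A" "\<And>n. 0 < n \<Longrightarrow> alpha_mixing P \<sigma> \<beta> n \<le> A * real n powr (1 - q)"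
    using alpha_mixing_polynomial[OF assms(10) _ _ alpha_le_1] assms(11) q by auto
  have good0: "0 < prob (good 0)"
    using assms(6) by (simp add: good_def)
  obtain \<theta> R B where \<theta>: "0 < \<theta>" and R: "1 \<le> R" and B: "in_Lp P p B" and AE_B:
    "AE \<omega> in P. 1 \<le> B \<omega> \<and> (\<forall>K>0. \<not> good_blocks (orbit_env P \<sigma> \<beta> \<omega>) \<gamma> \<theta> (K ^ R) (4 * K) \<longrightarrow>
       real (K ^ Suc R) powr (1 / \<gamma> - 1) \<le> B \<omega> powr s)"
    by (rule random_constant[OF good0 q A a assms(8,9,12)])
  obtain \<rho> where \<rho>: "esssup P (\<lambda>\<omega>. ereal (\<beta> \<omega>)) < ereal \<rho>" "ereal \<rho> < 1"
    using ereal_dense2[OF assms(4)] by auto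
  \<comment> \<open>An essential upper bound of \<open>\<beta>\<close> below \<open>1\<close>;
    the maximum makes it positive.\<close>
  define \<beta>0 where "\<beta>0 = max \<rho> (1/2)"
  have \<beta>0: "0 < \<beta>0" "\<beta>0 < 1"
    using \<rho>(2) by (auto simp: \<beta>0_def one_ereal_def)
  have "AE \<omega> in P. \<beta> \<omega> \<le> \<beta>0"
    using esssup_AE[where M = P and f = "\<lambda>\<omega>. ereal (\<beta> \<omega>)"]
  proof eventually_elim
    case (elim \<omega>)
    then have "ereal (\<beta> \<omega>) < ereal \<rho>"
      using \<rho>(1) by (rule le_less_trans)
    then show ?case
      by (simp add: \<beta>0_def)
  qed
  then have AE_\<beta>: "AE \<omega> in P. \<forall>t. \<beta> (int_iterate P \<sigma> t \<omega>) \<le> \<beta>0"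
    unfolding AE_all_countable by (intro allI) (rule AE_int_iterate)
  obtain C where C: "0 \<le> C" and "\<forall>b g\<^sub>1 g\<^sub>2 G\<^sub>1 G\<^sub>2 B N k n. lsv_environment b \<beta>0 \<longrightarrow> lip_bounded G\<^sub>1 g\<^sub>1 \<longrightarrow> lip_bounded G\<^sub>2 g\<^sub>2 \<longrightarrow>
    1 \<le> B \<longrightarrow> (\<forall>K>0. \<not> good_blocks b \<gamma> \<theta> (K ^ R) (4 * K) \<longrightarrow> real (K ^ Suc R) powr (1 / \<gamma> - 1) \<le> B) \<longrightarrow>
    0 < n \<longrightarrow>
    L1 (evolve b 0 n (defect (evolve b (- int (N + k)) (N + k) (\<lambda>_. 1))
        (observed b k g\<^sub>1 g\<^sub>2 (evolve b (- int (N + k)) N (\<lambda>_. 1)))))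
      \<le> C * G\<^sub>1 * G\<^sub>2 * B * real n powr (1 - 1 / \<gamma>)"
    using uniform_decay[OF \<beta>0 \<gamma> \<theta> R] by (elim exE conjE) (rule that)
  note decay = this(2)[rule_format]
  show ?thesis
  proof (intro exI[of _ "2 * C powr (1 / s)"] exI[of _ B] conjI B allI impI)
    fix h and r i j :: nat
    assume h: "is_racim_density P \<sigma> \<beta> h" and rij: "r \<le> i \<and> i < j"
    define k n where "k = i - r" and "n = j - i"
    have n: "0 < n"
      using rij by (simp add: n_def)
    let ?lim = "\<lambda>\<omega>. (\<lambda>n. \<integral>x. \<bar>cocycle_iterate \<sigma> (\<lambda>\<omega>. transfer (\<beta> \<omega>)) n (int_iterate P \<sigma> (- int n) \<omega>) (\<lambda>_. 1) x
                 - h \<omega> x\<bar> \<partial>leb01) \<longlonglongrightarrow> 0"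
    have "AE \<omega> in P. ?lim \<omega>"
      using h by (simp add: is_racim_density_def)
    then have AE_lim: "AE \<omega> in P. \<forall>t. ?lim (int_iterate P \<sigma> t \<omega>)"
      unfolding AE_all_countable by (intro allI) (rule AE_int_iterate)
    \<comment> \<open>All exceptional null sets are collected at the point
      \<open>\<sigma>\<^sup>i \<omega>\<close>, taken as time \<open>0\<close> of the
      environment.\<close>
    define good_point where "good_point \<omega> \<longleftrightarrow> (\<forall>t. \<beta> (int_iterate P \<sigma> t \<omega>) \<le> \<beta>0) \<and> (\<forall>t. ?lim (int_iterate P \<sigma> t \<omega>)) \<and>
      1 \<le> B \<omega> \<and> (\<forall>K>0. \<not> good_blocks (orbit_env P \<sigma> \<beta> \<omega>) \<gamma> \<theta> (K ^ R) (4 * K) \<longrightarrow>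
       real (K ^ Suc R) powr (1 / \<gamma> - 1) \<le> B \<omega> powr s)" for \<omega>
    have "AE \<omega> in P. good_point \<omega>"
      using AE_\<beta> AE_lim AE_B by eventually_elim (unfold good_point_def, blast)
    then have "AE \<omega> in P. good_point (int_iterate P \<sigma> (int i) \<omega>)"
      by (rule AE_int_iterate)
    then show "AE \<omega> in P. \<forall>g\<^sub>1 g\<^sub>2. is_Lip g\<^sub>1 \<and> is_Lip g\<^sub>2 \<longrightarrow>
          (let \<mu> = racim h ((\<sigma> ^^ j) \<omega>);
               f = centered \<mu> (norm_transfer_iterate \<sigma> \<beta> h (j - i) ((\<sigma> ^^ i) \<omega>)
                     (\<lambda>x. g\<^sub>2 x * norm_transfer_iterate \<sigma> \<beta> h (i - r) ((\<sigma> ^^ r) \<omega>) g\<^sub>1 x))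
           in in_Lp \<mu> s f \<and>
              Lp_norm \<mu> s f \<le> 2 * C powr (1 / s) * (1 + Lip_norm g\<^sub>1) * (1 + Lip_norm g\<^sub>2) * B ((\<sigma> ^^ i) \<omega>)
                * real (j - i) powr (- (1 / s) * (1 / \<gamma> - 1)))"
      using AE_space
    proof (eventually_elim, intro allI impI)
      fix \<omega> g\<^sub>1 g\<^sub>2
      assume gp: "good_point (int_iterate P \<sigma> (int i) \<omega>)" and \<omega>: "\<omega> \<in> space P" and g: "is_Lip g\<^sub>1 \<and> is_Lip g\<^sub>2"
      define \<omega>' where "\<omega>' = int_iterate P \<sigma> (int i) \<omega>"
      have \<omega>': "\<omega>' \<in> space P"
        unfolding \<omega>'_def by (rule int_iterate_space[OF \<omega>])
      have gp': "\<And>t. \<beta> (int_iterate P \<sigma> t \<omega>') \<le> \<beta>0" "\<And>t. ?lim (int_iterate P \<sigma> t \<omega>')" "1 \<le> B \<omega>'"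
        "\<And>K. 0 < K \<Longrightarrow> \<not> good_blocks (orbit_env P \<sigma> \<beta> \<omega>') \<gamma> \<theta> (K ^ R) (4 * K) \<Longrightarrow>
          real (K ^ Suc R) powr (1 / \<gamma> - 1) \<le> B \<omega>' powr s"
        using gp unfolding good_point_def \<omega>'_def by blast+
      define b where "b = orbit_env P \<sigma> \<beta> \<omega>'"
      define H where "H t = h (int_iterate P \<sigma> t \<omega>')" for t
      have env: "lsv_environment b \<beta>0"
        by standard (use assms(3)[OF int_iterate_space[OF \<omega>']] gp'(1) \<beta>0 in \<open>auto simp: b_def orbit_env_def\<close>)
      interpret limit_density b \<beta>0 H
        unfolding b_def H_def using env gp'(2) by (intro limit_density_orbit[OF \<omega>' _ h]) (simp_all add: b_def)
      have norm: "norm_transfer_iterate \<sigma> \<beta> h m (int_iterate P \<sigma> u \<omega>') \<phi> = normalized u m \<phi>" for m u \<phi>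
      proof (induction m)
        case (Suc m)
        let ?\<omega> = "int_iterate P \<sigma> (u + int m) \<omega>'"
        have "norm_transfer_iterate \<sigma> \<beta> h (Suc m) (int_iterate P \<sigma> u \<omega>') \<phi> =
            norm_transfer \<sigma> \<beta> h ?\<omega> (normalized u m \<phi>)"
          using Suc by (simp add: norm_transfer_iterate_def funpow_int_iterate[OF \<omega>'])
        moreover have "\<beta> ?\<omega> = b (u + int m)" "h ?\<omega> = H (u + int m)" "h (\<sigma> ?\<omega>) = H (u + int m + 1)"
          using int_iterate_plus_1[OF \<omega>', of "u + int m"] by (simp_all add: b_def H_def orbit_env_def)
        ultimately show ?case
          by (simp add: norm_transfer_def fun_eq_iff)
      qed (simp add: norm_transfer_iterate_def)
      have pts: "(\<sigma> ^^ i) \<omega> = \<omega>'" "(\<sigma> ^^ r) \<omega> = int_iterate P \<sigma> (- int k) \<omega>'" "(\<sigma> ^^ j) \<omega> = int_iterate P \<sigma> (int n) \<omega>'"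
        unfolding \<omega>'_def int_iterate_add[OF \<omega>] using rij by (simp_all add: int_iterate_of_nat[symmetric] k_def n_def of_nat_diff)
      have \<mu>: "racim h ((\<sigma> ^^ j) \<omega>) = density leb01 (\<lambda>x. ennreal (H (int n) x))"
        by (simp add: pts racim_def H_def)
      have f: "norm_transfer_iterate \<sigma> \<beta> h (j - i) ((\<sigma> ^^ i) \<omega>)
          (\<lambda>x. g\<^sub>2 x * norm_transfer_iterate \<sigma> \<beta> h (i - r) ((\<sigma> ^^ r) \<omega>) g\<^sub>1 x) =
          normalized 0 n (\<lambda>x. g\<^sub>2 x * normalized (- int k) k g\<^sub>1 x)"
        using norm[of n 0] norm[of k "- int k"] by (simp add: pts k_def n_def)
      have l1: "lip_bounded (Lip_norm g\<^sub>1) g\<^sub>1" and l2: "lip_bounded (Lip_norm g\<^sub>2) g\<^sub>2"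
        using g lip_bounded_Lip_norm by auto
      have Bs: "1 \<le> B \<omega>' powr s"
        using gp'(3) assms(9) by (intro ge_one_powr_ge_zero) auto
      have bound: "L1 (evolve b 0 n (defect (evolve b (- int (N + k)) (N + k) (\<lambda>_. 1))
          (observed b k g\<^sub>1 g\<^sub>2 (evolve b (- int (N + k)) N (\<lambda>_. 1)))))
          \<le> C * Lip_norm g\<^sub>1 * Lip_norm g\<^sub>2 * B \<omega>' powr s * real n powr (- (1 / \<gamma> - 1))" for N
        using decay[OF env l1 l2 Bs gp'(4)[folded b_def] n, of N k] unfolding minus_diff_eq by blast
      have B0: "0 \<le> B \<omega>'"
        using gp'(3) by linarith
      note final = centered_Lp_norm_le[OF l1 l2 assms(9) C B0 n bound]
      show "let \<mu> = racim h ((\<sigma> ^^ j) \<omega>);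
               f = centered \<mu> (norm_transfer_iterate \<sigma> \<beta> h (j - i) ((\<sigma> ^^ i) \<omega>)
                     (\<lambda>x. g\<^sub>2 x * norm_transfer_iterate \<sigma> \<beta> h (i - r) ((\<sigma> ^^ r) \<omega>) g\<^sub>1 x))
           in in_Lp \<mu> s f \<and>
              Lp_norm \<mu> s f \<le> 2 * C powr (1 / s) * (1 + Lip_norm g\<^sub>1) * (1 + Lip_norm g\<^sub>2) * B ((\<sigma> ^^ i) \<omega>)
                * real (j - i) powr (- (1 / s) * (1 / \<gamma> - 1))"
        unfolding Let_def \<mu> f unfolding pts(1) n_def[symmetric] using final by blast
    qed
  qed
qed

end
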